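(* Let $\mathbb F$ be the (augmented) filtration generated by a Brownian motion $W$, let $\tau$ be a nonnegative random variable satisfying Jacod's criterion with respect to $\mathbb F$, and let $\mathbb H$ be the initial expansion of $\mathbb F$ with $\tau$. Let $\mathbb G$ be a right-continuous filtration with $\mathbb F\subset\mathbb G\subset\mathbb H$ that makes $\tau$ a stopping time and satisfies $\mathcal G_t\cap\{\tau>t\}=\mathcal F_t\cap\{\tau>t\}$ for all $t\ge0$ (for example, the smallest right-continuous filtration containing $\mathbb F$ and making $\tau$ a stopping time). Let $p_t(u)$ be the $\mathcal F_t$-conditional densities of $\tau$, and write, by martingale representation, $$p_t(u)=p_0(u)+\int_0^tq_s(u)\,dW_s$$ for a family $\{q(u):u\ge0\}$ of $\mathbb F$-predictable processes. Assume that the processes $q(u)$ are (in absolute value, uniformly in $u$) bounded by some integrable process. Let $M$ be an $\mathbb F$-local martingale and let $k_t(u)$ be the function defined in the context. If $$ E\Big(\int_0^t|k_s(\tau)|\,d\langle M,M\rangle_s\Big)<\infty\quad\text{for all }t\ge0, $$ then ${}^oM^{\mathbb H}$ is a $\mathbb G$-local martingale, where $M^{\mathbb H}$ is the local martingale part of the $\mathbb H$-decomposition of $M$ and ${}^o$ denotes optional projection onto $\mathbb G$.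
   Context: All filtrations live on a complete probability space and satisfy the usual hypotheses. For a $\sigma$-field $\mathcal A$ and an event $B$, $\mathcal A\cap B=\{A\cap B:A\in\mathcal A\}$. Initial expansion: $\mathcal H_t=\bigcap_{u>t}(\mathcal F_u\vee\sigma(\tau))$. Jacod's criterion for $\tau$: there is a $\sigma$-finite measure $\eta$ on $\mathcal B(\mathbb R)$ such that for every $t\ge0$, $P(\tau\in\cdot\mid\mathcal F_t)(\omega)\ll\eta$ a.s. Then $p_t(u;\omega)=P(\tau\in du\mid\mathcal F_t)(\omega)/\eta(du)$, chosen càdlàg in $t$ and measurable for the optional $\sigma$-field of the filtration $\widehat{\mathcal F}_t=\bigcap_{u>t}\mathcal B(\mathbb R)\otimes\mathcal F_u$. The function $k$ (from Jacod's theorem): $k_t(u;\omega)$ is an $\widehat{\mathbb F}$-predictable function such that for $\eta$-a.e. $u$, $\langle p(u),M\rangle_t=\int_0^tk_s(u)p_{s-}(u)\,d\langle M,M\rangle_s$ on $\{p_-(u)>0\}$, $\int_0^t|k_s(\tau)|\,d\langle M,M\rangle_s<\infty$ a.s. for every $t$, and $M^{\mathbb H}_t=M_t-\int_0^tk_s(\tau)\,d\langle M,M\rangle_s$ is an $\mathbb H$-local martingale. *)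

theory Defs
  imports "HOL-Probability.Probability"
begin

section \<open>Filtrations and processes in continuous time\<close>

text \<open>
  A process is a function of type \<open>real \<Rightarrow> 'a \<Rightarrow> real\<close> and a family of \<open>\<sigma>\<close>-fields is a function of
  type \<open>real \<Rightarrow> 'a measure\<close>. In both cases only the values at times \<open>t \<ge> 0\<close> are meaningful; the
  library locale \<open>filtration\<close> is not used because it would constrain negative times as well, and
  because its stopping times cannot take the value \<open>\<infinity>\<close>. Only the spaces and the
  measurable sets of the members of a filtration matter, not their emeasures.
\<close>

definition filtration_on :: "'a measure \<Rightarrow> (real \<Rightarrow> 'a measure) \<Rightarrow> bool" where
  "filtration_on P F \<longleftrightarrow>
     (\<forall>t\<ge>0. subalgebra P (F t)) \<and> (\<forall>s t. 0 \<le> s \<longrightarrow> s \<le> t \<longrightarrow> sets (F s) \<subseteq> sets (F t))"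

definition right_continuous_filtration :: "(real \<Rightarrow> 'a measure) \<Rightarrow> bool" where
  "right_continuous_filtration F \<longleftrightarrow> (\<forall>t\<ge>0. sets (F t) = (\<Inter>u\<in>{t<..}. sets (F u)))"

definition adapted :: "(real \<Rightarrow> 'a measure) \<Rightarrow> (real \<Rightarrow> 'a \<Rightarrow> real) \<Rightarrow> bool" where
  "adapted F X \<longleftrightarrow> (\<forall>t\<ge>0. X t \<in> borel_measurable (F t))"

definition cadlag :: "(real \<Rightarrow> real) \<Rightarrow> bool" where
  "cadlag f \<longleftrightarrow>
     (\<forall>t\<ge>0. (f \<longlongrightarrow> f t) (at_right t)) \<and> (\<forall>t>0. \<exists>l. (f \<longlongrightarrow> l) (at_left t))"

text \<open>The left limit \<open>f\<^bsub>t-\<^esub>\<close>, with the convention \<open>f\<^bsub>0-\<^esub> = f\<^bsub>0\<^esub>\<close>.\<close>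

definition left_lim :: "(real \<Rightarrow> real) \<Rightarrow> real \<Rightarrow> real" where
  "left_lim f t = (if t \<le> 0 then f 0 else Lim (at_left t) f)"

definition finite_variation_path :: "(real \<Rightarrow> real) \<Rightarrow> bool" where
  "finite_variation_path f \<longleftrightarrow>
     (\<exists>a b. mono_on {0..} a \<and> mono_on {0..} b \<and> (\<forall>t\<ge>0. f t = a t - b t))"

text \<open>The optional and predictable \<open>\<sigma>\<close>-fields, on the product of the half-line with the space.\<close>

definition optional_sigma :: "(real \<Rightarrow> 'a measure) \<Rightarrow> (real \<times> 'a) measure" where
  "optional_sigma F = sigma ({0..} \<times> space (F 0))
     {{(t, \<omega>) \<in> {0..} \<times> space (F 0). X t \<omega> \<in> B} | X B.
        adapted F X \<and> (\<forall>\<omega>\<in>space (F 0). cadlag (\<lambda>t. X t \<omega>)) \<and> B \<in> sets borel}"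

definition predictable_sigma :: "(real \<Rightarrow> 'a measure) \<Rightarrow> (real \<times> 'a) measure" where
  "predictable_sigma F = sigma ({0..} \<times> space (F 0))
     ({{0} \<times> A | A. A \<in> sets (F 0)} \<union>
      {{s<..t} \<times> A | s t A. 0 \<le> s \<and> s \<le> t \<and> A \<in> sets (F s)})"

definition optional_process :: "(real \<Rightarrow> 'a measure) \<Rightarrow> (real \<Rightarrow> 'a \<Rightarrow> real) \<Rightarrow> bool" where
  "optional_process F X \<longleftrightarrow> (\<lambda>(t, \<omega>). X t \<omega>) \<in> borel_measurable (optional_sigma F)"

definition predictable_process :: "(real \<Rightarrow> 'a measure) \<Rightarrow> (real \<Rightarrow> 'a \<Rightarrow> real) \<Rightarrow> bool" where
  "predictable_process F X \<longleftrightarrow> (\<lambda>(t, \<omega>). X t \<omega>) \<in> borel_measurable (predictable_sigma F)"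

text \<open>The filtration \<open>\<Inter>\<^bsub>u>t\<^esub> B(\<real>) \<otimes> F\<^bsub>u\<^esub>\<close> on the product of the real line with the space.\<close>

definition hat_filtration :: "(real \<Rightarrow> 'a measure) \<Rightarrow> real \<Rightarrow> (real \<times> 'a) measure" where
  "hat_filtration F t =
     sigma (UNIV \<times> space (F 0)) (\<Inter>u\<in>{t<..}. sets ((borel :: real measure) \<Otimes>\<^sub>M F u))"


section \<open>Stopping times, martingales and local martingales\<close>

definition stop_time :: "'a measure \<Rightarrow> (real \<Rightarrow> 'a measure) \<Rightarrow> ('a \<Rightarrow> ennreal) \<Rightarrow> bool" where
  "stop_time P F T \<longleftrightarrow> (\<forall>t\<ge>0. {\<omega> \<in> space P. T \<omega> \<le> ennreal t} \<in> sets (F t))"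

definition stop_sigma ::
    "'a measure \<Rightarrow> (real \<Rightarrow> 'a measure) \<Rightarrow> ('a \<Rightarrow> ennreal) \<Rightarrow> 'a measure" where
  "stop_sigma P F T = sigma (space P)
     {A \<in> sets P. \<forall>t\<ge>0. {\<omega> \<in> A. T \<omega> \<le> ennreal t} \<in> sets (F t)}"

text \<open>The random variable \<open>X\<^bsub>T\<^esub> 1\<^bsub>{T<\<infinity>}\<^esub>\<close>.\<close>

definition value_at :: "(real \<Rightarrow> 'a \<Rightarrow> real) \<Rightarrow> ('a \<Rightarrow> ennreal) \<Rightarrow> 'a \<Rightarrow> real" where
  "value_at X T \<omega> = (if T \<omega> < \<infinity> then X (enn2real (T \<omega>)) \<omega> else 0)"

text \<open>The process \<open>X\<^bsub>t \<and> T\<^esub> 1\<^bsub>{T>0}\<^esub>\<close>.\<close>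

definition stopped_process ::
    "(real \<Rightarrow> 'a \<Rightarrow> real) \<Rightarrow> ('a \<Rightarrow> ennreal) \<Rightarrow> real \<Rightarrow> 'a \<Rightarrow> real" where
  "stopped_process X T t \<omega> = (if 0 < T \<omega> then X (enn2real (min (ennreal t) (T \<omega>))) \<omega> else 0)"

definition martingale ::
    "'a measure \<Rightarrow> (real \<Rightarrow> 'a measure) \<Rightarrow> (real \<Rightarrow> 'a \<Rightarrow> real) \<Rightarrow> bool" where
  "martingale P F X \<longleftrightarrow>
     adapted F X \<and> (AE \<omega> in P. cadlag (\<lambda>t. X t \<omega>)) \<and> (\<forall>t\<ge>0. integrable P (X t)) \<and>
     (\<forall>s t. 0 \<le> s \<longrightarrow> s \<le> t \<longrightarrow> (AE \<omega> in P. real_cond_exp P (F s) (X t) \<omega> = X s \<omega>))"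

definition local_martingale ::
    "'a measure \<Rightarrow> (real \<Rightarrow> 'a measure) \<Rightarrow> (real \<Rightarrow> 'a \<Rightarrow> real) \<Rightarrow> bool" where
  "local_martingale P F X \<longleftrightarrow>
     adapted F X \<and> (AE \<omega> in P. cadlag (\<lambda>t. X t \<omega>)) \<and>
     (\<exists>T :: nat \<Rightarrow> 'a \<Rightarrow> ennreal.
        (\<forall>n. stop_time P F (T n)) \<and>
        (AE \<omega> in P. incseq (\<lambda>n. T n \<omega>) \<and> (\<lambda>n. T n \<omega>) \<longlonglongrightarrow> \<infinity>) \<and>
        (\<forall>n. martingale P F (stopped_process X (T n))))"

text \<open>
  \<open>C\<close> is a version of the predictable bracket \<open>\<langle>X, Y\<rangle>\<close> of two local martingales, normalised
  by \<open>C\<^bsub>0\<^esub> = 0\<close>. The version \<open>\<langle>X, X\<rangle>\<close> is moreover required to have increasing paths.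
\<close>

definition angle_bracket ::
    "'a measure \<Rightarrow> (real \<Rightarrow> 'a measure) \<Rightarrow> (real \<Rightarrow> 'a \<Rightarrow> real) \<Rightarrow> (real \<Rightarrow> 'a \<Rightarrow> real)
      \<Rightarrow> (real \<Rightarrow> 'a \<Rightarrow> real) \<Rightarrow> bool" where
  "angle_bracket P F X Y C \<longleftrightarrow>
     local_martingale P F X \<and> local_martingale P F Y \<and> predictable_process F C \<and>
     (AE \<omega> in P. C 0 \<omega> = 0 \<and> cadlag (\<lambda>t. C t \<omega>) \<and> finite_variation_path (\<lambda>t. C t \<omega>)) \<and>
     local_martingale P F (\<lambda>t \<omega>. X t \<omega> * Y t \<omega> - C t \<omega>)"

definition angle_bracket_self ::
    "'a measure \<Rightarrow> (real \<Rightarrow> 'a measure) \<Rightarrow> (real \<Rightarrow> 'a \<Rightarrow> real) \<Rightarrow> (real \<Rightarrow> 'a \<Rightarrow> real) \<Rightarrow> bool" where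
  "angle_bracket_self P F X C \<longleftrightarrow>
     angle_bracket P F X X C \<and> (AE \<omega> in P. mono_on {0..} (\<lambda>t. C t \<omega>))"

text \<open>
  The Lebesgue--Stieltjes measure \<open>dC\<^bsub>s\<^esub>(\<omega>)\<close> of an increasing right-continuous path; the path is
  extended by its value at \<open>0\<close> to negative times. Integrals \<open>\<integral>\<^bsub>0\<^esub>\<^bsup>t\<^esup>\<close> are over \<open>{0<..t}\<close>.
\<close>

definition path_measure :: "(real \<Rightarrow> 'a \<Rightarrow> real) \<Rightarrow> 'a \<Rightarrow> real measure" where
  "path_measure C \<omega> = interval_measure (\<lambda>s. C (max 0 s) \<omega>)"


section \<open>Brownian motion and the It\^o integral\<close>

definition brownian_motion :: "'a measure \<Rightarrow> (real \<Rightarrow> 'a \<Rightarrow> real) \<Rightarrow> bool" where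
  "brownian_motion P W \<longleftrightarrow>
     (\<forall>t\<ge>0. W t \<in> borel_measurable P) \<and>
     (AE \<omega> in P. W 0 \<omega> = 0 \<and> continuous_on {0..} (\<lambda>t. W t \<omega>)) \<and>
     (\<forall>s t. 0 \<le> s \<longrightarrow> s < t \<longrightarrow>
        distributed P lborel (\<lambda>\<omega>. W t \<omega> - W s \<omega>) (normal_density 0 (sqrt (t - s)))) \<and>
     (\<forall>(n :: nat) (ts :: nat \<Rightarrow> real). 0 \<le> ts 0 \<longrightarrow> (\<forall>i<n. ts i < ts (Suc i)) \<longrightarrow>
        prob_space.indep_vars P (\<lambda>_. borel) (\<lambda>i \<omega>. W (ts (Suc i)) \<omega> - W (ts i) \<omega>) {..<n})"

text \<open>The filtration generated by \<open>W\<close>, made complete and right-continuous.\<close>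

definition augmented_filtration ::
    "'a measure \<Rightarrow> (real \<Rightarrow> 'a \<Rightarrow> real) \<Rightarrow> real \<Rightarrow> 'a measure" where
  "augmented_filtration P W t = sigma (space P)
     (\<Inter>u\<in>{t<..}. sigma_sets (space P)
        ({W s -` B \<inter> space P | s B. 0 \<le> s \<and> s \<le> u \<and> B \<in> sets borel} \<union> null_sets P))"

text \<open>
  The data \<open>(n, ts, \<xi>)\<close> represent the simple predictable process
  \<open>\<Sum>i<n. \<xi>\<^bsub>i\<^esub> 1\<^bsub>(t\<^sub>i, t\<^bsub>i+1\<^esub>]\<^esub>\<close> with bounded \<open>F\<^bsub>t\<^sub>i\<^esub>\<close>-measurable \<open>\<xi>\<^bsub>i\<^esub>\<close>.
\<close>

definition simple_integrand ::
    "'a measure \<Rightarrow> (real \<Rightarrow> 'a measure) \<Rightarrow> nat \<Rightarrow> (nat \<Rightarrow> real) \<Rightarrow> (nat \<Rightarrow> 'a \<Rightarrow> real) \<Rightarrow> bool" where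
  "simple_integrand P F n ts \<xi> \<longleftrightarrow>
     0 \<le> ts 0 \<and> (\<forall>i<n. ts i \<le> ts (Suc i)) \<and>
     (\<forall>i<n. \<xi> i \<in> borel_measurable (F (ts i)) \<and> (\<exists>c. \<forall>\<omega>\<in>space P. \<bar>\<xi> i \<omega>\<bar> \<le> c))"

definition simple_value ::
    "nat \<Rightarrow> (nat \<Rightarrow> real) \<Rightarrow> (nat \<Rightarrow> 'a \<Rightarrow> real) \<Rightarrow> real \<Rightarrow> 'a \<Rightarrow> real" where
  "simple_value n ts \<xi> s \<omega> = (\<Sum>i<n. \<xi> i \<omega> * indicator {ts i<..ts (Suc i)} s)"

definition simple_integral ::
    "(real \<Rightarrow> 'a \<Rightarrow> real) \<Rightarrow> nat \<Rightarrow> (nat \<Rightarrow> real) \<Rightarrow> (nat \<Rightarrow> 'a \<Rightarrow> real) \<Rightarrow> real \<Rightarrow> 'a \<Rightarrow> real" where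
  "simple_integral W n ts \<xi> t \<omega> =
     (\<Sum>i<n. \<xi> i \<omega> * (W (min t (ts (Suc i))) \<omega> - W (min t (ts i)) \<omega>))"

definition null_in_probability :: "'a measure \<Rightarrow> (nat \<Rightarrow> 'a \<Rightarrow> ennreal) \<Rightarrow> bool" where
  "null_in_probability P Z \<longleftrightarrow>
     (\<forall>e::real. e > 0 \<longrightarrow> (\<lambda>j. measure P {\<omega> \<in> space P. ennreal e < Z j \<omega>}) \<longlonglongrightarrow> 0)"

text \<open>
  \<open>Y\<close> is (the continuous version of) the It\^o integral \<open>\<integral> q dW\<close>, where \<open>q\<close> is predictable with
  \<open>\<integral>\<^bsub>0\<^esub>\<^bsup>t\<^esup> q\<^bsub>s\<^esub>\<^sup>2 ds < \<infinity>\<close> almost surely. Limits in probability are used, so that \<open>q\<close> need not be square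
  integrable with respect to \<open>P\<close>. Continuity of \<open>Y\<close> and the limit at every fixed \<open>t\<close>
  determine \<open>Y\<close> up to indistinguishability.
\<close>

definition ito_integral ::
    "'a measure \<Rightarrow> (real \<Rightarrow> 'a measure) \<Rightarrow> (real \<Rightarrow> 'a \<Rightarrow> real) \<Rightarrow> (real \<Rightarrow> 'a \<Rightarrow> real)
      \<Rightarrow> (real \<Rightarrow> 'a \<Rightarrow> real) \<Rightarrow> bool" where
  "ito_integral P F W q Y \<longleftrightarrow>
     predictable_process F q \<and>
     (AE \<omega> in P. \<forall>t\<ge>0. (\<integral>\<^sup>+s\<in>{0..t}. ennreal ((q s \<omega>)\<^sup>2) \<partial>lborel) < \<infinity>) \<and>
     adapted F Y \<and> (AE \<omega> in P. continuous_on {0..} (\<lambda>t. Y t \<omega>)) \<and>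
     (\<exists>(n :: nat \<Rightarrow> nat) (ts :: nat \<Rightarrow> nat \<Rightarrow> real) (\<xi> :: nat \<Rightarrow> nat \<Rightarrow> 'a \<Rightarrow> real).
        (\<forall>j. simple_integrand P F (n j) (ts j) (\<xi> j)) \<and>
        (\<forall>t\<ge>0.
           null_in_probability P (\<lambda>j \<omega>.
             \<integral>\<^sup>+s\<in>{0..t}. ennreal ((simple_value (n j) (ts j) (\<xi> j) s \<omega> - q s \<omega>)\<^sup>2) \<partial>lborel) \<and>
           null_in_probability P (\<lambda>j \<omega>.
             ennreal \<bar>simple_integral W (n j) (ts j) (\<xi> j) t \<omega> - Y t \<omega>\<bar>)))"


section \<open>Initial expansion, Jacod's criterion and the conditional densities\<close>

definition initial_expansion ::
    "'a measure \<Rightarrow> (real \<Rightarrow> 'a measure) \<Rightarrow> ('a \<Rightarrow> real) \<Rightarrow> real \<Rightarrow> 'a measure" where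
  "initial_expansion P F \<tau> t = sigma (space P)
     (\<Inter>u\<in>{t<..}. sigma_sets (space P)
        (sets (F u) \<union> {\<tau> -` B \<inter> space P | B. B \<in> sets borel}))"

text \<open>\<open>\<kappa>\<close> is a regular version of the conditional law \<open>P(\<tau> \<in> \<cdot> | A)\<close>.\<close>

definition conditional_law ::
    "'a measure \<Rightarrow> 'a measure \<Rightarrow> ('a \<Rightarrow> real) \<Rightarrow> ('a \<Rightarrow> real measure) \<Rightarrow> bool" where
  "conditional_law P A \<tau> \<kappa> \<longleftrightarrow>
     \<kappa> \<in> A \<rightarrow>\<^sub>M prob_algebra borel \<and>
     (\<forall>B\<in>sets borel. AE \<omega> in P.
        measure (\<kappa> \<omega>) B = real_cond_exp P A (indicator (\<tau> -` B \<inter> space P)) \<omega>)"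

definition jacod_criterion ::
    "'a measure \<Rightarrow> (real \<Rightarrow> 'a measure) \<Rightarrow> ('a \<Rightarrow> real) \<Rightarrow> real measure \<Rightarrow> bool" where
  "jacod_criterion P F \<tau> \<eta> \<longleftrightarrow>
     sets \<eta> = sets borel \<and> sigma_finite_measure \<eta> \<and>
     (\<forall>t\<ge>0. \<exists>\<kappa>. conditional_law P (F t) \<tau> \<kappa> \<and> (AE \<omega> in P. absolutely_continuous \<eta> (\<kappa> \<omega>)))"

text \<open>\<open>p t u \<omega>\<close> stands for \<open>p\<^bsub>t\<^esub>(u; \<omega>) = P(\<tau> \<in> du | F\<^bsub>t\<^esub>)(\<omega>) / \<eta>(du)\<close>.\<close>

definition conditional_density ::
    "'a measure \<Rightarrow> (real \<Rightarrow> 'a measure) \<Rightarrow> ('a \<Rightarrow> real) \<Rightarrow> real measure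
      \<Rightarrow> (real \<Rightarrow> real \<Rightarrow> 'a \<Rightarrow> real) \<Rightarrow> bool" where
  "conditional_density P F \<tau> \<eta> p \<longleftrightarrow>
     optional_process (hat_filtration F) (\<lambda>t (u, \<omega>). p t u \<omega>) \<and>
     (\<forall>u. \<forall>\<omega>\<in>space P. cadlag (\<lambda>t. p t u \<omega>) \<and> (\<forall>t\<ge>0. 0 \<le> p t u \<omega>)) \<and>
     (\<forall>t\<ge>0. \<exists>\<kappa>. conditional_law P (F t) \<tau> \<kappa> \<and>
        (AE \<omega> in P. \<kappa> \<omega> = density \<eta> (\<lambda>u. ennreal (p t u \<omega>))))"

text \<open>
  The process \<open>M\<^bsub>t\<^esub> - \<integral>\<^bsub>0\<^esub>\<^bsup>t\<^esup> k\<^bsub>s\<^esub>(\<tau>) dC\<^bsub>s\<^esub>\<close>, where \<open>C\<close> plays the role of \<open>\<langle>M, M\<rangle>\<close>.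
\<close>

definition expansion_part ::
    "(real \<Rightarrow> 'a \<Rightarrow> real) \<Rightarrow> (real \<Rightarrow> 'a \<Rightarrow> real) \<Rightarrow> (real \<Rightarrow> real \<Rightarrow> 'a \<Rightarrow> real) \<Rightarrow> ('a \<Rightarrow> real)
      \<Rightarrow> real \<Rightarrow> 'a \<Rightarrow> real" where
  "expansion_part M C k \<tau> t \<omega> = M t \<omega> - (LINT s:{0<..t}|path_measure C \<omega>. k s (\<tau> \<omega>) \<omega>)"

text \<open>
  The properties of the function \<open>k\<close> in Jacod's theorem; \<open>C\<close> is a version of \<open>\<langle>M, M\<rangle>\<close> and \<open>D\<close>
  one of \<open>\<langle>p(u), M\<rangle>\<close>. That the latter equals \<open>\<integral> k(u) p\<^bsub>-\<^esub>(u) d\<langle>M, M\<rangle>\<close> on \<open>{p\<^bsub>-\<^esub>(u) > 0}\<close> is an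
  identity at all \<open>(t, \<omega>)\<close> with \<open>p\<^bsub>t-\<^esub>(u; \<omega>) > 0\<close>, outside an evanescent set.
\<close>

definition jacod_function ::
    "'a measure \<Rightarrow> (real \<Rightarrow> 'a measure) \<Rightarrow> ('a \<Rightarrow> real) \<Rightarrow> real measure
      \<Rightarrow> (real \<Rightarrow> real \<Rightarrow> 'a \<Rightarrow> real) \<Rightarrow> (real \<Rightarrow> 'a \<Rightarrow> real) \<Rightarrow> (real \<Rightarrow> 'a \<Rightarrow> real)
      \<Rightarrow> (real \<Rightarrow> real \<Rightarrow> 'a \<Rightarrow> real) \<Rightarrow> bool" where
  "jacod_function P F \<tau> \<eta> p M C k \<longleftrightarrow>
     predictable_process (hat_filtration F) (\<lambda>t (u, \<omega>). k t u \<omega>) \<and>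
     (AE u in \<eta>. \<exists>D. angle_bracket P F (\<lambda>t. p t u) M D \<and>
        (AE \<omega> in P. \<forall>t\<ge>0. left_lim (\<lambda>s. p s u \<omega>) t > 0 \<longrightarrow>
           has_bochner_integral (path_measure C \<omega>)
             (\<lambda>s. indicator {0<..t} s * (k s u \<omega> * left_lim (\<lambda>r. p r u \<omega>) s)) (D t \<omega>))) \<and>
     (AE \<omega> in P. \<forall>t\<ge>0.
        (\<integral>\<^sup>+s\<in>{0<..t}. ennreal \<bar>k s (\<tau> \<omega>) \<omega>\<bar> \<partial>path_measure C \<omega>) < \<infinity>) \<and>
     local_martingale P (initial_expansion P F \<tau>) (expansion_part M C k \<tau>)"


section \<open>Optional projection\<close>

text \<open>
  \<open>N\<close> is a version of the optional projection of \<open>X\<close> onto \<open>G\<close>: it is \<open>G\<close>-optional and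
  \<open>N\<^bsub>T\<^esub> = E[X\<^bsub>T\<^esub> | G\<^bsub>T\<^esub>]\<close> a.s. on \<open>{T < \<infinity>}\<close> for every \<open>G\<close>-stopping time \<open>T\<close>. Since \<open>X\<^bsub>T\<^esub>\<close> need not be
  integrable, the conditional expectation is the generalised one, that is, the difference of the
  conditional expectations of the positive and negative parts, which is what \<open>real_cond_exp\<close> is by
  definition; it is meaningful when \<open>E[|X\<^bsub>T\<^esub>| 1\<^bsub>{T<\<infinity>}\<^esub> | G\<^bsub>T\<^esub>] < \<infinity>\<close> a.s. The optional projection is
  unique up to indistinguishability.
\<close>

definition is_optional_projection ::
    "'a measure \<Rightarrow> (real \<Rightarrow> 'a measure) \<Rightarrow> (real \<Rightarrow> 'a \<Rightarrow> real) \<Rightarrow> (real \<Rightarrow> 'a \<Rightarrow> real) \<Rightarrow> bool" where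
  "is_optional_projection P G X N \<longleftrightarrow>
     optional_process G N \<and>
     (\<forall>T. stop_time P G T \<longrightarrow>
        value_at X T \<in> borel_measurable P \<and>
        (AE \<omega> in P. nn_cond_exp P (stop_sigma P G T) (\<lambda>\<omega>. ennreal \<bar>value_at X T \<omega>\<bar>) \<omega> < \<infinity>) \<and>
        (AE \<omega> in P. value_at N T \<omega> = real_cond_exp P (stop_sigma P G T) (value_at X T) \<omega>))"

end

theory Submission
  imports Defs
begin

text \<open>
  Since \<open>M\<close> is a local martingale of the smallest filtration \<open>F\<close>, it has a reducing sequence \<open>S\<^sub>n\<close> of
  \<open>F\<close>-stopping times, which after intersection with the times at which \<open>\<bar>M\<bar>\<close> exceeds \<open>n\<close> makes the
  supremum of \<open>\<bar>M\<bar>\<close> up to \<open>S\<^sub>n \<and> t\<close> integrable. The drift \<open>\<integral> k\<^sub>s(\<tau>) d\<langle>M, M\<rangle>\<^sub>s\<close> is bounded on \<open>[0, t]\<close> by an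
  integrable variable, so the \<open>H\<close>-local martingale \<open>X = M\<^sup>H\<close> stopped at \<open>S\<^sub>n\<close> is a true \<open>H\<close>-martingale.
  Let \<open>N\<close> be the optional projection of \<open>X\<close> and \<open>A \<in> G\<^sub>s\<close>, \<open>s \<le> t\<close>. On \<open>A \<inter> {S\<^sub>n \<le> s}\<close> the stopped process \<open>N\<close> does
  not move between \<open>s\<close> and \<open>t\<close>, while \<open>A \<inter> {S\<^sub>n > s}\<close> belongs to \<open>G\<close> at the times \<open>S\<^sub>n \<and> s\<close> and \<open>S\<^sub>n \<and> t\<close>, where \<open>N\<close> and
  \<open>X\<close> have the same integral; hence \<open>N\<close> stopped at \<open>S\<^sub>n\<close> is a \<open>G\<close>-martingale.

  A version \<open>N\<close> with regular paths exists because the \<open>G\<close>-martingale closed by \<open>X\<close> at \<open>S\<^sub>n \<and> n\<close> has one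
  by Doob's upcrossing inequality, agrees with the projection of \<open>X\<close> before \<open>S\<^sub>n \<and> n\<close> by optional
  stopping, and these versions can therefore be pasted together along \<open>n\<close>.
\<close>

section \<open>Regular paths and upcrossings\<close>

text \<open>The obstacle is that the times reducing \<open>X\<close> in \<open>H\<close> need not be
  stopping times of \<open>G\<close>, so the reduced processes say nothing directly about the
  projection. They enter only under a limit: dominated convergence along them turns optional
  stopping of the reduced processes into identities for \<open>X\<close> itself, at times bounded by
  some \<open>S n\<close>.

  At a general stopping time \<open>X\<close> need not be integrable. Every identity is therefore
  tested on an event of the past of that time on which \<open>S n\<close> is positive and not yet
  exceeded. Up to a null set, such events and the event that the time is infinite exhaust the space,
  and a conditional expectation may be checked on each of them separately. Positivity of
  \<open>S n\<close> is demanded because a stopped process is by definition zero where the stopping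
  time is zero.

  Optional stopping and the construction of regular versions rest on the same form of uniform
  integrability: on the event where an approximating variable is large, its integral is dominated by
  that of one fixed closing variable.\<close>

lemma frequently_at_dense:
  assumes "frequently P (at x within S)" "open U" "x \<in> U"
  obtains y where "y \<in> S" "y \<in> U" "y \<noteq> x" "P y"
proof -
  have ev: "eventually (\<lambda>y. y \<in> U \<and> y \<in> S \<and> y \<noteq> x) (at x within S)"
    using assms by (auto simp: eventually_at_topological)
  have "frequently (\<lambda>y. (y \<in> U \<and> y \<in> S \<and> y \<noteq> x) \<and> P y) (at x within S)"
    by (rule frequently_eventually_conj[OF assms(1) ev])
  then show ?thesis using that by (auto dest: frequently_ex)
qed

text \<open>Between distinct lower and upper limits lie two rational levels, each passed frequently,
  which is the excluded oscillation. With rational levels only countably many pairs have to be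
  treated almost surely later on. The eventual bound makes both extended limits finite.\<close>

lemma convergent_of_no_oscillation:
  fixes f :: "'a \<Rightarrow> real"
  assumes F: "F \<noteq> bot" and bdd: "eventually (\<lambda>x. \<bar>f x\<bar> \<le> B) F"
    and osc: "\<And>a b. a \<in> \<rat> \<Longrightarrow> b \<in> \<rat> \<Longrightarrow> a < b \<Longrightarrow>
      \<not> ((\<exists>\<^sub>F x in F. f x < a) \<and> (\<exists>\<^sub>F x in F. b < f x))"
  shows "\<exists>l. (f \<longlongrightarrow> l) F"
proof -
  let ?g = "\<lambda>x. ereal (f x)"
  have lo: "ereal (-B) \<le> Liminf F ?g"
    by (rule Liminf_bounded) (use bdd in \<open>auto elim!: eventually_mono\<close>)
  have hi: "Limsup F ?g \<le> ereal B"
    by (rule Limsup_bounded) (use bdd in \<open>auto elim!: eventually_mono\<close>)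
  have le: "Liminf F ?g \<le> Limsup F ?g" by (rule Liminf_le_Limsup[OF F])
  have eq: "Liminf F ?g = Limsup F ?g"
  proof (rule ccontr)
    assume "Liminf F ?g \<noteq> Limsup F ?g"
    then have lt: "Liminf F ?g < Limsup F ?g" using le by simp
    obtain x where x: "Liminf F ?g = ereal x"
      using lo hi le by (cases "Liminf F ?g") auto
    obtain y where y: "Limsup F ?g = ereal y"
      using lo hi le by (cases "Limsup F ?g") auto
    have "x < y" using lt x y by simp
    then obtain b where b: "b \<in> \<rat>" "x < b" "b < y" using Rats_dense_in_real by blast
    then obtain a where a: "a \<in> \<rat>" "x < a" "a < b" using Rats_dense_in_real by blast
    have "\<exists>\<^sub>F z in F. f z < a"
    proof (rule ccontr)
      assume "\<not> ?thesis"
      then have "eventually (\<lambda>z. ereal a \<le> ?g z) F" by (simp add: not_frequently not_less)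
      then have "ereal a \<le> Liminf F ?g" by (rule Liminf_bounded)
      then show False using x a by simp
    qed
    moreover have "\<exists>\<^sub>F z in F. b < f z"
    proof (rule ccontr)
      assume "\<not> ?thesis"
      then have "eventually (\<lambda>z. ?g z \<le> ereal b) F" by (simp add: not_frequently not_less)
      then have "Limsup F ?g \<le> ereal b" by (rule Limsup_bounded)
      then show False using y b by simp
    qed
    ultimately show False using osc[of a b] a b by auto
  qed
  obtain x where x: "Liminf F ?g = ereal x"
    using lo hi le by (cases "Liminf F ?g") auto
  have "(?g \<longlongrightarrow> ereal x) F"
    by (rule Liminf_eq_Limsup[OF F]) (use x eq in auto)
  then show ?thesis by auto
qed

text \<open>The flag tells whether the trader who buys below \<open>a\<close> and sells above \<open>b\<close> currently holds the
  stock; recursion from the front makes both the path argument and the upcrossing inequality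
  inductions on the list.\<close>

fun upcrossings :: "real \<Rightarrow> real \<Rightarrow> bool \<Rightarrow> real list \<Rightarrow> nat" where
  "upcrossings a b h [] = 0"
| "upcrossings a b False (x # xs) = upcrossings a b (x < a) xs"
| "upcrossings a b True (x # xs) =
     (if b < x then Suc (upcrossings a b False xs) else upcrossings a b True xs)"

text \<open>Holding the stock already is worth at most one additional sale. Since
  \<open>a < b\<close>, no single price triggers both a purchase and a sale, and this closes the
  induction.\<close>

lemma upcrossings_hold_diff:
  assumes "a < b"
  shows "upcrossings a b False xs \<le> upcrossings a b True xs
    \<and> upcrossings a b True xs \<le> Suc (upcrossings a b False xs)"
proof (induction xs)
  case (Cons x xs)
  then show ?case using assms by (cases "x < a") auto
qed simp

text \<open>Seeing more prices never hurts the trader: an additional purchase can only raise the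
  later count, and an additional sale is compensated by its own \<open>Suc\<close>, both by the
  preceding comparison. This monotonicity reduces arbitrary finite lists to an exhausting sequence
  of finite grids.\<close>

lemma upcrossings_subseq:
  assumes "a < b" "subseq xs ys"
  shows "upcrossings a b h xs \<le> upcrossings a b h ys"
  using assms(2)
proof (induction arbitrary: h rule: list_emb.induct)
  case (list_emb_Nil ys)
  then show ?case by simp
next
  case (list_emb_Cons xs ys y)
  have "upcrossings a b h xs \<le> upcrossings a b h ys" by (rule list_emb_Cons.IH)
  also have "\<dots> \<le> upcrossings a b h (y # ys)"
    using upcrossings_hold_diff[OF assms(1), of ys] by (cases h; cases "y < a") auto
  finally show ?case .
next
  case (list_emb_Cons2 x y xs ys)
  then show ?case by (cases h) auto
qed

lemma upcrossings_le_length: "upcrossings a b h xs \<le> length xs"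
  by (induction a b h xs rule: upcrossings.induct) (auto intro: le_SucI)

lemma sorted_list_of_set_subseq:
  assumes "finite B" "A \<subseteq> B"
  shows "subseq (sorted_list_of_set A) (sorted_list_of_set (B :: 'a::linorder set))"
proof -
  have "finite A" using assms finite_subset by blast
  then have "sorted_list_of_set A = filter (\<lambda>x. x \<in> A) (sorted_list_of_set B)"
    by (intro sorted_distinct_set_unique)
      (use assms in \<open>auto intro: sorted_filter[where f="\<lambda>x. x", simplified]\<close>)
  then show ?thesis by simp
qed

text \<open>Every round puts one more upcrossing in front of the list, closer to \<open>t\<close>
  than all points so far. Therefore the high point \<open>d2\<close> is chosen first and the low
  point \<open>d1\<close> afterwards, between \<open>t\<close> and \<open>d2\<close>.\<close>

lemma upcrossings_right:
  fixes f :: "real \<Rightarrow> real"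
  assumes "a < b" "frequently (\<lambda>x. f x < a) (at t within S)"
    "frequently (\<lambda>x. b < f x) (at t within S)" "S \<subseteq> {t<..}" "t < s"
  shows "\<exists>xs. sorted_wrt (<) xs \<and> set xs \<subseteq> S \<inter> {t<..<s} \<and> n \<le> upcrossings a b False (map f xs)"
  using assms(5)
proof (induction n arbitrary: s)
  case 0
  then show ?case by (auto intro: exI[of _ "[]"])
next
  case (Suc n)
  then obtain xs where xs: "sorted_wrt (<) xs" "set xs \<subseteq> S \<inter> {t<..<s}"
    "n \<le> upcrossings a b False (map f xs)" by blast
  \<comment> \<open>Inserting \<open>s\<close> covers the empty list and keeps the new points below
    \<open>s\<close>.\<close>
  define m where "m = Min (insert s (set xs))"
  have m: "t < m" "m \<le> s" "\<And>x. x \<in> set xs \<Longrightarrow> m \<le> x"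
    using Suc.prems xs(2) by (auto simp: m_def)
  obtain d2 where d2: "d2 \<in> S" "d2 < m" "b < f d2"
    using frequently_at_dense[OF assms(3), of "{..<m}"] m(1) by auto
  obtain d1 where d1: "d1 \<in> S" "d1 < d2" "f d1 < a"
    using frequently_at_dense[OF assms(2), of "{..<d2}"] d2 assms(4) by auto
  show ?case
    by (rule exI[of _ "d1 # d2 # xs"])
      (use xs d1 d2 m assms(4) in \<open>fastforce\<close>)
qed

text \<open>The list again grows at its front although the points now accumulate at its end: a pair
  \<open>d1\<close>, \<open>d2\<close> is chosen beyond \<open>s\<close>, and the induction
  hypothesis fills the remaining interval from \<open>d2\<close> to \<open>t\<close>. This is why
  \<open>s\<close> is generalised.\<close>

lemma upcrossings_left:
  fixes f :: "real \<Rightarrow> real"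
  assumes "a < b" "frequently (\<lambda>x. f x < a) (at t within S)"
    "frequently (\<lambda>x. b < f x) (at t within S)" "S \<subseteq> {..<t}" "s < t"
  shows "\<exists>xs. sorted_wrt (<) xs \<and> set xs \<subseteq> S \<inter> {s<..<t} \<and> n \<le> upcrossings a b False (map f xs)"
  using assms(5)
proof (induction n arbitrary: s)
  case 0
  then show ?case by (auto intro: exI[of _ "[]"])
next
  case (Suc n)
  obtain d1 where d1: "d1 \<in> S" "s < d1" "f d1 < a"
    using frequently_at_dense[OF assms(2), of "{s<..}"] Suc.prems by auto
  obtain d2 where d2: "d2 \<in> S" "d1 < d2" "b < f d2"
    using frequently_at_dense[OF assms(3), of "{d1<..}"] d1 assms(4) by auto
  obtain xs where xs: "sorted_wrt (<) xs" "set xs \<subseteq> S \<inter> {d2<..<t}"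
    "n \<le> upcrossings a b False (map f xs)" using Suc.IH[of d2] d2 assms(4) by auto
  show ?case
    by (rule exI[of _ "d1 # d2 # xs"]) (use xs d1 d2 assms(4) in \<open>fastforce\<close>)
qed

section \<open>One-sided limits along the rationals\<close>

lemma at_within_Rats_right: "at t within (\<rat> \<inter> {t<..}) \<noteq> (bot :: real filter)"
proof -
  have "t islimpt (\<rat> \<inter> {t<..})"
    unfolding islimpt_approachable
  proof (intro allI impI)
    fix e :: real assume "0 < e"
    then obtain r where "r \<in> \<rat>" "t < r" "r < t + e" using Rats_dense_in_real[of t "t+e"] by auto
    then show "\<exists>x'\<in>\<rat> \<inter> {t<..}. x' \<noteq> t \<and> dist x' t < e" by (auto simp: dist_real_def intro!: bexI[of _ r])
  qed
  then show ?thesis by (simp add: trivial_limit_within)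
qed

lemma at_within_Rats_left: "0 < t \<Longrightarrow> at t within (\<rat> \<inter> {0..<t}) \<noteq> (bot :: real filter)"
proof -
  assume t: "0 < t"
  have "t islimpt (\<rat> \<inter> {0..<t})"
    unfolding islimpt_approachable
  proof (intro allI impI)
    fix e :: real assume "0 < e"
    then obtain r where "r \<in> \<rat>" "max 0 (t - e) < r" "r < t"
      using Rats_dense_in_real[of "max 0 (t - e)" t] t by auto
    then show "\<exists>x'\<in>\<rat> \<inter> {0..<t}. x' \<noteq> t \<and> dist x' t < e"
      by (auto simp: dist_real_def intro!: bexI[of _ r])
  qed
  then show ?thesis by (simp add: trivial_limit_within)
qed

lemma abs_le_of_right_limit:
  fixes f :: "real \<Rightarrow> real"
  assumes "(f \<longlongrightarrow> f r) (at_right r)" "r < c" "\<And>q. q \<in> \<rat> \<Longrightarrow> r < q \<Longrightarrow> q < c \<Longrightarrow> \<bar>f q\<bar> \<le> B"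
  shows "\<bar>f r\<bar> \<le> B"
proof -
  let ?F = "at r within (\<rat> \<inter> {r<..})"
  have "(f \<longlongrightarrow> f r) ?F" by (rule tendsto_within_subset[OF assms(1)]) auto
  then have "((\<lambda>q. \<bar>f q\<bar>) \<longlongrightarrow> \<bar>f r\<bar>) ?F" by (rule tendsto_rabs)
  moreover have "eventually (\<lambda>q. q \<in> {..<c} \<and> q \<in> \<rat> \<inter> {r<..}) ?F"
    unfolding eventually_at_topological using assms(2) by (intro exI[of _ "{..<c}"]) auto
  then have "eventually (\<lambda>q. \<bar>f q\<bar> \<le> B) ?F" by (rule eventually_mono) (use assms(3) in auto)
  ultimately show ?thesis by (rule tendsto_upperbound[OF _ _ at_within_Rats_right])
qed

text \<open>A value \<open>g u\<close> is a limit of values of \<open>f\<close> at rationals just to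
  the right of \<open>u\<close>. An estimate for \<open>f\<close> at the rationals of an open
  interval thus passes to \<open>g\<close> on that interval, with a non-strict inequality; working
  with \<open>e / 2\<close> restores strictness.\<close>

lemma cadlag_regularization:
  fixes f g :: "real \<Rightarrow> real"
  assumes right: "\<And>t. 0 \<le> t \<Longrightarrow> (f \<longlongrightarrow> g t) (at t within (\<rat> \<inter> {t<..}))"
    and left: "\<And>t. 0 < t \<Longrightarrow> \<exists>l. (f \<longlongrightarrow> l) (at t within (\<rat> \<inter> {0..<t}))"
  shows "cadlag g"
  unfolding cadlag_def
proof (intro conjI allI impI)
  have close: "\<bar>g u - l\<bar> \<le> e"
    if "0 \<le> u" "u < v" "\<And>d. d \<in> \<rat> \<Longrightarrow> u < d \<Longrightarrow> d < v \<Longrightarrow> \<bar>f d - l\<bar> < e" for u v l e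
  proof -
    have "eventually (\<lambda>d. d \<in> {..<v} \<and> d \<in> \<rat> \<inter> {u<..}) (at u within (\<rat> \<inter> {u<..}))"
      unfolding eventually_at_topological using that(2) by (auto intro!: exI[of _ "{..<v}"])
    then have "eventually (\<lambda>d. \<bar>f d - l\<bar> \<le> e) (at u within (\<rat> \<inter> {u<..}))"
      by (rule eventually_mono) (use that(3) in \<open>auto intro: less_imp_le\<close>)
    moreover have "((\<lambda>d. \<bar>f d - l\<bar>) \<longlongrightarrow> \<bar>g u - l\<bar>) (at u within (\<rat> \<inter> {u<..}))"
      by (intro tendsto_intros right that)
    ultimately show ?thesis using at_within_Rats_right tendsto_upperbound by blast
  qed
  show "(g \<longlongrightarrow> g t) (at_right t)" if t: "0 \<le> t" for t
  proof (rule tendstoI)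
    fix e :: real assume e: "0 < e"
    have "eventually (\<lambda>d. dist (f d) (g t) < e / 2) (at t within (\<rat> \<inter> {t<..}))"
      using right[OF t] e by (intro tendstoD) auto
    then obtain \<delta> where d: "0 < \<delta>"
      "\<And>d. d \<in> \<rat> \<Longrightarrow> t < d \<Longrightarrow> d < t + \<delta> \<Longrightarrow> \<bar>f d - g t\<bar> < e / 2"
      by (auto simp: eventually_at dist_real_def)
    have "\<bar>g u - g t\<bar> \<le> e / 2" if "t < u" "u < t + \<delta>" for u
      by (rule close[of u "t + \<delta>"]) (use t that d in auto)
    then show "\<forall>\<^sub>F u in at_right t. dist (g u) (g t) < e"
      unfolding eventually_at_right_field dist_real_def using d(1) e
      by (intro exI[of _ "t + \<delta>"]) force
  qed
  show "\<exists>l. (g \<longlongrightarrow> l) (at_left t)" if t: "0 < t" for t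
  proof -
    obtain l where l: "(f \<longlongrightarrow> l) (at t within (\<rat> \<inter> {0..<t}))" using left[OF t] by auto
    have "(g \<longlongrightarrow> l) (at_left t)"
    proof (rule tendstoI)
      fix e :: real assume e: "0 < e"
      have "eventually (\<lambda>d. dist (f d) l < e / 2) (at t within (\<rat> \<inter> {0..<t}))"
        using l e by (intro tendstoD) auto
      then obtain \<delta> where d: "0 < \<delta>"
        "\<And>d. d \<in> \<rat> \<Longrightarrow> 0 \<le> d \<Longrightarrow> d < t \<Longrightarrow> t - \<delta> < d \<Longrightarrow> \<bar>f d - l\<bar> < e / 2"
        by (auto simp: eventually_at dist_real_def)
      have "\<bar>g u - l\<bar> \<le> e / 2" if "max 0 (t - \<delta>) < u" "u < t" for u
        by (rule close[of u t]) (use t that d in auto)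
      then show "\<forall>\<^sub>F u in at_left t. dist (g u) l < e"
        unfolding eventually_at_left_field dist_real_def using d(1) e t
        by (intro exI[of _ "max 0 (t - \<delta>)"]) force
    qed
    then show ?thesis by blast
  qed
qed

lemma rational_limits_of_upcrossings:
  fixes f :: "real \<Rightarrow> real"
  assumes bdd: "\<And>n::nat. \<exists>B. \<forall>x\<in>\<rat> \<inter> {0..real n}. \<bar>f x\<bar> \<le> B"
    and up: "\<And>(n::nat) a b. a \<in> \<rat> \<Longrightarrow> b \<in> \<rat> \<Longrightarrow> a < b \<Longrightarrow> \<exists>c. \<forall>xs. sorted_wrt (<) xs \<longrightarrow>
        set xs \<subseteq> \<rat> \<inter> {0..real n} \<longrightarrow> upcrossings a b False (map f xs) \<le> c"
  shows "0 \<le> t \<Longrightarrow> \<exists>l. (f \<longlongrightarrow> l) (at t within (\<rat> \<inter> {t<..}))"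
    and "0 < t \<Longrightarrow> \<exists>l. (f \<longlongrightarrow> l) (at t within (\<rat> \<inter> {0..<t}))"
proof -
  have limit: "\<exists>l. (f \<longlongrightarrow> l) (at t within D)"
    if t: "0 \<le> t" and D: "at t within D \<noteq> bot" "D \<inter> {..<t+1} \<subseteq> \<rat> \<inter> {0..}"
      and osc: "\<And>a b n. a < b \<Longrightarrow> frequently (\<lambda>x. f x < a) (at t within D) \<Longrightarrow>
        frequently (\<lambda>x. b < f x) (at t within D) \<Longrightarrow> \<exists>xs. sorted_wrt (<) xs \<and>
          set xs \<subseteq> D \<inter> {..<t+1} \<and> n \<le> upcrossings a b False (map f xs)" for D
  proof -
    \<comment> \<open>The margin of one provides a neighbourhood of \<open>t\<close> inside the
      range of the bounds, also to the right of \<open>t\<close>.\<close>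
    obtain n :: nat where n: "t + 1 < real n" using reals_Archimedean2 by blast
    have Dn: "D \<inter> {..<t+1} \<subseteq> \<rat> \<inter> {0..real n}" using D(2) n by auto
    obtain B where B: "\<forall>x\<in>\<rat> \<inter> {0..real n}. \<bar>f x\<bar> \<le> B" using bdd by blast
    show ?thesis
    proof (rule convergent_of_no_oscillation[OF D(1), of _ B])
      show "\<forall>\<^sub>F x in at t within D. \<bar>f x\<bar> \<le> B"
        unfolding eventually_at_topological
        by (rule exI[of _ "{..<t+1}"]) (use B Dn in auto)
      fix a b :: real assume ab: "a \<in> \<rat>" "b \<in> \<rat>" "a < b"
      show "\<not> ((\<exists>\<^sub>F x in at t within D. f x < a) \<and> (\<exists>\<^sub>F x in at t within D. b < f x))"
      proof
        assume *: "(\<exists>\<^sub>F x in at t within D. f x < a) \<and> (\<exists>\<^sub>F x in at t within D. b < f x)"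
        obtain c where c: "\<And>xs. sorted_wrt (<) xs \<Longrightarrow> set xs \<subseteq> \<rat> \<inter> {0..real n} \<Longrightarrow>
            upcrossings a b False (map f xs) \<le> c" using up[OF ab, of n] by blast
        obtain xs where xs: "sorted_wrt (<) xs" "set xs \<subseteq> D \<inter> {..<t+1}"
            "Suc c \<le> upcrossings a b False (map f xs)" using osc[OF ab(3)] * by blast
        from c[OF xs(1) order_trans[OF xs(2) Dn]] xs(3) show False by simp
      qed
    qed
  qed
  show "\<exists>l. (f \<longlongrightarrow> l) (at t within (\<rat> \<inter> {t<..}))" if t: "0 \<le> t"
  proof (rule limit[OF t at_within_Rats_right])
    fix a b n assume "a < b" "frequently (\<lambda>x. f x < a) (at t within (\<rat> \<inter> {t<..}))"
      "frequently (\<lambda>x. b < f x) (at t within (\<rat> \<inter> {t<..}))"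
    from upcrossings_right[OF this, of "t + 1" n]
    show "\<exists>xs. sorted_wrt (<) xs \<and> set xs \<subseteq> (\<rat> \<inter> {t<..}) \<inter> {..<t+1} \<and>
        n \<le> upcrossings a b False (map f xs)" by fastforce
  qed (use t in auto)
  show "\<exists>l. (f \<longlongrightarrow> l) (at t within (\<rat> \<inter> {0..<t}))" if t: "0 < t"
  proof (rule limit[OF less_imp_le[OF t] at_within_Rats_left[OF t]])
    fix a b n assume "a < b" "frequently (\<lambda>x. f x < a) (at t within (\<rat> \<inter> {0..<t}))"
      "frequently (\<lambda>x. b < f x) (at t within (\<rat> \<inter> {0..<t}))"
    from upcrossings_left[OF this _ t, of n]
    show "\<exists>xs. sorted_wrt (<) xs \<and> set xs \<subseteq> (\<rat> \<inter> {0..<t}) \<inter> {..<t+1} \<and>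
        n \<le> upcrossings a b False (map f xs)" by fastforce
  qed auto
qed

section \<open>Cadlag paths: locality, stopping and local boundedness\<close>

lemma cadlag_cong:
  assumes "\<And>t. 0 \<le> t \<Longrightarrow> \<exists>e>0. \<exists>g. cadlag g \<and> (\<forall>s. 0 \<le> s \<longrightarrow> s < t + e \<longrightarrow> f s = g s)"
  shows "cadlag f"
  unfolding cadlag_def
proof (intro conjI allI impI)
  fix t :: real assume t: "0 \<le> t"
  obtain e g where g: "0 < e" "cadlag g" "\<And>s. 0 \<le> s \<Longrightarrow> s < t + e \<Longrightarrow> f s = g s" using assms[OF t] by blast
  have "\<forall>\<^sub>F s in at_right t. f s = g s"
    unfolding eventually_at_right_field using g t by (intro exI[of _ "t + e"]) auto
  moreover have "(g \<longlongrightarrow> f t) (at_right t)" using g t by (simp add: cadlag_def)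
  ultimately show "(f \<longlongrightarrow> f t) (at_right t)" by (simp add: tendsto_cong)
next
  fix t :: real assume t: "0 < t"
  obtain e g where g: "0 < e" "cadlag g" "\<And>s. 0 \<le> s \<Longrightarrow> s < t + e \<Longrightarrow> f s = g s"
    using assms[of t] t by auto
  have "\<forall>\<^sub>F s in at_left t. f s = g s"
    unfolding eventually_at_left_field using g t by (intro exI[of _ 0]) auto
  moreover obtain l where "(g \<longlongrightarrow> l) (at_left t)" using g t by (auto simp: cadlag_def)
  ultimately show "\<exists>l. (f \<longlongrightarrow> l) (at_left t)" by (auto simp: tendsto_cong)
qed

lemma cadlag_const: "cadlag (\<lambda>_. c)"
  by (auto simp: cadlag_def)

lemma cadlag_diff:
  assumes "cadlag f" "cadlag g" shows "cadlag (\<lambda>t. f t - g t)"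
  unfolding cadlag_def
proof (intro conjI allI impI)
  show "((\<lambda>t. f t - g t) \<longlongrightarrow> f t - g t) (at_right t)" if "0 \<le> t" for t
    using assms that by (intro tendsto_diff) (auto simp: cadlag_def)
  fix t :: real assume "0 < t"
  then obtain l m where "(f \<longlongrightarrow> l) (at_left t)" "(g \<longlongrightarrow> m) (at_left t)"
    using assms unfolding cadlag_def by blast
  then show "\<exists>l. ((\<lambda>t. f t - g t) \<longlongrightarrow> l) (at_left t)" by (blast intro: tendsto_diff)
qed

lemma cadlag_stopped:
  assumes "cadlag f"
  shows "cadlag (\<lambda>t. f (enn2real (min (ennreal t) c)))"
proof (cases c rule: ennreal_cases)
  case top
  show ?thesis
    by (rule cadlag_cong) (use assms top in \<open>auto intro!: exI[of _ 1] exI[of _ f]\<close>)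
next
  case (real r)
  have eq: "f (enn2real (min (ennreal t) c)) = f (min t r)" if "0 \<le> t" for t
    using that real by (simp add: min_def)
  have "cadlag (\<lambda>t. f (min t r))"
    unfolding cadlag_def
  proof (intro conjI allI impI)
    fix t :: real assume t: "0 \<le> t"
    show "((\<lambda>t. f (min t r)) \<longlongrightarrow> f (min t r)) (at_right t)"
    proof (cases "t < r")
      case True
      then have "\<forall>\<^sub>F s in at_right t. f (min s r) = f s"
        unfolding eventually_at_right_field by (intro exI[of _ r]) auto
      then show ?thesis using assms t True by (simp add: tendsto_cong cadlag_def)
    next
      case False
      then have "\<forall>\<^sub>F s in at_right t. f (min s r) = f r"
        unfolding eventually_at_right_field by (intro exI[of _ "t + 1"]) (auto simp: min_def)
      then show ?thesis using False by (simp add: tendsto_cong)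
    qed
  next
    fix t :: real assume t: "0 < t"
    show "\<exists>l. ((\<lambda>t. f (min t r)) \<longlongrightarrow> l) (at_left t)"
    proof (cases "t \<le> r")
      case True
      then have "\<forall>\<^sub>F s in at_left t. f (min s r) = f s"
        unfolding eventually_at_left_field by (intro exI[of _ "t - 1"]) auto
      then show ?thesis using assms t True by (auto simp add: tendsto_cong cadlag_def)
    next
      case False
      then have "\<forall>\<^sub>F s in at_left t. f (min s r) = f r"
        unfolding eventually_at_left_field by (intro exI[of _ r]) (auto simp: min_def)
      then show ?thesis using False by (auto simp add: tendsto_cong)
    qed
  qed
  then show ?thesis
    by (intro cadlag_cong) (use eq in \<open>auto intro!: exI[of _ 1] exI[of _ "\<lambda>t. f (min t r)"]\<close>)
qed

text \<open>The two one-sided limits give a bound near each point, and Bolzano's bisection principle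
  joins these local bounds. The guard \<open>0 \<le> a\<close> in the property reflects that the
  path is controlled at nonnegative times only.\<close>

lemma cadlag_bounded:
  assumes "cadlag f" "0 \<le> t"
  shows "\<exists>B. \<forall>s\<in>{0..t}. \<bar>f s\<bar> \<le> B"
proof -
  have "(0::real) \<le> 0 \<longrightarrow> (\<exists>B. \<forall>s\<in>{0..t}. \<bar>f s\<bar> \<le> B)"
  proof (rule Bolzano[where P = "\<lambda>a b. 0 \<le> a \<longrightarrow> (\<exists>B. \<forall>s\<in>{a..b}. \<bar>f s\<bar> \<le> B)", OF assms(2)])
    fix a b c :: real
    assume 1: "0 \<le> a \<longrightarrow> (\<exists>B. \<forall>s\<in>{a..b}. \<bar>f s\<bar> \<le> B)"
      and 2: "0 \<le> b \<longrightarrow> (\<exists>B. \<forall>s\<in>{b..c}. \<bar>f s\<bar> \<le> B)" and ab: "a \<le> b" "b \<le> c"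
    show "0 \<le> a \<longrightarrow> (\<exists>B. \<forall>s\<in>{a..c}. \<bar>f s\<bar> \<le> B)"
    proof
      assume "0 \<le> a"
      with 1 2 ab obtain B1 B2 where "\<forall>s\<in>{a..b}. \<bar>f s\<bar> \<le> B1" "\<forall>s\<in>{b..c}. \<bar>f s\<bar> \<le> B2" by auto
      then show "\<exists>B. \<forall>s\<in>{a..c}. \<bar>f s\<bar> \<le> B"
        by (intro exI[of _ "max B1 B2"]) (force simp: le_max_iff_disj)
    qed
  next
    fix x :: real assume x: "0 \<le> x" "x \<le> t"
    have "(f \<longlongrightarrow> f x) (at_right x)" using assms(1) x by (simp add: cadlag_def)
    from tendstoD[OF this, of 1] obtain b where b: "x < b" "\<And>s. x < s \<Longrightarrow> s < b \<Longrightarrow> \<bar>f s - f x\<bar> < 1"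
      by (auto simp: eventually_at_right_field dist_real_def)
    obtain a l where a: "a < x" "\<And>s. 0 \<le> s \<Longrightarrow> a < s \<Longrightarrow> s < x \<Longrightarrow> \<bar>f s - l\<bar> < 1"
    proof (cases "0 < x")
      case True
      then obtain l where "(f \<longlongrightarrow> l) (at_left x)" using assms(1) by (auto simp: cadlag_def)
      from tendstoD[OF this, of 1] obtain a where "a < x" "\<And>s. a < s \<Longrightarrow> s < x \<Longrightarrow> \<bar>f s - l\<bar> < 1"
        by (auto simp: eventually_at_left_field dist_real_def)
      then show ?thesis using that by blast
    next
      \<comment> \<open>At time zero there is no left limit, but no nonnegative point lies to the
        left either, so any \<open>a\<close> below \<open>x\<close> and any \<open>l\<close> will
        do.\<close>
      case False
      then show ?thesis using that[of "x - 1" 0] x by auto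
    qed
    show "\<exists>d>0. \<forall>a b. a \<le> x \<and> x \<le> b \<and> b - a < d \<longrightarrow> 0 \<le> a \<longrightarrow> (\<exists>B. \<forall>s\<in>{a..b}. \<bar>f s\<bar> \<le> B)"
    proof (rule exI[of _ "min (b - x) (x - a)"], intro conjI allI impI)
      show "0 < min (b - x) (x - a)" using a b by simp
      fix u v assume uv: "u \<le> x \<and> x \<le> v \<and> v - u < min (b - x) (x - a)" "0 \<le> u"
      have "\<bar>f s\<bar> \<le> max (\<bar>f x\<bar> + 1) (\<bar>l\<bar> + 1)" if s: "s \<in> {u..v}" for s
      proof -
        consider "s < x" | "s = x" | "x < s" by linarith
        then show ?thesis
        proof cases
          case 1 then show ?thesis using a(2)[of s] s uv by (auto simp: le_max_iff_disj)
        next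
          case 3 then show ?thesis using b(2)[of s] s uv by (auto simp: le_max_iff_disj)
        qed auto
      qed
      then show "\<exists>B. \<forall>s\<in>{u..v}. \<bar>f s\<bar> \<le> B" by blast
    qed
  qed
  then show ?thesis by simp
qed

section \<open>Approximation of stopping times and limits of uniformly integrable sequences\<close>

text \<open>By completeness every subset of the exceptional null set is null, and \<open>A\<close>
  contains all null sets.\<close>

lemma measurable_AE_cong:
  assumes "complete_measure P" and sub: "subalgebra P A" and null: "null_sets P \<subseteq> sets A"
    and f[measurable]: "f \<in> borel_measurable A" and eq: "AE x in P. f x = (g x :: real)"
  shows "g \<in> borel_measurable A"
proof -
  interpret complete_measure P by fact
  have sp: "space A = space P" using sub by (simp add: subalgebra_def)
  obtain N where N: "N \<in> null_sets P" "\<And>x. x \<in> space P - N \<Longrightarrow> f x = g x"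
    using eq by (auto elim: AE_E3)
  show ?thesis
  proof (rule measurableI)
    fix B :: "real set" assume B: "B \<in> sets borel"
    have "g -` B \<inter> space A = (f -` B \<inter> space A - N) \<union> (g -` B \<inter> space A \<inter> N)"
      using N(2) sp by auto
    moreover have "f -` B \<inter> space A \<in> sets A" using f B by (rule measurable_sets)
    moreover have "N \<in> sets A" using N null by auto
    moreover have "g -` B \<inter> space A \<inter> N \<in> sets A"
      using complete2[of _ N] N null by blast
    ultimately show "g -` B \<inter> space A \<in> sets A" by (metis sets.Diff sets.Un)
  qed simp
qed

text \<open>A form of Vitali's theorem. The tail hypothesis is what conditional expectations of a
  fixed variable \<open>\<xi>\<close> satisfy, and it implies uniform integrability. Clamped
  variables converge by bounded convergence, and the error made by clamping is a tail, small
  uniformly in \<open>k\<close>.\<close>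

lemma (in prob_space) set_integral_lim_tail_dominated:
  fixes f :: "nat \<Rightarrow> 'a \<Rightarrow> real"
  assumes xi[measurable]: "integrable M \<xi>" and f[measurable]: "\<And>k. integrable M (f k)"
    and g[measurable]: "g \<in> borel_measurable M"
    and tail: "\<And>k K. 0 \<le> K \<Longrightarrow> (\<integral>x. indicator {x\<in>space M. K < \<bar>f k x\<bar>} x * \<bar>f k x\<bar> \<partial>M)
      \<le> (\<integral>x. indicator {x\<in>space M. K < \<bar>f k x\<bar>} x * \<bar>\<xi> x\<bar> \<partial>M)"
    and lim: "AE x in M. (\<lambda>k. f k x) \<longlonglongrightarrow> g x"
  shows "integrable M g"
    and "A \<in> sets M \<Longrightarrow> (\<And>k. (\<integral>x. indicator A x * f k x \<partial>M) = c) \<Longrightarrow> (\<integral>x. indicator A x * g x \<partial>M) = c"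
proof -
  have [measurable]: "\<xi> \<in> borel_measurable M" "\<And>k. f k \<in> borel_measurable M"
    using xi f by (auto intro: borel_measurable_integrable)
  let ?E = "\<integral>x. \<bar>\<xi> x\<bar> \<partial>M"
  have ind: "integrable M (\<lambda>x. indicator B x * h x)" if "B \<in> sets M" "integrable M h" for B and h :: "'a \<Rightarrow> real"
    using integrable_mult_indicator[OF that] by simp
  have L1: "(\<integral>x. \<bar>f k x\<bar> \<partial>M) \<le> ?E" for k
  proof -
    have "(\<integral>x. \<bar>f k x\<bar> \<partial>M) = (\<integral>x. indicator {x\<in>space M. 0 < \<bar>f k x\<bar>} x * \<bar>f k x\<bar> \<partial>M)"
      by (intro Bochner_Integration.integral_cong) (auto simp: indicator_def)
    also have "\<dots> \<le> (\<integral>x. indicator {x\<in>space M. 0 < \<bar>f k x\<bar>} x * \<bar>\<xi> x\<bar> \<partial>M)" by (rule tail) simp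
    also have "\<dots> \<le> ?E"
      by (intro integral_mono ind integrable_abs xi) (auto simp: indicator_def)
    finally show ?thesis .
  qed
  show g_int: "integrable M g"
  proof (rule integrableI_bounded)
    have "(\<integral>\<^sup>+x. ennreal (norm (g x)) \<partial>M) = (\<integral>\<^sup>+x. liminf (\<lambda>k. ennreal \<bar>f k x\<bar>) \<partial>M)"
    proof (rule nn_integral_cong_AE)
      show "AE x in M. ennreal (norm (g x)) = liminf (\<lambda>k. ennreal \<bar>f k x\<bar>)"
        using lim
      proof eventually_elim
        case (elim x)
        then have 1: "(\<lambda>k. ennreal \<bar>f k x\<bar>) \<longlonglongrightarrow> ennreal \<bar>g x\<bar>" by (intro tendsto_ennrealI tendsto_rabs)
        show ?case unfolding real_norm_def by (rule lim_imp_Liminf[OF _ 1, symmetric]) (rule sequentially_bot)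
      qed
    qed
    also have "\<dots> \<le> liminf (\<lambda>k. \<integral>\<^sup>+x. ennreal \<bar>f k x\<bar> \<partial>M)" by (rule nn_integral_liminf) measurable
    also have "\<dots> \<le> limsup (\<lambda>k. \<integral>\<^sup>+x. ennreal \<bar>f k x\<bar> \<partial>M)" by (rule Liminf_le_Limsup) simp
    also have "\<dots> \<le> ennreal ?E"
      by (rule Limsup_bounded) (use L1 f in \<open>auto simp: nn_integral_eq_integral ennreal_leI\<close>)
    finally show "(\<integral>\<^sup>+x. ennreal (norm (g x)) \<partial>M) < \<infinity>" by (simp add: order_le_less_trans)
  qed simp
  assume A[measurable]: "A \<in> sets M" and c: "\<And>k. (\<integral>x. indicator A x * f k x \<partial>M) = c"
  have tails: "\<exists>n0. \<forall>n\<ge>n0. \<forall>k. (\<integral>x. indicator {x\<in>space M. real n < \<bar>f k x\<bar>} x * \<bar>f k x\<bar> \<partial>M) \<le> e"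
    if e: "0 < e" for e
  proof -
    have "(\<lambda>n. \<integral>x. indicator {x\<in>space M. real n < \<bar>\<xi> x\<bar>} x * \<bar>\<xi> x\<bar> \<partial>M) \<longlonglongrightarrow> (\<integral>x. 0 \<partial>M)"
    proof (rule integral_dominated_convergence[where w = "\<lambda>x. \<bar>\<xi> x\<bar>"])
      show "AE x in M. (\<lambda>n. indicator {x\<in>space M. real n < \<bar>\<xi> x\<bar>} x * \<bar>\<xi> x\<bar>) \<longlonglongrightarrow> 0"
      proof (rule AE_I2)
        fix x
        obtain m :: nat where m: "\<bar>\<xi> x\<bar> \<le> real m" using real_arch_simple by blast
        show "(\<lambda>n. indicator {x\<in>space M. real n < \<bar>\<xi> x\<bar>} x * \<bar>\<xi> x\<bar>) \<longlonglongrightarrow> 0"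
          by (rule tendsto_eventually) (use m in \<open>auto simp: eventually_sequentially intro!: exI[of _ m]\<close>)
      qed
    qed (use xi in \<open>auto simp: indicator_def\<close>)
    then have "eventually (\<lambda>n. (\<integral>x. indicator {x\<in>space M. real n < \<bar>\<xi> x\<bar>} x * \<bar>\<xi> x\<bar> \<partial>M) < e / 2) sequentially"
      using e by (intro order_tendstoD) auto
    then obtain l :: nat where l: "(\<integral>x. indicator {x\<in>space M. real l < \<bar>\<xi> x\<bar>} x * \<bar>\<xi> x\<bar> \<partial>M) < e / 2"
      by (auto simp: eventually_sequentially)
    \<comment> \<open>By Markov's inequality the event \<open>real n < \<bar>f k x\<bar>\<close> has
      probability at most \<open>?E / n\<close>, so from \<open>n0\<close> on \<open>real l\<close>
      times this probability is at most \<open>e / 2\<close>. On that event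
      \<open>\<bar>\<xi>\<bar>\<close> is at most \<open>l\<close> plus its own tail beyond
      \<open>l\<close>, and the latter has integral below \<open>e / 2\<close>.\<close>
    obtain n0 :: nat where n0: "real l * ?E / (e / 2) < real n0" using reals_Archimedean2 by blast
    have E0: "0 \<le> ?E" by (rule integral_nonneg_AE) simp
    have "(\<integral>x. indicator {x\<in>space M. real n < \<bar>f k x\<bar>} x * \<bar>f k x\<bar> \<partial>M) \<le> e" if n: "n0 \<le> n" for n k
    proof -
      let ?B = "{x\<in>space M. real n < \<bar>f k x\<bar>}"
      have Bi: "integrable M (indicator ?B :: 'a \<Rightarrow> real)"
        by (intro integrable_real_indicator) (auto simp: emeasure_eq_measure)
      have "0 \<le> real l * ?E / (e / 2)" using E0 e by simp
      then have npos: "0 < real n" using n0 n by linarith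
      have "real n * measure M ?B = (\<integral>x. real n * indicator ?B x \<partial>M)" by simp
      also have "\<dots> \<le> (\<integral>x. \<bar>f k x\<bar> \<partial>M)"
      proof (rule integral_mono)
        show "integrable M (\<lambda>x. real n * indicator ?B x)"
          by (intro integrable_mult_right Bi)
      qed (use f in \<open>auto split: split_indicator\<close>)
      also have "\<dots> \<le> ?E" by (rule L1)
      finally have "real n * (real l * measure M ?B) \<le> real l * ?E"
        using mult_left_mono[of "real n * measure M ?B" ?E "real l"] by (simp add: ac_simps)
      also have "real l * ?E \<le> real n * (e / 2)"
      proof -
        have "real l * ?E < real n0 * (e/2)" using n0 e by (simp add: field_simps)
        also have "\<dots> \<le> real n * (e/2)" using n e by (intro mult_right_mono) auto
        finally show ?thesis by simp
      qed
      finally have 1: "real l * measure M ?B \<le> e / 2" using npos by simp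
      have "(\<integral>x. indicator ?B x * \<bar>f k x\<bar> \<partial>M) \<le> (\<integral>x. indicator ?B x * \<bar>\<xi> x\<bar> \<partial>M)" by (rule tail) simp
      also have "\<dots> \<le> (\<integral>x. real l * indicator ?B x + indicator {x\<in>space M. real l < \<bar>\<xi> x\<bar>} x * \<bar>\<xi> x\<bar> \<partial>M)"
        by (intro integral_mono ind integrable_abs xi Bochner_Integration.integrable_add
              integrable_mult_right Bi) (auto split: split_indicator)
      also have "\<dots> = real l * measure M ?B + (\<integral>x. indicator {x\<in>space M. real l < \<bar>\<xi> x\<bar>} x * \<bar>\<xi> x\<bar> \<partial>M)"
        by (subst Bochner_Integration.integral_add) (auto intro!: ind integrable_abs xi integrable_mult_right Bi)
      also have "\<dots> \<le> e" using 1 l by simp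
      finally show ?thesis .
    qed
    then show ?thesis by blast
  qed
  define clamp :: "nat \<Rightarrow> real \<Rightarrow> real" where "clamp n x = max (- real n) (min (real n) x)" for n x
  have clamp_bd: "\<bar>clamp n x\<bar> \<le> real n" "\<bar>clamp n x\<bar> \<le> \<bar>x\<bar>" for n x by (auto simp: clamp_def)
  have clamp_m[measurable]: "clamp n \<in> borel_measurable borel" for n unfolding clamp_def by measurable
  have clampint: "integrable M (\<lambda>x. clamp n (h x))" if "h \<in> borel_measurable M" for n h
    using that by (intro integrable_const_bound[where B = "real n"]) (auto simp: clamp_bd)
  have conv_g: "(\<lambda>n. \<integral>x. indicator A x * clamp n (g x) \<partial>M) \<longlonglongrightarrow> (\<integral>x. indicator A x * g x \<partial>M)"
  proof (rule integral_dominated_convergence[where w = "\<lambda>x. \<bar>g x\<bar>"])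
    show "AE x in M. (\<lambda>n. indicator A x * clamp n (g x)) \<longlonglongrightarrow> indicator A x * g x"
    proof (rule AE_I2)
      fix x
      obtain m :: nat where m: "\<bar>g x\<bar> \<le> real m" using real_arch_simple by blast
      show "(\<lambda>n. indicator A x * clamp n (g x)) \<longlonglongrightarrow> indicator A x * g x"
        by (rule tendsto_eventually)
          (use m in \<open>auto simp: eventually_sequentially clamp_def intro!: exI[of _ m]\<close>)
    qed
  qed (use g_int clamp_bd in \<open>auto simp: indicator_def\<close>)
  have conv_f: "(\<lambda>k. \<integral>x. indicator A x * clamp n (f k x) \<partial>M) \<longlonglongrightarrow> (\<integral>x. indicator A x * clamp n (g x) \<partial>M)" for n
  proof (rule integral_dominated_convergence[where w = "\<lambda>x. real n"])
    show "AE x in M. (\<lambda>k. indicator A x * clamp n (f k x)) \<longlonglongrightarrow> indicator A x * clamp n (g x)"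
      using lim
      by eventually_elim (auto simp: clamp_def intro!: tendsto_intros)
  qed (use clamp_bd in \<open>auto simp: indicator_def\<close>)
  have "\<bar>c - (\<integral>x. indicator A x * g x \<partial>M)\<bar> \<le> e" if e: "0 < e" for e
  proof -
    obtain n0 where n0: "\<And>n k. n0 \<le> n \<Longrightarrow>
        (\<integral>x. indicator {x\<in>space M. real n < \<bar>f k x\<bar>} x * \<bar>f k x\<bar> \<partial>M) \<le> e" using tails[OF e] by blast
    have "\<bar>c - (\<integral>x. indicator A x * clamp n (g x) \<partial>M)\<bar> \<le> e" if n: "n0 \<le> n" for n
    proof -
      have "\<bar>c - (\<integral>x. indicator A x * clamp n (f k x) \<partial>M)\<bar> \<le> e" for k
      proof -
        have "\<bar>c - (\<integral>x. indicator A x * clamp n (f k x) \<partial>M)\<bar>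
          = \<bar>\<integral>x. indicator A x * f k x - indicator A x * clamp n (f k x) \<partial>M\<bar>"
          unfolding c[of k, symmetric]
          by (subst Bochner_Integration.integral_diff) (auto intro!: ind clampint f)
        also have "\<dots> \<le> (\<integral>x. \<bar>indicator A x * f k x - indicator A x * clamp n (f k x)\<bar> \<partial>M)"
          by (rule integral_abs_bound)
        also have "\<dots> \<le> (\<integral>x. indicator {x\<in>space M. real n < \<bar>f k x\<bar>} x * \<bar>f k x\<bar> \<partial>M)"
          by (intro integral_mono integrable_abs Bochner_Integration.integrable_diff ind clampint f)
            (auto simp: indicator_def clamp_def)
        also have "\<dots> \<le> e" by (rule n0[OF n])
        finally show ?thesis .
      qed
      moreover have "(\<lambda>k. \<bar>c - (\<integral>x. indicator A x * clamp n (f k x) \<partial>M)\<bar>)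
          \<longlonglongrightarrow> \<bar>c - (\<integral>x. indicator A x * clamp n (g x) \<partial>M)\<bar>"
        by (intro tendsto_intros conv_f)
      ultimately show ?thesis by (intro LIMSEQ_le_const2) auto
    qed
    moreover have "(\<lambda>n. \<bar>c - (\<integral>x. indicator A x * clamp n (g x) \<partial>M)\<bar>)
        \<longlonglongrightarrow> \<bar>c - (\<integral>x. indicator A x * g x \<partial>M)\<bar>"
      by (intro tendsto_intros conv_g)
    ultimately show ?thesis by (intro LIMSEQ_le_const2) auto
  qed
  then have "\<bar>c - (\<integral>x. indicator A x * g x \<partial>M)\<bar> \<le> 0" by (rule field_le_epsilon[of _ 0, simplified])
  then show "(\<integral>x. indicator A x * g x \<partial>M) = c" by simp
qed

section \<open>Dyadic approximation from the right\<close>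

definition disc :: "nat \<Rightarrow> real \<Rightarrow> real" where
  "disc m x = (of_int \<lfloor>x * 2 ^ m\<rfloor> + 1) / 2 ^ m"

lemma disc_gt: "x < disc m x"
  unfolding disc_def by (simp add: field_simps) linarith

lemma disc_le: "disc m x \<le> x + (1 / 2) ^ m"
proof -
  have "disc m x \<le> (x * 2 ^ m + 1) / 2 ^ m"
    unfolding disc_def by (intro divide_right_mono) auto
  then show ?thesis by (simp add: field_simps)
qed

lemma disc_tendsto: "(\<lambda>m. disc m x) \<longlonglongrightarrow> x"
proof (rule tendsto_sandwich[of "\<lambda>_. x"])
  have "(\<lambda>m. x + (1 / 2) ^ m) \<longlonglongrightarrow> x + 0"
    by (intro tendsto_intros) auto
  then show "(\<lambda>m. x + (1 / 2) ^ m) \<longlonglongrightarrow> x" by simp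
qed (use disc_gt disc_le in \<open>auto intro!: always_eventually less_imp_le\<close>)

text \<open>The threshold on the right is the last dyadic number of level \<open>m\<close> up to
  \<open>d\<close>. Hence whether a discretised time has come by \<open>d\<close> is known at
  \<open>d\<close>. The inequality is strict because \<open>disc\<close> moves even dyadic numbers
  upwards.\<close>

lemma disc_le_iff: "disc m x \<le> d \<longleftrightarrow> x < of_int \<lfloor>d * 2 ^ m\<rfloor> / 2 ^ m"
proof -
  have "disc m x \<le> d \<longleftrightarrow> of_int (\<lfloor>x * 2 ^ m\<rfloor> + 1) \<le> d * 2 ^ m"
    unfolding disc_def by (simp add: field_simps)
  also have "\<dots> \<longleftrightarrow> \<lfloor>x * 2 ^ m\<rfloor> + 1 \<le> \<lfloor>d * 2 ^ m\<rfloor>" by (simp only: le_floor_iff)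
  also have "\<dots> \<longleftrightarrow> x * 2 ^ m < of_int \<lfloor>d * 2 ^ m\<rfloor>" by linarith
  finally show ?thesis by (simp add: field_simps)
qed

lemma tendsto_min_disc:
  assumes "\<And>x. 0 \<le> x \<Longrightarrow> (f \<longlongrightarrow> f x) (at_right x)" "0 \<le> x" "x \<le> n"
  shows "(\<lambda>m. f (min (disc m x) n)) \<longlonglongrightarrow> f x"
proof (cases "x = n")
  \<comment> \<open>At the right end point truncation makes the sequence constant; everywhere else
    it stays strictly above \<open>x\<close>, as a limit from the right requires.\<close>
  case True
  then have "min (disc m x) n = x" for m using disc_gt[of x m] by (simp add: min_def)
  then show ?thesis by simp
next
  case False
  have "filterlim (\<lambda>m. min (disc m x) n) (at_right x) sequentially"
    unfolding filterlim_at
  proof (intro conjI)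
    have "(\<lambda>m. min (disc m x) n) \<longlonglongrightarrow> min x n" by (intro tendsto_intros disc_tendsto)
    then show "(\<lambda>m. min (disc m x) n) \<longlonglongrightarrow> x" using assms by (simp add: min_def)
    show "\<forall>\<^sub>F m in sequentially. min (disc m x) n \<in> {x<..} \<and> min (disc m x) n \<noteq> x"
      using False assms(3) disc_gt[of x]
      by (intro always_eventually allI) (auto simp: min_def less_le dest: not_sym)
  qed
  then show ?thesis using assms(1)[OF assms(2)] filterlim_compose by blast
qed

lemma disc_Rats: "disc m (x) \<in> \<rat>"
  unfolding disc_def by (intro Rats_divide Rats_add Rats_power) auto

section \<open>Optional stopping\<close>

text \<open>Optional stopping is applied to \<open>G\<close> and \<open>H\<close>, and to
  \<open>F\<close> for the reducing sequence, hence a locale of its own. Null sets at time zero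
  propagate to all later times; they absorb exceptional sets of path properties that hold only
  almost surely.\<close>

locale complete_filtered_space = prob_space P + complete_measure P for P :: "'a measure" +
  fixes G :: "real \<Rightarrow> 'a measure"
  assumes filt: "filtration_on P G" and null_G: "null_sets P \<subseteq> sets (G 0)"
begin

lemma subalg_G: "0 \<le> t \<Longrightarrow> subalgebra P (G t)"
  using filt by (simp add: filtration_on_def)

lemma space_G: "0 \<le> t \<Longrightarrow> space (G t) = space P"
  using subalg_G by (auto simp: subalgebra_def)

lemma sets_G: "0 \<le> t \<Longrightarrow> A \<in> sets (G t) \<Longrightarrow> A \<in> sets P"
  using subalg_G by (auto simp: subalgebra_def)

lemma sets_G_mono: "0 \<le> s \<Longrightarrow> s \<le> t \<Longrightarrow> A \<in> sets (G s) \<Longrightarrow> A \<in> sets (G t)"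
  using filt by (auto simp: filtration_on_def)

lemma null_sets_G: "0 \<le> t \<Longrightarrow> null_sets P \<subseteq> sets (G t)"
  using null_G sets_G_mono[of 0 t] by auto

lemma measurable_G_mono:
  assumes "0 \<le> s" "s \<le> t" "f \<in> measurable (G s) N" shows "f \<in> measurable (G t) N"
proof (rule measurableI)
  have t: "0 \<le> t" using assms by simp
  fix x assume "x \<in> space (G t)"
  then show "f x \<in> space N" using measurable_space[OF assms(3)] space_G assms(1) t by simp
next
  have t: "0 \<le> t" using assms by simp
  fix B assume "B \<in> sets N"
  then have "f -` B \<inter> space P \<in> sets (G s)"
    using measurable_sets[OF assms(3)] by (simp add: space_G[OF assms(1)])
  then show "f -` B \<inter> space (G t) \<in> sets (G t)"
    unfolding space_G[OF t] by (rule sets_G_mono[OF assms(1,2)])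
qed

lemma measurable_G: "0 \<le> t \<Longrightarrow> f \<in> measurable (G t) N \<Longrightarrow> f \<in> measurable P N"
  by (rule measurable_from_subalg[OF subalg_G])

lemma measurable_AE_G:
  assumes "0 \<le> t" "f \<in> borel_measurable (G t)" "AE x in P. f x = (g x :: real)"
  shows "g \<in> borel_measurable (G t)"
  by (rule measurable_AE_cong[OF complete_measure_axioms subalg_G[OF assms(1)]
      null_sets_G[OF assms(1)] assms(2,3)])

lemma integrable_ind:
  "B \<in> sets P \<Longrightarrow> integrable P h \<Longrightarrow> integrable P (\<lambda>x. indicator B x * (h x :: real))"
  using integrable_mult_indicator[of B P h] by simp

lemma integral_split:
  assumes "A \<in> sets P" "B \<in> sets P" "integrable P h"
  shows "(\<integral>w. indicator A w * h w \<partial>P)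
    = (\<integral>w. indicator (A \<inter> B) w * h w \<partial>P) + (\<integral>w. indicator (A - B) w * (h w :: real) \<partial>P)"
proof -
  have "(\<integral>w. indicator A w * h w \<partial>P) = (\<integral>w. indicator (A \<inter> B) w * h w + indicator (A - B) w * h w \<partial>P)"
    by (intro Bochner_Integration.integral_cong refl) (auto split: split_indicator)
  then show ?thesis
    by (subst (asm) Bochner_Integration.integral_add) (use assms in \<open>auto intro!: integrable_ind\<close>)
qed

text \<open>For a stopping time this is the \<sigma>-field of its past, kept as a family of sets. In
  particular \<open>space P \<in> past \<theta>\<close> is the encoding of "\<open>\<theta>\<close>
  is a stopping time". Times are real here since optional stopping concerns bounded ones.\<close>

definition past :: "('a \<Rightarrow> real) \<Rightarrow> 'a set set" where
  "past \<theta> = {A \<in> sets P. \<forall>t\<ge>0. {w \<in> A. \<theta> w \<le> t} \<in> sets (G t)}"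

lemma past_less:
  assumes "A \<in> past \<theta>" "0 \<le> t" "\<And>w. w \<in> A \<Longrightarrow> 0 \<le> \<theta> w"
  shows "{w \<in> A. \<theta> w < t} \<in> sets (G t)"
proof (cases "t = 0")
  case True
  then have e: "{w \<in> A. \<theta> w < t} = {}" using assms(3) by force
  show ?thesis unfolding e by simp
next
  case False
  \<comment> \<open>The approximating times start at zero and increase to \<open>t\<close>, so they
    never become negative, where the filtration carries no meaning.\<close>
  have "{w \<in> A. \<theta> w < t} = (\<Union>j::nat. {w \<in> A. \<theta> w \<le> t - t / (real j + 1)})"
  proof (intro set_eqI iffI)
    fix w assume mem: "w \<in> {w \<in> A. \<theta> w < t}"
    obtain j :: nat where "t / (t - \<theta> w) < real j" using reals_Archimedean2 by blast
    then have "t < real j * (t - \<theta> w)" using mem by (simp add: field_simps)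
    also have "\<dots> \<le> (real j + 1) * (t - \<theta> w)" using mem by (intro mult_right_mono) auto
    finally have "t / (real j + 1) < t - \<theta> w" by (simp add: field_simps)
    then show "w \<in> (\<Union>j::nat. {w \<in> A. \<theta> w \<le> t - t / (real j + 1)})"
      using mem by (auto intro!: exI[of _ j])
  next
    fix w assume "w \<in> (\<Union>j::nat. {w \<in> A. \<theta> w \<le> t - t / (real j + 1)})"
    then obtain j :: nat where j: "w \<in> A" "\<theta> w \<le> t - t / (real j + 1)" by auto
    have "0 < t / (real j + 1)" using False assms(2) by (intro divide_pos_pos) auto
    then show "w \<in> {w \<in> A. \<theta> w < t}" using j by simp
  qed
  moreover have "{w \<in> A. \<theta> w \<le> t - t / (real j + 1)} \<in> sets (G t)" for j :: nat
  proof -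
    have 1: "t / (real j + 1) \<le> t" using assms(2) by (simp add: field_simps)
    have 2: "0 \<le> t / (real j + 1)" using assms(2) by simp
    show ?thesis
      by (rule sets_G_mono[of "t - t / (real j + 1)"]) (use 1 2 assms(1) in \<open>auto simp: past_def\<close>)
  qed
  ultimately show ?thesis by auto
qed

lemma past_disc:
  assumes "A \<in> past \<theta>" "\<And>w. w \<in> A \<Longrightarrow> 0 \<le> \<theta> w" "\<And>w. w \<in> A \<Longrightarrow> \<theta> w \<le> n"
  shows "A \<in> past (\<lambda>w. min (disc m (\<theta> w)) n)"
proof -
  have "{w \<in> A. min (disc m (\<theta> w)) n \<le> d} \<in> sets (G d)" if d: "0 \<le> d" for d
  proof (cases "n \<le> d")
    case True
    then have "{w \<in> A. min (disc m (\<theta> w)) n \<le> d} = {w \<in> A. \<theta> w \<le> d}" using assms(3) by force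
    then show ?thesis using assms(1) d by (simp add: past_def)
  next
    case False
    let ?d = "of_int \<lfloor>d * 2 ^ m\<rfloor> / 2 ^ m :: real"
    have dd: "0 \<le> ?d" "?d \<le> d" using d by (simp_all add: field_simps)
    have "{w \<in> A. min (disc m (\<theta> w)) n \<le> d} = {w \<in> A. \<theta> w < ?d}"
      using False by (auto simp: min_le_iff_disj disc_le_iff)
    then show ?thesis using sets_G_mono[OF dd past_less[OF assms(1) dd(1) assms(2)]] by simp
  qed
  then show ?thesis using assms(1) by (simp add: past_def)
qed

lemma past_eq:
  assumes "A \<in> past \<theta>" "0 \<le> t" "\<And>w. w \<in> A \<Longrightarrow> 0 \<le> \<theta> w"
  shows "{w \<in> A. \<theta> w = t} \<in> sets (G t)"
proof -
  have eq: "{w \<in> A. \<theta> w = t} = {w \<in> A. \<theta> w \<le> t} - {w \<in> A. \<theta> w < t}" by auto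
  have "{w \<in> A. \<theta> w \<le> t} \<in> sets (G t)" using assms(1,2) by (simp add: past_def)
  then show ?thesis unfolding eq by (rule sets.Diff[OF _ past_less[OF assms]])
qed

text \<open>These are the possible values of a time in \<open>[0, n]\<close> after discretisation at
  level \<open>m\<close> and truncation at \<open>n\<close>. The index goes one beyond the floor
  because rounding is strictly upwards.\<close>

definition grid :: "nat \<Rightarrow> real \<Rightarrow> real set" where
  "grid m n = (\<lambda>j::int. min (of_int j / 2 ^ m) n) ` {0..\<lfloor>n * 2 ^ m\<rfloor> + 1}"

lemma grid: "finite (grid m n)" "0 \<le> n \<Longrightarrow> grid m n \<subseteq> {0..n}"
  by (auto simp: grid_def)

lemma disc_in_grid:
  assumes "0 \<le> x" "x \<le> n" shows "min (disc m x) n \<in> grid m n"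
proof -
  have "\<lfloor>x * 2 ^ m\<rfloor> \<le> \<lfloor>n * 2 ^ m\<rfloor>" using assms by (intro floor_mono) auto
  moreover have "0 \<le> \<lfloor>x * 2 ^ m\<rfloor>" using assms by simp
  ultimately show ?thesis
    unfolding grid_def disc_def by (intro image_eqI[of _ _ "\<lfloor>x * 2 ^ m\<rfloor> + 1"]) auto
qed

text \<open>Integrals split along the finitely many values of \<open>\<theta>\<close>. The
  comparison is an inequality because it serves two purposes: once with absolute values for the tail
  estimate, and once with both signs for the martingale identity.\<close>

lemma integral_simple_time:
  fixes h :: "real \<Rightarrow> 'a \<Rightarrow> real"
  assumes V: "finite V" and th: "\<And>w. w \<in> space P \<Longrightarrow> \<theta> w \<in> V"
    and h: "\<And>v. v \<in> V \<Longrightarrow> integrable P (h v)" and h': "integrable P h'"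
    and meas: "\<And>v. v \<in> V \<Longrightarrow> {w \<in> space P. \<theta> w = v} \<in> sets P"
  shows "integrable P (\<lambda>w. h (\<theta> w) w)"
    and "A \<in> sets P \<Longrightarrow> (\<And>v. v \<in> V \<Longrightarrow> (\<integral>w. indicator {w \<in> A. \<theta> w = v} w * h v w \<partial>P)
        \<le> (\<integral>w. indicator {w \<in> A. \<theta> w = v} w * h' w \<partial>P)) \<Longrightarrow>
      (\<integral>w. indicator A w * h (\<theta> w) w \<partial>P) \<le> (\<integral>w. indicator A w * h' w \<partial>P)"
proof -
  have eq: "h (\<theta> w) w = (\<Sum>v\<in>V. indicator {w \<in> space P. \<theta> w = v} w * h v w)" if "w \<in> space P" for w
    using th[OF that] V that by (simp add: indicator_def if_distrib[of "\<lambda>x. x * _"] cong: if_cong)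
  have "integrable P (\<lambda>w. \<Sum>v\<in>V. indicator {w \<in> space P. \<theta> w = v} w * h v w)"
    by (intro Bochner_Integration.integrable_sum integrable_ind meas h)
  then show int: "integrable P (\<lambda>w. h (\<theta> w) w)"
    by (rule iffD1[OF Bochner_Integration.integrable_cong, rotated -1]) (auto simp: eq)
  assume A: "A \<in> sets P" and le: "\<And>v. v \<in> V \<Longrightarrow> (\<integral>w. indicator {w \<in> A. \<theta> w = v} w * h v w \<partial>P)
        \<le> (\<integral>w. indicator {w \<in> A. \<theta> w = v} w * h' w \<partial>P)"
  have Asp: "A \<subseteq> space P" using A by (rule sets.sets_into_space)
  have AV: "{w \<in> A. \<theta> w = v} \<in> sets P" if "v \<in> V" for v
  proof -
    have "{w \<in> A. \<theta> w = v} = A \<inter> {w \<in> space P. \<theta> w = v}" using Asp by auto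
    then show ?thesis using A meas[OF that] by auto
  qed
  have "(\<integral>w. indicator A w * h (\<theta> w) w \<partial>P) = (\<integral>w. (\<Sum>v\<in>V. indicator {w \<in> A. \<theta> w = v} w * h v w) \<partial>P)"
    by (intro Bochner_Integration.integral_cong) (auto simp: eq indicator_def sum_distrib_left)
  also have "\<dots> = (\<Sum>v\<in>V. \<integral>w. indicator {w \<in> A. \<theta> w = v} w * h v w \<partial>P)"
    by (intro Bochner_Integration.integral_sum integrable_ind AV h)
  also have "\<dots> \<le> (\<Sum>v\<in>V. \<integral>w. indicator {w \<in> A. \<theta> w = v} w * h' w \<partial>P)"
    by (intro sum_mono le)
  also have "\<dots> = (\<integral>w. (\<Sum>v\<in>V. indicator {w \<in> A. \<theta> w = v} w * h' w) \<partial>P)"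
    by (intro Bochner_Integration.integral_sum[symmetric] integrable_ind AV h')
  also have "\<dots> = (\<integral>w. indicator A w * h' w \<partial>P)"
  proof (intro Bochner_Integration.integral_cong refl)
    fix w assume "w \<in> space P"
    then show "(\<Sum>v\<in>V. indicator {w \<in> A. \<theta> w = v} w * h' w) = indicator A w * h' w"
      using th V by (simp add: indicator_def if_distrib[of "\<lambda>x. x * _"] cong: if_cong)
  qed
  finally show "(\<integral>w. indicator A w * h (\<theta> w) w \<partial>P) \<le> (\<integral>w. indicator A w * h' w \<partial>P)" .
qed

text \<open>\<open>Z\<close> is a version of the martingale \<open>E[\<xi> | G\<^sub>t]\<close> on the interval \<open>[0, n]\<close>.\<close>

definition closed_by :: "real \<Rightarrow> ('a \<Rightarrow> real) \<Rightarrow> (real \<Rightarrow> 'a \<Rightarrow> real) \<Rightarrow> bool" where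
  "closed_by n \<xi> Z \<longleftrightarrow> integrable P \<xi> \<and> (\<forall>t. 0 \<le> t \<longrightarrow> t \<le> n \<longrightarrow>
     Z t \<in> borel_measurable (G t) \<and> integrable P (Z t) \<and>
     (\<forall>A\<in>sets (G t). (\<integral>w. indicator A w * Z t w \<partial>P) = (\<integral>w. indicator A w * \<xi> w \<partial>P)))"

text \<open>Conditional Jensen inequality for the absolute value: \<open>A\<close> is cut along the
  sign of \<open>Z t\<close>, on each piece \<open>Z t\<close> and \<open>\<xi>\<close> have the
  same integral, and \<open>\<bar>\<xi>\<bar>\<close> dominates both \<open>\<xi>\<close> and its
  negative.\<close>

lemma closed_by_abs:
  assumes "closed_by n \<xi> Z" "0 \<le> t" "t \<le> n" "A \<in> sets (G t)"
  shows "(\<integral>w. indicator A w * \<bar>Z t w\<bar> \<partial>P) \<le> (\<integral>w. indicator A w * \<bar>\<xi> w\<bar> \<partial>P)"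
proof -
  have Zm[measurable]: "Z t \<in> borel_measurable (G t)" and Zi: "integrable P (Z t)" and xi: "integrable P \<xi>"
    using assms by (auto simp: closed_by_def)
  have [measurable]: "A \<in> sets (G t)" by fact
  define B C where "B = {w \<in> space (G t). w \<in> A \<and> 0 \<le> Z t w}" and "C = {w \<in> space (G t). w \<in> A \<and> Z t w < 0}"
  have BC: "B \<in> sets (G t)" "C \<in> sets (G t)" unfolding B_def C_def by measurable
  note BCP = this[THEN sets_G[OF assms(2)]]
  have "(\<integral>w. indicator A w * \<bar>Z t w\<bar> \<partial>P) = (\<integral>w. indicator B w * Z t w - indicator C w * Z t w \<partial>P)"
    by (intro Bochner_Integration.integral_cong refl)
      (auto simp: B_def C_def space_G[OF assms(2)] indicator_def)
  also have "\<dots> = (\<integral>w. indicator B w * Z t w \<partial>P) - (\<integral>w. indicator C w * Z t w \<partial>P)"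
    by (intro Bochner_Integration.integral_diff integrable_ind BCP Zi)
  also have "\<dots> = (\<integral>w. indicator B w * \<xi> w \<partial>P) - (\<integral>w. indicator C w * \<xi> w \<partial>P)"
    using assms BC by (simp add: closed_by_def)
  also have "\<dots> = (\<integral>w. indicator B w * \<xi> w - indicator C w * \<xi> w \<partial>P)"
    by (intro Bochner_Integration.integral_diff[symmetric] integrable_ind BCP xi)
  also have "\<dots> \<le> (\<integral>w. indicator A w * \<bar>\<xi> w\<bar> \<partial>P)"
    by (intro integral_mono Bochner_Integration.integrable_diff integrable_ind BCP integrable_abs xi sets_G[OF assms(2,4)])
      (auto simp: B_def C_def space_G[OF assms(2)] indicator_def)
  finally show ?thesis .
qed

lemma measurable_simple_time:
  assumes V: "finite V" and th: "\<And>w. w \<in> space A \<Longrightarrow> \<theta> w \<in> V"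
    and h: "\<And>v. v \<in> V \<Longrightarrow> h v \<in> borel_measurable A"
    and meas: "\<And>v. v \<in> V \<Longrightarrow> {w \<in> space A. \<theta> w = v} \<in> sets A"
  shows "(\<lambda>w. h (\<theta> w) w :: real) \<in> borel_measurable A"
proof -
  have "(\<lambda>w. \<Sum>v\<in>V. indicator {w \<in> space A. \<theta> w = v} w * h v w) \<in> borel_measurable A"
    by (intro borel_measurable_sum borel_measurable_times borel_measurable_indicator meas h)
  then show ?thesis
    by (rule measurable_cong[THEN iffD1, rotated])
      (use th V in \<open>simp add: indicator_def if_distrib[of "\<lambda>x. x * _"] cong: if_cong\<close>)
qed

text \<open>The discretised times are truncated at \<open>t\<close>, so each of their values is
  already known at \<open>t\<close>. Right continuity of the paths identifies the limit, and
  completeness disposes of the exceptional outcomes.\<close>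

lemma stopped_value_measurable:
  fixes Z :: "real \<Rightarrow> 'a \<Rightarrow> real"
  assumes t: "0 \<le> t" and Z: "\<And>s. 0 \<le> s \<Longrightarrow> s \<le> t \<Longrightarrow> Z s \<in> borel_measurable (G s)"
    and rc: "AE w in P. \<forall>s\<ge>0. ((\<lambda>s. Z s w) \<longlongrightarrow> Z s w) (at_right s)"
    and th: "space P \<in> past \<theta>" "\<And>w. w \<in> space P \<Longrightarrow> 0 \<le> \<theta> w \<and> \<theta> w \<le> t"
  shows "(\<lambda>w. Z (\<theta> w) w) \<in> borel_measurable (G t)"
proof -
  let ?f = "\<lambda>m w. Z (min (disc m (\<theta> w)) t) w"
  have [measurable]: "?f m \<in> borel_measurable (G t)" for m
  proof (rule measurable_simple_time[where h = Z and V = "grid m t"])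
    have *: "space P \<in> past (\<lambda>w. min (disc m (\<theta> w)) t)" by (rule past_disc) (use th in auto)
    fix v assume vg: "v \<in> grid m t"
    have v: "0 \<le> v" "v \<le> t" using subsetD[OF grid(2)[OF t] vg] by auto
    show "Z v \<in> borel_measurable (G t)" by (rule measurable_G_mono[OF v Z[OF v]])
    have "0 \<le> min (disc m (\<theta> w)) t" if "w \<in> space P" for w
      using th(2)[OF that] disc_gt[of "\<theta> w" m] by simp
    then have "{w \<in> space P. min (disc m (\<theta> w)) t = v} \<in> sets (G v)"
      by (intro past_eq[OF * v(1)])
    then show "{w \<in> space (G t). min (disc m (\<theta> w)) t = v} \<in> sets (G t)"
      unfolding space_G[OF t] by (rule sets_G_mono[OF v])
  next
    show "\<And>w. w \<in> space (G t) \<Longrightarrow> min (disc m (\<theta> w)) t \<in> grid m t"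
      using th(2) disc_in_grid unfolding space_G[OF t] by blast
  qed (rule grid)
  have "(\<lambda>w. lim (\<lambda>m. ?f m w)) \<in> borel_measurable (G t)" by measurable
  then show ?thesis
  proof (rule measurable_AE_G[OF t])
    show "AE w in P. lim (\<lambda>m. ?f m w) = Z (\<theta> w) w"
      using rc AE_space
    proof eventually_elim
      case (elim w)
      then have "(\<lambda>m. ?f m w) \<longlonglongrightarrow> Z (\<theta> w) w"
        by (intro tendsto_min_disc[where f = "\<lambda>s. Z s w"]) (use th in auto)
      then show ?case by (rule limI)
    qed
  qed
qed

text \<open>For a discretised time the identity holds cell by cell, since the cell with value
  \<open>v\<close> belongs to \<open>G v\<close>. The same decomposition bounds its tails by those
  of \<open>\<xi>\<close>, which makes the passage to \<open>\<theta>\<close> uniformly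
  integrable.\<close>

theorem optional_stopping:
  assumes n: "0 \<le> n" and Z: "closed_by n \<xi> Z"
    and rc: "AE w in P. \<forall>s\<ge>0. ((\<lambda>s. Z s w) \<longlongrightarrow> Z s w) (at_right s)"
    and th: "space P \<in> past \<theta>" "\<And>w. w \<in> space P \<Longrightarrow> 0 \<le> \<theta> w \<and> \<theta> w \<le> n"
  shows "integrable P (\<lambda>w. Z (\<theta> w) w)"
    and "A \<in> past \<theta> \<Longrightarrow>
      (\<integral>w. indicator A w * Z (\<theta> w) w \<partial>P) = (\<integral>w. indicator A w * \<xi> w \<partial>P)"
proof -
  let ?\<theta> = "\<lambda>m w. min (disc m (\<theta> w)) n"
  let ?f = "\<lambda>m w. Z (?\<theta> m w) w"
  have pos: "0 \<le> ?\<theta> m w" if "w \<in> space P" for m w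
    using th(2)[OF that] disc_gt[of "\<theta> w" m] by simp
  have sp: "space P \<in> past (?\<theta> m)" for m by (rule past_disc) (use th in auto)
  have V: "finite (grid m n)" "\<And>w. w \<in> space P \<Longrightarrow> ?\<theta> m w \<in> grid m n" for m
    using grid disc_in_grid th by auto
  have vn: "0 \<le> v" "v \<le> n" if "v \<in> grid m n" for v m
    using subsetD[OF grid(2)[OF n] that] by auto
  have xi: "integrable P \<xi>" and Zi: "\<And>t. 0 \<le> t \<Longrightarrow> t \<le> n \<Longrightarrow> integrable P (Z t)"
    and Zm: "\<And>t. 0 \<le> t \<Longrightarrow> t \<le> n \<Longrightarrow> Z t \<in> borel_measurable (G t)"
    using Z unfolding closed_by_def by blast+
  have cell: "{w \<in> space P. ?\<theta> m w = v} \<in> sets (G v)" if "v \<in> grid m n" for m v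
    by (rule past_eq[OF sp vn(1)[OF that] pos])
  have cellP: "{w \<in> space P. ?\<theta> m w = v} \<in> sets P" if "v \<in> grid m n" for m v
    by (rule sets_G[OF vn(1)[OF that] cell[OF that]])
  have fi: "integrable P (?f m)" for m
    by (rule integral_simple_time(1)[OF V(1)[of m] V(2), where h' = \<xi>])
      (use Zi vn xi cellP in auto)
  have gm: "(\<lambda>w. Z (\<theta> w) w) \<in> borel_measurable P"
    by (rule measurable_G[OF n stopped_value_measurable[OF n]]) (use Zm rc th in auto)
  have tail: "(\<integral>w. indicator {w\<in>space P. K < \<bar>?f m w\<bar>} w * \<bar>?f m w\<bar> \<partial>P)
      \<le> (\<integral>w. indicator {w\<in>space P. K < \<bar>?f m w\<bar>} w * \<bar>\<xi> w\<bar> \<partial>P)" for m K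
  proof (rule integral_simple_time(2)[OF V(1)[of m] V(2), where h = "\<lambda>v w. \<bar>Z v w\<bar>"])
    have [measurable]: "?f m \<in> borel_measurable P" using fi by (rule borel_measurable_integrable)
    show "{w\<in>space P. K < \<bar>?f m w\<bar>} \<in> sets P" by measurable
    fix v assume v: "v \<in> grid m n"
    have [measurable]: "Z v \<in> borel_measurable (G v)" using Zm vn[OF v] by auto
    have "{w \<in> {w\<in>space P. K < \<bar>?f m w\<bar>}. ?\<theta> m w = v}
        = {w \<in> space P. ?\<theta> m w = v} \<inter> {w \<in> space (G v). K < \<bar>Z v w\<bar>}"
      using space_G[OF vn(1)[OF v]] by auto
    moreover have "\<dots> \<in> sets (G v)" by (rule sets.Int[OF cell[OF v]]) measurable
    ultimately have "{w \<in> {w\<in>space P. K < \<bar>?f m w\<bar>}. ?\<theta> m w = v} \<in> sets (G v)" by simp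
    from closed_by_abs[OF Z vn[OF v] this]
    show "(\<integral>w. indicator {w \<in> {w\<in>space P. K < \<bar>?f m w\<bar>}. ?\<theta> m w = v} w * \<bar>Z v w\<bar> \<partial>P)
      \<le> (\<integral>w. indicator {w \<in> {w\<in>space P. K < \<bar>?f m w\<bar>}. ?\<theta> m w = v} w * \<bar>\<xi> w\<bar> \<partial>P)" .
  qed (use Zi vn xi cellP in auto)
  have lim: "AE w in P. (\<lambda>m. ?f m w) \<longlonglongrightarrow> Z (\<theta> w) w"
    using rc AE_space
    by eventually_elim (rule tendsto_min_disc[where f = "\<lambda>s. Z s _"], use th in auto)
  show "integrable P (\<lambda>w. Z (\<theta> w) w)"
    by (rule set_integral_lim_tail_dominated(1)[OF xi fi gm tail lim])
  assume A: "A \<in> past \<theta>"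
  then have AP: "A \<in> sets P" and Asp: "A \<subseteq> space P" by (auto simp: past_def dest: sets.sets_into_space)
  have A2: "A \<in> past (?\<theta> m)" for m by (rule past_disc[OF A]) (use th Asp in auto)
  have Acell: "{w \<in> A. ?\<theta> m w = v} \<in> sets (G v)" if "v \<in> grid m n" for m v
    by (rule past_eq[OF A2 vn(1)[OF that] pos[OF subsetD[OF Asp]]])
  have eq: "(\<integral>w. indicator {w \<in> A. ?\<theta> m w = v} w * Z v w \<partial>P)
      = (\<integral>w. indicator {w \<in> A. ?\<theta> m w = v} w * \<xi> w \<partial>P)" if "v \<in> grid m n" for m v
    using Z vn[OF that] Acell[OF that] by (auto simp: closed_by_def)
  have "(\<integral>w. indicator A w * ?f m w \<partial>P) = (\<integral>w. indicator A w * \<xi> w \<partial>P)" for m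
  proof (rule antisym)
    show "(\<integral>w. indicator A w * ?f m w \<partial>P) \<le> (\<integral>w. indicator A w * \<xi> w \<partial>P)"
      by (rule integral_simple_time(2)[OF V(1)[of m] V(2), where h = Z])
        (use Zi vn xi cellP AP eq in auto)
    have "(\<integral>w. indicator A w * (- ?f m w) \<partial>P) \<le> (\<integral>w. indicator A w * (- \<xi> w) \<partial>P)"
      by (rule integral_simple_time(2)[OF V(1)[of m] V(2), where h = "\<lambda>v w. - Z v w"])
        (use Zi vn xi cellP AP eq in auto)
    then show "(\<integral>w. indicator A w * \<xi> w \<partial>P) \<le> (\<integral>w. indicator A w * ?f m w \<partial>P)" by simp
  qed
  then show "(\<integral>w. indicator A w * Z (\<theta> w) w \<partial>P) = (\<integral>w. indicator A w * \<xi> w \<partial>P)"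
    by (rule set_integral_lim_tail_dominated(2)[OF xi fi gm tail lim AP])
qed

end

section \<open>Regularization of closed martingales\<close>

text \<open>Right continuity of the filtration is used twice: a limit from the right has to be
  measurable at the limiting time, and a first exceedance time has to be a stopping time.\<close>

locale usual_filtered_space = complete_filtered_space +
  assumes rc: "right_continuous_filtration G"
begin

lemma measurable_right_limit:
  assumes t: "0 \<le> t" and f: "\<And>u. t < u \<Longrightarrow> f \<in> borel_measurable (G u)"
  shows "(f :: 'a \<Rightarrow> real) \<in> borel_measurable (G t)"
proof (rule measurableI)
  fix B :: "real set" assume B: "B \<in> sets borel"
  have "f -` B \<inter> space P \<in> sets (G u)" if u: "t < u" for u
    using measurable_sets[OF f[OF u] B] space_G[of u] t u by simp
  then have "f -` B \<inter> space P \<in> (\<Inter>u\<in>{t<..}. sets (G u))" by blast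
  then show "f -` B \<inter> space (G t) \<in> sets (G t)"
    using rc t unfolding right_continuous_filtration_def space_G[OF t] by blast
qed simp

end

context complete_filtered_space
begin

lemma cond_exp_subalgebra: "0 \<le> t \<Longrightarrow> sigma_finite_subalgebra P (G t)"
  using finite_measure_subalgebra.intro[OF finite_measure_axioms] subalg_G[of t]
    finite_measure_subalgebra.axioms finite_measure_subalgebra_axioms.intro
  by (metis finite_measure_subalgebra_is_sigma_finite)

lemma closed_by_cond_exp:
  assumes "integrable P \<xi>"
  shows "closed_by n \<xi> (\<lambda>t. real_cond_exp P (G t) \<xi>)"
  unfolding closed_by_def
proof (intro conjI allI impI ballI)
  fix t :: real assume t: "0 \<le> t"
  interpret sigma_finite_subalgebra P "G t" by (rule cond_exp_subalgebra[OF t])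
  show "integrable P (real_cond_exp P (G t) \<xi>)" by (rule real_cond_exp_int(1)[OF assms])
  show "(\<integral>w. indicator A w * real_cond_exp P (G t) \<xi> w \<partial>P) = (\<integral>w. indicator A w * \<xi> w \<partial>P)"
    if "A \<in> sets (G t)" for A
    using real_cond_exp_intA[OF assms that] by (simp add: set_lebesgue_integral_def)
qed (use assms in auto)

section \<open>Doob's maximal and upcrossing inequalities along finite lists of times\<close>

context
  fixes \<xi> :: "'a \<Rightarrow> real" and y :: "real \<Rightarrow> 'a \<Rightarrow> real"
  assumes closed: "\<And>n. closed_by n \<xi> y"
begin

lemma closed_facts:
  shows "integrable P \<xi>" and "0 \<le> t \<Longrightarrow> y t \<in> borel_measurable (G t)" and "0 \<le> t \<Longrightarrow> integrable P (y t)"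
    and "0 \<le> t \<Longrightarrow> A \<in> sets (G t) \<Longrightarrow> (\<integral>w. indicator A w * y t w \<partial>P) = (\<integral>w. indicator A w * \<xi> w \<partial>P)"
  using closed[of t] by (auto simp: closed_by_def)

text \<open>Doob's maximal inequality, the first exceedance being found by recursion: where the
  level is passed at the head of the list \<open>closed_by_abs\<close> settles the matter, and the
  rest of \<open>A\<close>, still an event known at that time, is handed to the tail. Therefore the
  inequality is stated on an arbitrary \<open>A\<close> in \<open>G s\<close>.\<close>

lemma maximal_list:
  assumes "0 \<le> L" "0 \<le> s" "A \<in> sets (G s)" "sorted_wrt (<) ts" "\<And>t. t \<in> set ts \<Longrightarrow> s \<le> t"
  shows "{w \<in> A. \<exists>t\<in>set ts. L < \<bar>y t w\<bar>} \<in> sets P"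
    and "L * measure P {w \<in> A. \<exists>t\<in>set ts. L < \<bar>y t w\<bar>} \<le> (\<integral>w. indicator A w * \<bar>\<xi> w\<bar> \<partial>P)"
proof -
  \<comment> \<open>Both claims are proved together, as the estimate for the longer list uses
    measurability of the event of the shorter one.\<close>
  have "{w \<in> A. \<exists>t\<in>set ts. L < \<bar>y t w\<bar>} \<in> sets P \<and>
    L * measure P {w \<in> A. \<exists>t\<in>set ts. L < \<bar>y t w\<bar>} \<le> (\<integral>w. indicator A w * \<bar>\<xi> w\<bar> \<partial>P)"
    using assms(2-)
  proof (induction ts arbitrary: A s)
    case Nil
    then show ?case by (auto intro!: integral_nonneg_AE)
  next
    case (Cons t ts)
    have st: "s \<le> t" "0 \<le> t" using Cons.prems(1) Cons.prems(4)[of t] by auto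
    have [measurable]: "y t \<in> borel_measurable (G t)" by (rule closed_facts(2)[OF st(2)])
    let ?B = "{w \<in> space (G t). L < \<bar>y t w\<bar>}"
    have B: "?B \<in> sets (G t)" by measurable
    have A: "A \<in> sets (G t)" by (rule sets_G_mono[OF Cons.prems(1) st(1) Cons.prems(2)])
    have AB: "A \<inter> ?B \<in> sets (G t)" "A - ?B \<in> sets (G t)" using A B by auto
    note P = A[THEN sets_G[OF st(2)]] B[THEN sets_G[OF st(2)]] AB[THEN sets_G[OF st(2)]]
    have Asp: "A \<subseteq> space (G t)" using A by (rule sets.sets_into_space)
    let ?E = "\<lambda>A ts. {w \<in> A. \<exists>t\<in>set ts. L < \<bar>y t w\<bar>}"
    have IH: "?E (A - ?B) ts \<in> sets P"
        "L * measure P (?E (A - ?B) ts) \<le> (\<integral>w. indicator (A - ?B) w * \<bar>\<xi> w\<bar> \<partial>P)"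
      using Cons.IH[OF st(2) AB(2)] Cons.prems(3) by (auto simp: less_imp_le)
    have eq: "?E A (t # ts) = (A \<inter> ?B) \<union> ?E (A - ?B) ts" using Asp by auto
    have "L * measure P (A \<inter> ?B) = (\<integral>w. L * indicator (A \<inter> ?B) w \<partial>P)" using P by simp
    also have "\<dots> \<le> (\<integral>w. indicator (A \<inter> ?B) w * \<bar>y t w\<bar> \<partial>P)"
    proof (rule integral_mono)
      show "integrable P (\<lambda>w. L * indicator (A \<inter> ?B) w)"
        by (intro integrable_mult_right integrable_real_indicator P) (auto simp: emeasure_eq_measure)
      show "integrable P (\<lambda>w. indicator (A \<inter> ?B) w * \<bar>y t w\<bar>)"
        by (intro integrable_ind P integrable_abs closed_facts st)
    qed (auto split: split_indicator)
    also have "\<dots> \<le> (\<integral>w. indicator (A \<inter> ?B) w * \<bar>\<xi> w\<bar> \<partial>P)"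
      by (rule closed_by_abs[OF closed[of t] st(2) order_refl AB(1)])
    finally have "L * measure P (A \<inter> ?B) + L * measure P (?E (A - ?B) ts) \<le> (\<integral>w. indicator A w * \<bar>\<xi> w\<bar> \<partial>P)"
      using IH(2) integral_split[OF P(1,2), of "\<lambda>w. \<bar>\<xi> w\<bar>"] closed_facts(1) by auto
    moreover have "measure P (?E A (t # ts)) \<le> measure P (A \<inter> ?B) + measure P (?E (A - ?B) ts)"
      unfolding eq by (rule measure_Un_le[OF P(3) IH(1)])
    ultimately have "L * measure P (?E A (t # ts)) \<le> (\<integral>w. indicator A w * \<bar>\<xi> w\<bar> \<partial>P)"
      using mult_left_mono[of "measure P (?E A (t # ts))" "measure P (A \<inter> ?B) + measure P (?E (A - ?B) ts)" L] assms(1)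
      by (simp add: distrib_left)
    moreover have "?E A (t # ts) \<in> sets P" unfolding eq using P(3) IH(1) by (rule sets.Un)
    ultimately show ?case by simp
  qed
  then show "{w \<in> A. \<exists>t\<in>set ts. L < \<bar>y t w\<bar>} \<in> sets P"
    and "L * measure P {w \<in> A. \<exists>t\<in>set ts. L < \<bar>y t w\<bar>} \<le> (\<integral>w. indicator A w * \<bar>\<xi> w\<bar> \<partial>P)" by auto
qed

definition nup :: "real \<Rightarrow> real \<Rightarrow> bool \<Rightarrow> real list \<Rightarrow> 'a \<Rightarrow> real" where
  "nup a b h ts w = real (upcrossings a b h (map (\<lambda>t. y t w) ts))"

lemma nup_measurable:
  assumes "\<And>t. t \<in> set ts \<Longrightarrow> 0 \<le> t" shows "nup a b h ts \<in> borel_measurable P"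
  using assms
proof (induction ts arbitrary: h)
  case Nil
  then show ?case by (simp add: nup_def)
next
  case (Cons t ts)
  have [measurable]: "y t \<in> borel_measurable P" using closed_facts(3)[of t] Cons.prems by auto
  have [measurable]: "nup a b h ts \<in> borel_measurable P" for h using Cons by auto
  have F: "nup a b False (t # ts) w = (if y t w < a then nup a b True ts w else nup a b False ts w)" for w
    by (simp add: nup_def)
  have T: "nup a b True (t # ts) w = (if b < y t w then 1 + nup a b False ts w else nup a b True ts w)" for w
    by (simp add: nup_def)
  show ?case by (cases h) (simp_all add: F T cong: measurable_cong)
qed

lemma nup_integrable:
  assumes "\<And>t. t \<in> set ts \<Longrightarrow> 0 \<le> t" shows "integrable P (nup a b h ts)"
proof (rule integrable_const_bound[where B = "real (length ts)"])
  show "AE w in P. norm (nup a b h ts w) \<le> real (length ts)"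
    using upcrossings_le_length[of a b h "map (\<lambda>t. y t _) ts"] by (auto simp: nup_def)
qed (rule nup_measurable[OF assms])

text \<open>While no stock is held the expected future gain of the upcrossing strategy is bounded below by
  \<open>- E(\<bar>\<xi>\<bar> + \<bar>a\<bar>)\<close>; while stock is held the current excess of the price over \<open>a\<close> is at stake in addition.\<close>

lemma upcrossing_inequality:
  assumes ab: "a < b"
    and "0 \<le> s" "A \<in> sets (G s)" "sorted_wrt (<) ts" "\<And>t. t \<in> set ts \<Longrightarrow> s \<le> t"
  shows "(b - a) * (\<integral>w. indicator A w * nup a b False ts w \<partial>P) \<le> (\<integral>w. indicator A w * (\<bar>\<xi> w\<bar> + \<bar>a\<bar>) \<partial>P)
    \<and> (b - a) * (\<integral>w. indicator A w * nup a b True ts w \<partial>P)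
        \<le> (\<integral>w. indicator A w * (\<xi> w - a + (\<bar>\<xi> w\<bar> + \<bar>a\<bar>)) \<partial>P)"
  using assms(2-)
proof (induction ts arbitrary: A s)
  case Nil
  have "0 \<le> indicator A w * (\<xi> w - a + (\<bar>\<xi> w\<bar> + \<bar>a\<bar>))" for w by (auto split: split_indicator)
  then show ?case by (auto simp: nup_def intro!: integral_nonneg_AE)
next
  case (Cons t ts)
  have st: "s \<le> t" "0 \<le> t" using Cons.prems(1) Cons.prems(4)[of t] by auto
  have pos: "0 \<le> r" if "r \<in> set (t # ts)" for r using Cons.prems(4)[OF that] Cons.prems(1) by simp
  then have pos': "0 \<le> r" if "r \<in> set ts" for r using that by simp
  have [measurable]: "y t \<in> borel_measurable (G t)" by (rule closed_facts(2)[OF st(2)])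
  have A: "A \<in> sets (G t)" by (rule sets_G_mono[OF Cons.prems(1) st(1) Cons.prems(2)])
  have Asp: "A \<subseteq> space (G t)" using A by (rule sets.sets_into_space)
  let ?B = "{w \<in> space (G t). y t w < a}" and ?C = "{w \<in> space (G t). b < y t w}"
  let ?W = "\<lambda>w. \<bar>\<xi> w\<bar> + \<bar>a\<bar>" and ?V = "\<lambda>w. \<xi> w - a + (\<bar>\<xi> w\<bar> + \<bar>a\<bar>)"
  let ?I = "\<lambda>A h. \<integral>w. indicator A w * h w \<partial>P"
  have BC: "?B \<in> sets (G t)" "?C \<in> sets (G t)" by measurable
  have S: "A \<inter> ?B \<in> sets (G t)" "A - ?B \<in> sets (G t)" "A \<inter> ?C \<in> sets (G t)" "A - ?C \<in> sets (G t)"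
    using A BC by auto
  note SP = S[THEN sets_G[OF st(2)]] and BCP = BC[THEN sets_G[OF st(2)]]
    and AP = A[THEN sets_G[OF st(2)]]
  have Wi: "integrable P ?W" and Vi: "integrable P ?V" using closed_facts(1) by auto
  have nupi: "integrable P (nup a b h ts)" "integrable P (nup a b h (t # ts))" for h
    by (intro nup_integrable pos'; assumption) (intro nup_integrable pos)
  have IH: "(b - a) * ?I D (nup a b False ts) \<le> ?I D ?W" "(b - a) * ?I D (nup a b True ts) \<le> ?I D ?V"
    if "D \<in> sets (G t)" for D
    using Cons.IH[OF st(2) that] Cons.prems(3) by (auto simp: less_imp_le)
  \<comment> \<open>On events known at \<open>t\<close> the closing variable may be exchanged for
    the current price.\<close>
  have Veq: "?I D ?V = ?I D (\<lambda>w. y t w - a) + ?I D ?W" if D: "D \<in> sets (G t)" for D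
  proof -
    have DP: "D \<in> sets P" by (rule sets_G[OF st(2) D])
    have i: "integrable P (\<lambda>w. indicator D w * \<xi> w)" "integrable P (\<lambda>w. indicator D w * y t w)"
      "integrable P (\<lambda>w. indicator D w * a)" "integrable P (\<lambda>w. indicator D w * ?W w)"
      using closed_facts(1) closed_facts(3)[OF st(2)] by (intro integrable_ind DP; simp)+
    have "?I D ?V = (\<integral>w. indicator D w * \<xi> w - indicator D w * a + indicator D w * ?W w \<partial>P)"
      by (intro Bochner_Integration.integral_cong refl) (auto split: split_indicator)
    also have "\<dots> = ?I D \<xi> - ?I D (\<lambda>_. a) + ?I D ?W"
      by (simp only: Bochner_Integration.integral_add Bochner_Integration.integral_diff
          Bochner_Integration.integrable_diff i)
    also have "\<dots> = ?I D (y t) - ?I D (\<lambda>_. a) + ?I D ?W" using closed_facts(4)[OF st(2) D] by simp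
    also have "\<dots> = (\<integral>w. indicator D w * y t w - indicator D w * a \<partial>P) + ?I D ?W"
      by (simp only: Bochner_Integration.integral_diff i)
    also have "(\<integral>w. indicator D w * y t w - indicator D w * a \<partial>P) = ?I D (\<lambda>w. y t w - a)"
      by (simp add: right_diff_distrib)
    finally show ?thesis .
  qed
  have yi: "integrable P (\<lambda>w. y t w - a)" using closed_facts(3)[OF st(2)] by auto
  have "(b - a) * ?I A (nup a b False (t # ts)) \<le> ?I A ?W"
  proof -
    have "?I A (nup a b False (t # ts)) = ?I (A \<inter> ?B) (nup a b False (t # ts)) + ?I (A - ?B) (nup a b False (t # ts))"
      by (rule integral_split[OF AP BCP(1) nupi(2)])
    also have "?I (A \<inter> ?B) (nup a b False (t # ts)) = ?I (A \<inter> ?B) (nup a b True ts)"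
      by (intro Bochner_Integration.integral_cong refl) (auto simp: nup_def split: split_indicator)
    also have "?I (A - ?B) (nup a b False (t # ts)) = ?I (A - ?B) (nup a b False ts)"
      by (intro Bochner_Integration.integral_cong refl) (use Asp in \<open>auto simp: nup_def split: split_indicator\<close>)
    finally have "(b - a) * ?I A (nup a b False (t # ts)) \<le> ?I (A \<inter> ?B) ?V + ?I (A - ?B) ?W"
      using IH(2)[OF S(1)] IH(1)[OF S(2)] by (simp add: distrib_left)
    also have "?I (A \<inter> ?B) ?V \<le> ?I (A \<inter> ?B) ?W"
    proof -
      have "?I (A \<inter> ?B) (\<lambda>w. y t w - a) \<le> ?I (A \<inter> ?B) (\<lambda>w. 0)"
        by (intro integral_mono integrable_ind SP yi) (auto split: split_indicator)
      then show ?thesis using Veq[OF S(1)] by simp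
    qed
    finally show ?thesis using integral_split[OF AP BCP(1) Wi] by simp
  qed
  \<comment> \<open>A sale on \<open>?C\<close> contributes \<open>b - a\<close>, which the stake
    \<open>y t - a\<close> covers because the price exceeds \<open>b\<close> there.\<close>
  moreover have "(b - a) * ?I A (nup a b True (t # ts)) \<le> ?I A ?V"
  proof -
    have "?I A (nup a b True (t # ts)) = ?I (A \<inter> ?C) (nup a b True (t # ts)) + ?I (A - ?C) (nup a b True (t # ts))"
      by (rule integral_split[OF AP BCP(2) nupi(2)])
    also have "?I (A \<inter> ?C) (nup a b True (t # ts)) = ?I (A \<inter> ?C) (\<lambda>w. 1 + nup a b False ts w)"
      by (intro Bochner_Integration.integral_cong refl) (auto simp: nup_def split: split_indicator)
    also have "?I (A \<inter> ?C) (\<lambda>w. 1 + nup a b False ts w) = ?I (A \<inter> ?C) (\<lambda>_. 1) + ?I (A \<inter> ?C) (nup a b False ts)"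
      unfolding distrib_left
      by (intro Bochner_Integration.integral_add integrable_ind SP nupi integrable_const)
    also have "?I (A - ?C) (nup a b True (t # ts)) = ?I (A - ?C) (nup a b True ts)"
      by (intro Bochner_Integration.integral_cong refl) (use Asp in \<open>auto simp: nup_def split: split_indicator\<close>)
    finally have "(b - a) * ?I A (nup a b True (t # ts))
        \<le> (b - a) * ?I (A \<inter> ?C) (\<lambda>_. 1) + ?I (A \<inter> ?C) ?W + ?I (A - ?C) ?V"
      using IH(1)[OF S(3)] IH(2)[OF S(4)] by (simp add: distrib_left)
    also have "(b - a) * ?I (A \<inter> ?C) (\<lambda>_. 1) \<le> ?I (A \<inter> ?C) (\<lambda>w. y t w - a)"
    proof -
      have "(b - a) * ?I (A \<inter> ?C) (\<lambda>_. 1) = ?I (A \<inter> ?C) (\<lambda>_. b - a)" by simp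
      also have "\<dots> \<le> ?I (A \<inter> ?C) (\<lambda>w. y t w - a)"
        by (intro integral_mono integrable_ind SP yi integrable_const) (auto split: split_indicator)
      finally show ?thesis .
    qed
    finally show ?thesis using integral_split[OF AP BCP(2) Vi] Veq[OF S(3)] by simp
  qed
  ultimately show ?case by simp
qed

text \<open>Both inequalities bound finite lists by constants that do not depend on the list, so
  they survive the limit along finite sets exhausting the rationals of
  \<open>[0, n]\<close>.\<close>

lemma AE_regular:
  fixes n :: nat
  shows "AE w in P. \<exists>B. \<forall>x\<in>\<rat> \<inter> {0..real n}. \<bar>y x w\<bar> \<le> B"
    and "a < b \<Longrightarrow> AE w in P. \<exists>c. \<forall>xs. sorted_wrt (<) xs \<longrightarrow> set xs \<subseteq> \<rat> \<inter> {0..real n} \<longrightarrow>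
        upcrossings a b False (map (\<lambda>t. y t w) xs) \<le> c"
proof -
  define D where "D = \<rat> \<inter> {0..real n}"
  define e where "e = from_nat_into D"
  have "countable D" unfolding D_def using countable_rat by auto
  moreover have "0 \<in> D" by (auto simp: D_def)
  ultimately have D: "range e = D" unfolding e_def by (intro range_from_nat_into) auto
  define T where "T k = sorted_list_of_set (e ` {..k})" for k :: nat
  have T: "sorted_wrt (<) (T k)" "set (T k) = e ` {..k}" for k by (auto simp: T_def)
  have TD: "set (T k) \<subseteq> D" for k using T(2)[of k] D by auto
  have T0: "0 \<le> t" if "t \<in> set (T k)" for t k
    using subsetD[OF TD that] by (simp add: D_def)
  have Tex: "\<exists>k. X \<subseteq> set (T k)" if X: "finite X" "X \<subseteq> D" for X
  proof -
    obtain I where I: "finite I" "X = e ` I"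
      using finite_subset_image[OF X(1), of e UNIV] X(2) D by auto
    have "I \<subseteq> {..Max (insert 0 I)}" using I(1) by auto
    then show ?thesis using I T(2)[of "Max (insert 0 I)"] by blast
  qed
  have top: "space P \<in> sets (G 0)" using space_G[of 0] sets.top[of "G 0"] by simp
  let ?E = "\<integral>w. \<bar>\<xi> w\<bar> \<partial>P"
  let ?B = "\<lambda>L k. {w \<in> space P. \<exists>t\<in>set (T k). L < \<bar>y t w\<bar>}"
  have one: "(\<integral>w. indicator (space P) w * h w \<partial>P) = (\<integral>w. h w \<partial>P)" for h :: "'a \<Rightarrow> real"
    by (intro Bochner_Integration.integral_cong) auto
  show "AE w in P. \<exists>B. \<forall>x\<in>\<rat> \<inter> {0..real n}. \<bar>y x w\<bar> \<le> B"
  proof -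
    have BP: "?B L k \<in> sets P" if "0 \<le> L" for L k
      by (rule maximal_list(1)[OF that order_refl top T(1) T0])
    have Ble: "L * measure P (?B L k) \<le> ?E" if "0 \<le> L" for L k
      using maximal_list(2)[OF that order_refl top T(1) T0, of k] by (simp add: one)
    have lim: "L * measure P (\<Union>k. ?B L k) \<le> ?E" if L: "0 \<le> L" for L
    proof -
      have "incseq (?B L)"
      proof (rule monoI)
        fix i j :: nat assume "i \<le> j"
        then have "set (T i) \<subseteq> set (T j)" by (auto simp: T(2))
        then show "?B L i \<subseteq> ?B L j" by blast
      qed
      then have "(\<lambda>k. measure P (?B L k)) \<longlonglongrightarrow> measure P (\<Union>k. ?B L k)"
        using BP[OF L] by (intro finite_Lim_measure_incseq) auto
      then have "(\<lambda>k. L * measure P (?B L k)) \<longlonglongrightarrow> L * measure P (\<Union>k. ?B L k)" by (intro tendsto_intros)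
      then show ?thesis using Ble[OF L] by (intro LIMSEQ_le_const2) auto
    qed
    \<comment> \<open>On \<open>?N\<close> every level is exceeded at some rational time. Its
      measure times \<open>j\<close> is at most \<open>?E\<close> for every \<open>j\<close>, so it
      vanishes.\<close>
    let ?N = "\<Inter>j::nat. \<Union>k. ?B (real j) k"
    have NP: "?N \<in> sets P" using BP by auto
    have "measure P ?N * real j \<le> ?E" for j :: nat
    proof -
      have "measure P ?N \<le> measure P (\<Union>k. ?B (real j) k)"
        using BP[of "real j"] by (intro finite_measure_mono) auto
      then have "measure P ?N * real j \<le> measure P (\<Union>k. ?B (real j) k) * real j" by (intro mult_right_mono) auto
      also have "\<dots> \<le> ?E" using lim[of "real j"] by (simp add: mult.commute)
      finally show ?thesis .
    qed
    note le = this
    have "measure P ?N = 0"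
    proof (rule ccontr)
      assume "measure P ?N \<noteq> 0"
      then have pos: "0 < measure P ?N" by (simp add: zero_less_measure_iff)
      obtain j :: nat where "?E / measure P ?N < real j" using reals_Archimedean2 by blast
      then show False using le[of j] pos by (simp add: field_simps)
    qed
    then have "?N \<in> null_sets P" using NP by (auto simp: null_sets_def emeasure_eq_measure)
    then have "AE w in P. w \<notin> ?N" by (rule AE_not_in)
    then show ?thesis
      using AE_space
    proof eventually_elim
      case (elim w)
      then obtain j :: nat where j: "\<And>k t. t \<in> set (T k) \<Longrightarrow> \<bar>y t w\<bar> \<le> real j" by (auto simp: not_less)
      have "\<bar>y x w\<bar> \<le> real j" if "x \<in> \<rat> \<inter> {0..real n}" for x
        using Tex[of "{x}"] j that by (auto simp: D_def)
      then show ?case by blast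
    qed
  qed
  assume ab: "a < b"
  let ?U = "\<lambda>k w. nup a b False (T k) w"
  have Um[measurable]: "?U k \<in> borel_measurable P" for k by (rule nup_measurable[OF T0])
  have Ui: "integrable P (?U k)" for k by (rule nup_integrable[OF T0])
  have sub: "upcrossings a b False (map (\<lambda>t. y t w) xs) \<le> upcrossings a b False (map (\<lambda>t. y t w) (T k))"
    if "sorted_wrt (<) xs" "set xs \<subseteq> set (T k)" for xs k w
  proof -
    have "xs = sorted_list_of_set (set xs)"
      using that(1) by (simp add: sorted_list_of_set.idem_if_sorted_distinct strict_sorted_iff)
    then have "subseq xs (T k)"
      using sorted_list_of_set_subseq[of "e ` {..k}" "set xs"] that(2) T(2)[of k] unfolding T_def by simp
    then show ?thesis by (intro upcrossings_subseq[OF ab] subseq_map)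
  qed
  \<comment> \<open>The expected number of upcrossings is bounded uniformly over the grids; by
    monotone convergence the limiting number has finite expectation and is finite almost
    surely.\<close>
  have "AE w in P. (SUP k. ennreal (?U k w)) \<noteq> \<infinity>"
  proof (rule nn_integral_noteq_infinite)
    have "(\<integral>\<^sup>+w. (SUP k. ennreal (?U k w)) \<partial>P) = (SUP k. \<integral>\<^sup>+w. ennreal (?U k w) \<partial>P)"
    proof (rule nn_integral_monotone_convergence_SUP)
      show "incseq (\<lambda>k w. ennreal (?U k w))"
      proof (intro monoI le_funI ennreal_leI)
        fix i j :: nat and w assume "i \<le> j"
        then have "set (T i) \<subseteq> set (T j)" by (auto simp: T(2))
        from sub[OF T(1) this] show "?U i w \<le> ?U j w" by (simp add: nup_def)
      qed
    qed measurable
    also have "\<dots> \<le> ennreal ((?E + \<bar>a\<bar>) / (b - a))"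
    proof (rule SUP_least)
      fix k
      have "(b - a) * (\<integral>w. ?U k w \<partial>P) \<le> (\<integral>w. \<bar>\<xi> w\<bar> + \<bar>a\<bar> \<partial>P)"
        using upcrossing_inequality[OF ab order_refl top T(1) T0, of k] by (simp add: one)
      also have "\<dots> = ?E + \<bar>a\<bar>"
        using closed_facts(1) by (subst Bochner_Integration.integral_add) (auto simp: prob_space)
      finally have "(\<integral>w. ?U k w \<partial>P) \<le> (?E + \<bar>a\<bar>) / (b - a)" using ab by (simp add: field_simps)
      moreover have "(\<integral>\<^sup>+w. ennreal (?U k w) \<partial>P) = ennreal (\<integral>w. ?U k w \<partial>P)"
        by (rule nn_integral_eq_integral[OF Ui]) (simp add: nup_def)
      ultimately show "(\<integral>\<^sup>+w. ennreal (?U k w) \<partial>P) \<le> ennreal ((?E + \<bar>a\<bar>) / (b - a))"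
        by (simp only: ennreal_leI)
    qed
    finally show "(\<integral>\<^sup>+w. (SUP k. ennreal (?U k w)) \<partial>P) \<noteq> \<infinity>"
      using neq_top_trans[OF ennreal_neq_top] unfolding infinity_ennreal_def by blast
  qed measurable
  then show "AE w in P. \<exists>c. \<forall>xs. sorted_wrt (<) xs \<longrightarrow> set xs \<subseteq> \<rat> \<inter> {0..real n} \<longrightarrow>
        upcrossings a b False (map (\<lambda>t. y t w) xs) \<le> c"
  proof eventually_elim
    case (elim w)
    then obtain r where r: "0 \<le> r" "(SUP k. ennreal (?U k w)) = ennreal r"
      by (cases "SUP k. ennreal (?U k w)" rule: ennreal_cases) auto
    obtain c :: nat where c: "r \<le> real c" using real_arch_simple by blast
    have Uc: "upcrossings a b False (map (\<lambda>t. y t w) (T k)) \<le> c" for k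
    proof -
      have "ennreal (?U k w) \<le> ennreal r" unfolding r(2)[symmetric] by (rule SUP_upper) simp
      then have "?U k w \<le> r" using r(1) by simp
      then show ?thesis using c by (simp add: nup_def)
    qed
    have "upcrossings a b False (map (\<lambda>t. y t w) xs) \<le> c"
      if xs: "sorted_wrt (<) xs" "set xs \<subseteq> \<rat> \<inter> {0..real n}" for xs
    proof -
      obtain k where "set xs \<subseteq> set (T k)" using Tex[of "set xs"] xs(2) by (auto simp: D_def)
      from sub[OF xs(1) this] Uc[of k] show ?thesis by (rule order_trans)
    qed
    then show ?case by blast
  qed
qed

end

end

section \<open>Doob's regularization\<close>

context usual_filtered_space
begin

text \<open>Conditional expectations are chosen separately for each time, so their paths mean
  something at countably many times only. The limits from the right along the rationals define
  \<open>Y\<close>; right continuity of the filtration makes \<open>Y\<close> adapted, and uniform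
  integrability preserves the integrals over events of \<open>G t\<close>.\<close>

theorem cadlag_version:
  assumes xi: "integrable P \<xi>"
  shows "\<exists>Y. adapted G Y \<and> (\<forall>w\<in>space P. cadlag (\<lambda>t. Y t w)) \<and> (\<forall>n. closed_by n \<xi> Y)"
proof -
  define y where "y t = real_cond_exp P (G t) \<xi>" for t
  have closed: "closed_by n \<xi> y" for n unfolding y_def by (rule closed_by_cond_exp[OF xi])
  note facts = closed_facts[OF closed]
  let ?good = "\<lambda>w. \<forall>n::nat. (\<exists>B. \<forall>x\<in>\<rat> \<inter> {0..real n}. \<bar>y x w\<bar> \<le> B) \<and>
     (\<forall>a\<in>\<rat>. \<forall>b\<in>\<rat>. a < b \<longrightarrow> (\<exists>c. \<forall>xs. sorted_wrt (<) xs \<longrightarrow> set xs \<subseteq> \<rat> \<inter> {0..real n} \<longrightarrow>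
        upcrossings a b False (map (\<lambda>t. y t w) xs) \<le> c))"
  have "AE w in P. ?good w"
    unfolding AE_all_countable
  proof (intro allI AE_conjI)
    fix n :: nat
    show "AE w in P. \<exists>B. \<forall>x\<in>\<rat> \<inter> {0..real n}. \<bar>y x w\<bar> \<le> B" by (rule AE_regular(1)[OF closed])
    show "AE w in P. (\<forall>a\<in>\<rat>. \<forall>b\<in>\<rat>. a < b \<longrightarrow> (\<exists>c. \<forall>xs. sorted_wrt (<) xs \<longrightarrow>
        set xs \<subseteq> \<rat> \<inter> {0..real n} \<longrightarrow> upcrossings a b False (map (\<lambda>t. y t w) xs) \<le> c))"
    proof (intro AE_ball_countable[THEN iffD2] countable_rat ballI)
      fix a b :: real
      show "AE w in P. a < b \<longrightarrow> (\<exists>c. \<forall>xs. sorted_wrt (<) xs \<longrightarrow>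
        set xs \<subseteq> \<rat> \<inter> {0..real n} \<longrightarrow> upcrossings a b False (map (\<lambda>t. y t w) xs) \<le> c)"
        using AE_regular(2)[OF closed, of a b n] by (cases "a < b") auto
    qed
  qed
  then obtain N where N: "N \<in> null_sets P" and good: "\<And>w. w \<in> space P - N \<Longrightarrow>
     ?good w"
    by (rule AE_E3) blast
  \<comment> \<open>The value zero on the exceptional set makes every path cadlag, not only almost
    every one; the generators of the optional \<sigma>-field ask for this.\<close>
  define Y where "Y t w = (if w \<in> N then 0 else Lim (at t within (\<rat> \<inter> {t<..})) (\<lambda>d. y d w))" for t w
  have right: "((\<lambda>d. y d w) \<longlongrightarrow> Y t w) (at t within (\<rat> \<inter> {t<..}))"
    if mem: "w \<in> space P" "w \<notin> N" and t: "0 \<le> t" for t w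
  proof -
    have "\<exists>l. ((\<lambda>d. y d w) \<longlongrightarrow> l) (at t within (\<rat> \<inter> {t<..}))"
      by (rule rational_limits_of_upcrossings(1)) (use good[of w] mem t in auto)
    then obtain l where l: "((\<lambda>d. y d w) \<longlongrightarrow> l) (at t within (\<rat> \<inter> {t<..}))" by blast
    then have "Y t w = l" using mem tendsto_Lim[OF at_within_Rats_right l] by (simp add: Y_def)
    then show ?thesis using l by simp
  qed
  have cad: "cadlag (\<lambda>t. Y t w)" if mem: "w \<in> space P" for w
  proof (cases "w \<in> N")
    case True
    then show ?thesis by (simp add: Y_def cadlag_const)
  next
    case False
    show ?thesis
    proof (rule cadlag_regularization)
      show "((\<lambda>d. y d w) \<longlongrightarrow> Y t w) (at t within (\<rat> \<inter> {t<..}))" if "0 \<le> t" for t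
        by (rule right[OF mem False that])
      show "\<exists>l. ((\<lambda>d. y d w) \<longlongrightarrow> l) (at t within (\<rat> \<inter> {0..<t}))" if "0 < t" for t
        by (rule rational_limits_of_upcrossings(2)) (use good[of w] mem False that in auto)
    qed
  qed
  have lim: "(\<lambda>k. y (disc k t) w) \<longlonglongrightarrow> Y t w" if mem: "w \<in> space P" "w \<notin> N" and t: "0 \<le> t" for t w
  proof -
    have "filterlim (\<lambda>k. disc k t) (at t within (\<rat> \<inter> {t<..})) sequentially"
      using disc_tendsto disc_gt disc_Rats
      by (auto simp: filterlim_at intro!: always_eventually less_imp_neq[THEN not_sym])
    then show ?thesis using right[OF mem t] by (rule filterlim_compose[rotated])
  qed
  have adapt: "Y t \<in> borel_measurable (G t)" if t: "0 \<le> t" for t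
  proof (rule measurable_right_limit[OF t])
    fix u assume u: "t < u"
    then have u0: "0 \<le> u" using t by simp
    \<comment> \<open>From level \<open>m\<close> on the approximating times do not exceed
      \<open>u\<close>, so the limit is measurable at every \<open>u\<close> beyond
      \<open>t\<close>.\<close>
    obtain m where m: "(1 / 2) ^ m < u - t" using real_arch_pow_inv[of "u - t" "1 / 2"] u by auto
    have d: "disc (k + m) t \<le> u" "0 \<le> disc (k + m) t" for k
    proof -
      have "(1 / 2 :: real) ^ (k + m) \<le> (1 / 2) ^ m" by (intro power_decreasing) auto
      then show "disc (k + m) t \<le> u" using disc_le[of "k + m" t] m by linarith
      show "0 \<le> disc (k + m) t" using disc_gt[of t "k + m"] t by simp
    qed
    have yd[measurable]: "y (disc (k + m) t) \<in> borel_measurable (G u)" for k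
      by (rule measurable_G_mono[OF d(2) d(1) facts(2)[OF d(2)]])
    have [measurable]: "N \<in> sets (G u)" using null_sets_G[OF u0] N by auto
    have "(\<lambda>w. if w \<in> N then 0 else lim (\<lambda>k. y (disc (k + m) t) w)) \<in> borel_measurable (G u)"
      by measurable
    then show "Y t \<in> borel_measurable (G u)"
    proof (rule measurable_cong[THEN iffD1, rotated])
      fix w assume "w \<in> space (G u)"
      then have mem: "w \<in> space P" using space_G[OF u0] by simp
      show "(if w \<in> N then 0 else lim (\<lambda>k. y (disc (k + m) t) w)) = Y t w"
      proof (cases "w \<in> N")
        case True then show ?thesis by (simp add: Y_def)
      next
        case False
        have "(\<lambda>k. y (disc (k + m) t) w) \<longlonglongrightarrow> Y t w"
          by (rule LIMSEQ_ignore_initial_segment[OF lim[OF mem False t]])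
        then show ?thesis using False by (simp add: limI)
      qed
    qed
  qed
  have "closed_by n \<xi> Y" for n
    unfolding closed_by_def
  proof (intro conjI allI impI ballI)
    fix t :: real assume t: "0 \<le> t"
    have d: "0 \<le> disc k t" "t \<le> disc k t" for k using disc_gt[of t k] t by auto
    have fi: "integrable P (y (disc k t))" for k by (rule facts(3)[OF d(1)])
    have gm: "Y t \<in> borel_measurable P" by (rule measurable_G[OF t adapt[OF t]])
    have tail: "(\<integral>x. indicator {x\<in>space P. K < \<bar>y (disc k t) x\<bar>} x * \<bar>y (disc k t) x\<bar> \<partial>P)
      \<le> (\<integral>x. indicator {x\<in>space P. K < \<bar>y (disc k t) x\<bar>} x * \<bar>\<xi> x\<bar> \<partial>P)" for k K
    proof (rule closed_by_abs[OF closed d(1) order_refl])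
      have [measurable]: "y (disc k t) \<in> borel_measurable (G (disc k t))" by (rule facts(2)[OF d(1)])
      have "{x\<in>space (G (disc k t)). K < \<bar>y (disc k t) x\<bar>} \<in> sets (G (disc k t))" by measurable
      then show "{x\<in>space P. K < \<bar>y (disc k t) x\<bar>} \<in> sets (G (disc k t))"
        unfolding space_G[OF d(1)] .
    qed
    have limAE: "AE x in P. (\<lambda>k. y (disc k t) x) \<longlonglongrightarrow> Y t x"
      using AE_not_in[OF N] AE_space by eventually_elim (rule lim[OF _ _ t])
    show "integrable P (Y t)" by (rule set_integral_lim_tail_dominated(1)[OF xi fi gm tail limAE])
    show "(\<integral>w. indicator A w * Y t w \<partial>P) = (\<integral>w. indicator A w * \<xi> w \<partial>P)" if A: "A \<in> sets (G t)" for A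
      by (rule set_integral_lim_tail_dominated(2)[OF xi fi gm tail limAE sets_G[OF t A]])
        (rule facts(4)[OF d(1) sets_G_mono[OF t d(2) A]])
  qed (use xi adapt in auto)
  then show ?thesis using adapt cad by (intro exI[of _ Y]) (auto simp: adapted_def)
qed

end

section \<open>Reduction by stopping times of the smaller filtration\<close>

lemma enn2real_le_iff_ennreal:
  "x < top \<Longrightarrow> 0 \<le> r \<Longrightarrow> enn2real x \<le> r \<longleftrightarrow> x \<le> ennreal r"
  by (cases x rule: ennreal_cases) auto

lemma optional_process_adapted:
  assumes "filtration_on P G" "optional_process G N"
  shows "adapted G N"
  unfolding adapted_def
proof (intro allI impI)
  fix t :: real assume t: "0 \<le> t"
  have sp: "space (G t) = space (G 0)" using assms(1) t by (auto simp: filtration_on_def subalgebra_def)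
  have "(\<lambda>w. (t, w)) \<in> measurable (G t) (optional_sigma G)"
    unfolding optional_sigma_def
  proof (rule measurable_measure_of)
    fix E assume "E \<in> {{(t, w) \<in> {0..} \<times> space (G 0). Y t w \<in> B} | Y B.
        adapted G Y \<and> (\<forall>w\<in>space (G 0). cadlag (\<lambda>t. Y t w)) \<and> B \<in> sets borel}"
    then obtain Y B where E: "E = {(t, w) \<in> {0..} \<times> space (G 0). Y t w \<in> B}"
      "adapted G Y" "B \<in> sets borel" by blast
    have "(\<lambda>w. (t, w)) -` E \<inter> space (G t) = Y t -` B \<inter> space (G t)" using E(1) t sp by auto
    moreover have "Y t \<in> borel_measurable (G t)" using E(2) t by (simp add: adapted_def)
    ultimately show "(\<lambda>w. (t, w)) -` E \<inter> space (G t) \<in> sets (G t)" using E(3) measurable_sets by metis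
  qed (use t sp in auto)
  from measurable_compose[OF this assms(2)[unfolded optional_process_def]]
  show "N t \<in> borel_measurable (G t)" by simp
qed

section \<open>The \<sigma>-field of a stopping time\<close>

context complete_filtered_space
begin

text \<open>The generating family is a \<sigma>-field already; closure under complements is where
  \<open>T\<close> has to be a stopping time.\<close>

lemma stop_sigma:
  assumes T: "stop_time P G T"
  shows "space (stop_sigma P G T) = space P"
    and "sets (stop_sigma P G T) = {A \<in> sets P. \<forall>t\<ge>0. {w \<in> A. T w \<le> ennreal t} \<in> sets (G t)}" (is "_ = ?\<Sigma>")
    and "subalgebra P (stop_sigma P G T)"
proof -
  have pow: "?\<Sigma> \<subseteq> Pow (space P)" by (auto dest: sets.sets_into_space)
  have "sigma_algebra (space P) ?\<Sigma>"
    unfolding sigma_algebra_iff2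
  proof (intro conjI ballI allI impI)
    fix A assume A: "A \<in> ?\<Sigma>"
    show "space P - A \<in> ?\<Sigma>"
    proof (intro CollectI conjI allI impI)
      show "space P - A \<in> sets P" using A by auto
      fix t :: real assume t: "0 \<le> t"
      have eq: "{w \<in> space P - A. T w \<le> ennreal t} = {w \<in> space P. T w \<le> ennreal t} - {w \<in> A. T w \<le> ennreal t}"
        by auto
      show "{w \<in> space P - A. T w \<le> ennreal t} \<in> sets (G t)"
        unfolding eq by (rule sets.Diff) (use A T t in \<open>simp_all add: stop_time_def\<close>)
    qed
  next
    fix A :: "nat \<Rightarrow> 'a set" assume A: "range A \<subseteq> ?\<Sigma>"
    show "\<Union>(range A) \<in> ?\<Sigma>"
    proof (intro CollectI conjI allI impI)
      show "\<Union>(range A) \<in> sets P" using A by (intro sets.countable_UN) auto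
      fix t :: real assume t: "0 \<le> t"
      have eq: "{w \<in> \<Union>(range A). T w \<le> ennreal t} = (\<Union>i. {w \<in> A i. T w \<le> ennreal t})" by auto
      show "{w \<in> \<Union>(range A). T w \<le> ennreal t} \<in> sets (G t)"
        unfolding eq by (rule sets.countable_UN) (use A t in blast)
    qed
  qed (use pow in auto)
  then interpret sigma_algebra "space P" ?\<Sigma> .
  show 1: "space (stop_sigma P G T) = space P" "sets (stop_sigma P G T) = ?\<Sigma>"
    unfolding stop_sigma_def using pow sigma_sets_eq by (simp_all add: sets_measure_of)
  then show "subalgebra P (stop_sigma P G T)" by (auto simp: subalgebra_def)
qed

lemma stop_sigma_bounded:
  assumes "stop_time P G T" "\<And>w. T w < top"
  shows "sets (stop_sigma P G T) = past (\<lambda>w. enn2real (T w))"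
  unfolding stop_sigma(2)[OF assms(1)] past_def by (auto simp: enn2real_le_iff_ennreal assms(2))

lemma space_past_stop:
  assumes "stop_time P G T" "\<And>w. T w < top"
  shows "space P \<in> past (\<lambda>w. enn2real (T w))"
  using assms(1) by (auto simp: past_def stop_time_def enn2real_le_iff_ennreal assms(2))

lemma stop_time_min:
  assumes "stop_time P G T" "stop_time P G S"
  shows "stop_time P G (\<lambda>w. min (T w) (S w))"
proof -
  have eq: "{w \<in> space P. min (T w) (S w) \<le> ennreal t}
      = {w \<in> space P. T w \<le> ennreal t} \<union> {w \<in> space P. S w \<le> ennreal t}" for t
    by (auto simp: min_le_iff_disj)
  show ?thesis unfolding stop_time_def eq using assms by (auto simp: stop_time_def)
qed

lemma stop_time_const: "0 \<le> c \<Longrightarrow> stop_time P G (\<lambda>_. ennreal c)"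
  unfolding stop_time_def
proof (intro allI impI)
  fix t :: real assume t: "0 \<le> t"
  show "{w \<in> space P. ennreal c \<le> ennreal t} \<in> sets (G t)"
    using sets.top[of "G t"] space_G[OF t] by (cases "ennreal c \<le> ennreal t") auto
qed

lemma stop_time_pos:
  assumes "stop_time P G T" "0 \<le> t" shows "{w \<in> space P. ennreal t < T w} \<in> sets (G t)"
proof -
  have eq: "{w \<in> space P. ennreal t < T w} = space P - {w \<in> space P. T w \<le> ennreal t}" by auto
  have "space P \<in> sets (G t)" using sets.top[of "G t"] space_G[OF assms(2)] by simp
  then show ?thesis
    unfolding eq by (rule sets.Diff) (use assms in \<open>simp add: stop_time_def\<close>)
qed

lemma martingale_closed_by:
  assumes X: "martingale P G X" and t: "0 \<le> t"
  shows "closed_by t (X t) X"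
  unfolding closed_by_def
proof (intro conjI allI impI ballI)
  fix s A assume s: "0 \<le> s" "s \<le> t" and A: "A \<in> sets (G s)"
  interpret sigma_finite_subalgebra P "G s" by (rule cond_exp_subalgebra[OF s(1)])
  have Xi: "integrable P (X t)" using X t by (simp add: martingale_def)
  have "AE w in P. real_cond_exp P (G s) (X t) w = X s w" using X s by (simp add: martingale_def)
  moreover have "X s \<in> borel_measurable P"
    using X s by (auto simp: martingale_def intro: borel_measurable_integrable)
  moreover have "A \<in> sets P" by (rule sets_G[OF s(1) A])
  ultimately have "(\<integral>w. indicator A w * real_cond_exp P (G s) (X t) w \<partial>P) = (\<integral>w. indicator A w * X s w \<partial>P)"
    by (intro integral_cong_AE) auto
  then show "(\<integral>w. indicator A w * X s w \<partial>P) = (\<integral>w. indicator A w * X t w \<partial>P)"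
    using real_cond_exp_intA[OF Xi A] by (simp add: set_lebesgue_integral_def)
qed (use X t in \<open>auto simp: martingale_def adapted_def\<close>)

lemma cadlag_AE_right:
  assumes "AE w in P. cadlag (\<lambda>t. X t w)"
  shows "AE w in P. \<forall>s\<ge>0. ((\<lambda>s. X s w) \<longlongrightarrow> X s w) (at_right s)"
  using assms by eventually_elim (simp add: cadlag_def)

end

text \<open>A local martingale of \<open>H\<close> need not be reducible by stopping times of the smaller filtration \<open>G\<close>,
  and without that its optional projection need not be a local martingale.\<close>

locale reduced_local_martingale =
  G: usual_filtered_space P G + H: complete_filtered_space P H
  for P :: "'a measure" and G H :: "real \<Rightarrow> 'a measure" +
  fixes X :: "real \<Rightarrow> 'a \<Rightarrow> real" and S :: "nat \<Rightarrow> 'a \<Rightarrow> ennreal"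
  assumes G_le_H: "\<And>t. 0 \<le> t \<Longrightarrow> sets (G t) \<subseteq> sets (H t)"
    and X: "local_martingale P H X"
    and S_stop: "\<And>n. stop_time P G (S n)"
    and S_lim: "AE w in P. incseq (\<lambda>n. S n w) \<and> (\<lambda>n. S n w) \<longlonglongrightarrow> \<infinity>"
    and S_dom: "\<And>n t. 0 \<le> t \<Longrightarrow> \<exists>D. integrable P D \<and> (AE w in P. 0 < S n w \<longrightarrow>
        (\<forall>r. 0 \<le> r \<longrightarrow> r \<le> t \<longrightarrow> ennreal r \<le> S n w \<longrightarrow> \<bar>X r w\<bar> \<le> D w))"
begin

definition stopped :: "nat \<Rightarrow> real \<Rightarrow> 'a \<Rightarrow> real" where
  "stopped n t w = enn2real (min (ennreal t) (S n w))"

lemma stopped: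
  assumes "0 \<le> t"
  shows "0 \<le> stopped n t w" "stopped n t w \<le> t" "ennreal (stopped n t w) \<le> S n w"
    "ennreal t \<le> S n w \<Longrightarrow> stopped n t w = t"
    "ennreal (stopped n t w) = min (ennreal t) (S n w)"
proof -
  have fin: "min (ennreal t) (S n w) < top" by (simp add: min_less_iff_disj)
  show 1: "ennreal (stopped n t w) = min (ennreal t) (S n w)"
    using fin by (simp add: stopped_def)
  show "0 \<le> stopped n t w" by (simp add: stopped_def)
  show "stopped n t w \<le> t" using fin assms by (simp add: stopped_def enn2real_le_iff_ennreal)
  show "ennreal (stopped n t w) \<le> S n w" unfolding 1 by simp
  show "stopped n t w = t" if "ennreal t \<le> S n w" using that assms by (simp add: stopped_def min_absorb1)
qed

lemma G_past_H: "A \<in> G.past \<theta> \<Longrightarrow> A \<in> H.past \<theta>"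
  using G_le_H by (auto simp: G.past_def H.past_def)

lemma stopped_stop: "0 \<le> t \<Longrightarrow> stop_time P G (\<lambda>w. min (ennreal t) (S n w))"
  by (intro G.stop_time_min G.stop_time_const S_stop)

lemma stopped_past: "0 \<le> t \<Longrightarrow> space P \<in> G.past (stopped n t)"
  unfolding stopped_def by (rule G.space_past_stop[OF stopped_stop]) (auto simp: min_less_iff_disj)

lemma sets_stop_sigma_stopped:
  "0 \<le> t \<Longrightarrow> sets (stop_sigma P G (\<lambda>w. min (ennreal t) (S n w))) = G.past (stopped n t)"
  unfolding stopped_def by (rule G.stop_sigma_bounded[OF stopped_stop]) (auto simp: min_less_iff_disj)

lemma X_adapted: "adapted H X" and X_cadlag: "AE w in P. cadlag (\<lambda>t. X t w)"
  using X by (auto simp: local_martingale_def)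

lemma X_at_measurable:
  assumes "0 \<le> t" "space P \<in> H.past \<sigma>" "\<And>w. w \<in> space P \<Longrightarrow> 0 \<le> \<sigma> w \<and> \<sigma> w \<le> t"
  shows "(\<lambda>w. X (\<sigma> w) w) \<in> borel_measurable P"
  by (rule H.measurable_G[OF assms(1) H.stopped_value_measurable[OF assms(1) _ H.cadlag_AE_right[OF X_cadlag]]])
    (use assms X_adapted in \<open>auto simp: adapted_def\<close>)

text \<open>For each process reduced in \<open>H\<close>, optional stopping at
  \<open>\<sigma>\<close> and at \<open>stopped n t\<close> gives two integrals equal to the one of
  its value at \<open>t\<close>. The bound in \<open>S_dom\<close> covers all times up to
  \<open>S n\<close> and \<open>t\<close>, hence also these times cut off at \<open>T m\<close>, and
  so permits the limit in \<open>m\<close>.\<close>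

lemma reduced_martingale:
  assumes t: "0 \<le> t" and s: "space P \<in> H.past \<sigma>" "\<And>w. w \<in> space P \<Longrightarrow> 0 \<le> \<sigma> w \<and> \<sigma> w \<le> t"
    and A: "A \<in> H.past \<sigma>" "\<And>w. w \<in> A \<Longrightarrow> ennreal (\<sigma> w) \<le> S n w \<and> 0 < S n w"
  shows "integrable P (\<lambda>w. indicator A w * X (\<sigma> w) w)"
    and "(\<integral>w. indicator A w * X (\<sigma> w) w \<partial>P) = (\<integral>w. indicator A w * X (stopped n t w) w \<partial>P)"
proof -
  have AP[measurable]: "A \<in> sets P" using A(1) by (simp add: H.past_def)
  have Asp: "A \<subseteq> space P" using AP by (rule sets.sets_into_space)
  obtain D where D: "integrable P D" "AE w in P. 0 < S n w \<longrightarrow>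
      (\<forall>r. 0 \<le> r \<longrightarrow> r \<le> t \<longrightarrow> ennreal r \<le> S n w \<longrightarrow> \<bar>X r w\<bar> \<le> D w)"
    using S_dom[OF t, of n] by blast
  note st = stopped[OF t, of n]
  have r: "space P \<in> H.past (stopped n t)" "\<And>w. w \<in> space P \<Longrightarrow> 0 \<le> stopped n t w \<and> stopped n t w \<le> t"
    using G_past_H[OF stopped_past[OF t]] st by auto
  \<comment> \<open>On \<open>A\<close> the time \<open>\<sigma>\<close> is at most
    \<open>stopped n t\<close>, so what is known at the former is known at the latter.\<close>
  have Ar: "A \<in> H.past (stopped n t)"
    unfolding H.past_def
  proof (intro CollectI conjI allI impI AP)
    fix u :: real assume u: "0 \<le> u"
    have "\<sigma> w \<le> stopped n t w" if mem: "w \<in> A" for w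
    proof -
      have "ennreal (\<sigma> w) \<le> ennreal (stopped n t w)"
        unfolding st(5) using A(2)[OF mem] s(2)[of w] mem Asp by (auto intro!: ennreal_leI)
      then show ?thesis using st(1) by simp
    qed
    then have "{w \<in> A. stopped n t w \<le> u} = {w \<in> A. \<sigma> w \<le> u} \<inter> {w \<in> space P. stopped n t w \<le> u}"
      using Asp by force
    then show "{w \<in> A. stopped n t w \<le> u} \<in> sets (H u)"
      using A(1) r(1) u by (auto simp: H.past_def)
  qed
  obtain T where T: "AE w in P. incseq (\<lambda>n. T n w) \<and> (\<lambda>n. T n w) \<longlonglongrightarrow> \<infinity>"
    and Z: "\<And>m::nat. martingale P H (stopped_process X (T m))"
    using X by (auto simp: local_martingale_def)
  let ?Z = "\<lambda>m. stopped_process X (T m)"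
  have dom: "AE w in P. w \<in> A \<longrightarrow> (\<forall>r. 0 \<le> r \<longrightarrow> r \<le> t \<longrightarrow> ennreal r \<le> S n w \<longrightarrow> \<bar>X r w\<bar> \<le> \<bar>D w\<bar>)"
    using D(2) by eventually_elim (use A(2) in force)
  have conv: "(\<lambda>m. \<integral>w. indicator A w * ?Z m (\<theta> w) w \<partial>P) \<longlonglongrightarrow> (\<integral>w. indicator A w * X (\<theta> w) w \<partial>P)
      \<and> integrable P (\<lambda>w. indicator A w * X (\<theta> w) w)"
    if th: "space P \<in> H.past \<theta>" "\<And>w. w \<in> space P \<Longrightarrow> 0 \<le> \<theta> w \<and> \<theta> w \<le> t"
      "\<And>w. w \<in> A \<Longrightarrow> ennreal (\<theta> w) \<le> S n w" for \<theta>
  proof -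
    have X_m[measurable]: "(\<lambda>w. X (\<theta> w) w) \<in> borel_measurable P" by (rule X_at_measurable[OF t th(1,2)])
    have Z_m[measurable]: "(\<lambda>w. ?Z m (\<theta> w) w) \<in> borel_measurable P" for m
      by (rule borel_measurable_integrable,
          rule H.optional_stopping(1)[OF t H.martingale_closed_by[OF Z t] H.cadlag_AE_right th(1,2)])
        (use Z in \<open>auto simp: martingale_def\<close>)
    have "(\<lambda>m. \<integral>w. indicator A w * ?Z m (\<theta> w) w \<partial>P) \<longlonglongrightarrow> (\<integral>w. indicator A w * X (\<theta> w) w \<partial>P)"
    proof (rule integral_dominated_convergence[where w = "\<lambda>w. \<bar>D w\<bar>"])
      show "AE w in P. (\<lambda>m. indicator A w * ?Z m (\<theta> w) w) \<longlonglongrightarrow> indicator A w * X (\<theta> w) w"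
        using T
      proof eventually_elim
        case (elim w)
        then have "eventually (\<lambda>m. ennreal (\<theta> w) < T m w) sequentially"
          by (intro order_tendstoD) auto
        then have "eventually (\<lambda>m. indicator A w * ?Z m (\<theta> w) w = indicator A w * X (\<theta> w) w) sequentially"
        proof eventually_elim
          case (elim m)
          then have "0 < T m w" by (rule le_less_trans[rotated]) simp
          moreover have "w \<in> A \<Longrightarrow> 0 \<le> \<theta> w" using th(2) Asp by blast
          ultimately show ?case using elim
            by (auto simp: stopped_process_def min_absorb1 less_imp_le split: split_indicator)
        qed
        then show ?case by (rule tendsto_eventually)
      qed
      show "AE w in P. norm (indicator A w * ?Z m (\<theta> w) w) \<le> \<bar>D w\<bar>" for m
        using dom
      proof eventually_elim
        case (elim w)
        show ?case
        proof (cases "w \<in> A \<and> 0 < T m w")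
          case True
          \<comment> \<open>The reduced process takes a value of \<open>X\<close> at an earlier
            time, which obeys the same bound.\<close>
          let ?r = "enn2real (min (ennreal (\<theta> w)) (T m w))"
          have th0: "0 \<le> \<theta> w" "\<theta> w \<le> t" using th(2) True Asp by auto
          have fin: "min (ennreal (\<theta> w)) (T m w) < top" by (simp add: min_less_iff_disj)
          then have "ennreal ?r \<le> ennreal (\<theta> w)" by simp
          moreover from this have "?r \<le> t" using th0 by (simp add: ennreal_le_iff)
          ultimately have "\<bar>X ?r w\<bar> \<le> \<bar>D w\<bar>" using elim True th(3)[of w] by auto
          then show ?thesis using True by (simp add: stopped_process_def)
        qed (auto simp: stopped_process_def)
      qed
    qed (use D(1) in auto)
    moreover have "integrable P (\<lambda>w. indicator A w * X (\<theta> w) w)"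
    proof (rule Bochner_Integration.integrable_bound[OF integrable_abs[OF D(1)]])
      show "AE w in P. norm (indicator A w * X (\<theta> w) w) \<le> norm \<bar>D w\<bar>"
        using dom
        by eventually_elim (use th Asp in \<open>auto split: split_indicator\<close>)
    qed measurable
    ultimately show ?thesis by blast
  qed
  have eq: "(\<integral>w. indicator A w * ?Z m (\<sigma> w) w \<partial>P) = (\<integral>w. indicator A w * ?Z m (stopped n t w) w \<partial>P)" for m
    using H.optional_stopping(2)[OF t H.martingale_closed_by[OF Z t] H.cadlag_AE_right s A(1)]
      H.optional_stopping(2)[OF t H.martingale_closed_by[OF Z t] H.cadlag_AE_right r Ar] Z
    by (simp add: martingale_def)
  show "integrable P (\<lambda>w. indicator A w * X (\<sigma> w) w)" using conv[OF s] A(2) by blast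
  show "(\<integral>w. indicator A w * X (\<sigma> w) w \<partial>P) = (\<integral>w. indicator A w * X (stopped n t w) w \<partial>P)"
  proof (rule LIMSEQ_unique)
    show "(\<lambda>m. \<integral>w. indicator A w * ?Z m (\<sigma> w) w \<partial>P) \<longlonglongrightarrow> (\<integral>w. indicator A w * X (\<sigma> w) w \<partial>P)"
      using conv[OF s] A(2) by blast
    show "(\<lambda>m. \<integral>w. indicator A w * ?Z m (\<sigma> w) w \<partial>P) \<longlonglongrightarrow> (\<integral>w. indicator A w * X (stopped n t w) w \<partial>P)"
      unfolding eq using conv[OF r] st(3) by blast
  qed
qed

end

context complete_filtered_space
begin

lemma past_const:
  assumes "0 \<le> t" "A \<in> sets (G t)" shows "A \<in> past (\<lambda>_. t)"
  unfolding past_def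
proof (intro CollectI conjI allI impI)
  show "A \<in> sets P" by (rule sets_G[OF assms])
  show "{w \<in> A. t \<le> r} \<in> sets (G r)" for r
    using sets_G_mono[OF assms(1) _ assms(2), of r] by (cases "t \<le> r") auto
qed

lemma cond_exp_stop_sigma:
  "stop_time P G T \<Longrightarrow> sigma_finite_subalgebra P (stop_sigma P G T)"
  by (rule finite_measure_subalgebra_is_sigma_finite[OF finite_measure_subalgebra.intro[OF finite_measure_axioms]])
    (simp add: finite_measure_subalgebra_axioms_def stop_sigma(3))

text \<open>A rational instant separates \<open>T w\<close> from \<open>R w\<close>. For the part
  known at time \<open>t\<close> the instant \<open>t\<close> itself is added: it catches the
  outcomes with \<open>t < R w\<close>, whose separating rational may lie beyond
  \<open>t\<close>.\<close>

lemma stop_time_less: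
  assumes T: "stop_time P G T" and R: "stop_time P G R"
  shows "{w \<in> space P. T w < R w} \<in> sets (stop_sigma P G T)"
proof -
  let ?Q = "\<lambda>q. {w \<in> space P. T w \<le> ennreal q} \<inter> {w \<in> space P. ennreal q < R w}"
  have Q: "?Q q \<in> sets (G q)" if "0 \<le> q" for q
    using T stop_time_pos[OF R that] that by (intro sets.Int) (auto simp: stop_time_def)
  have ex: "\<exists>q\<in>\<rat>. 0 \<le> q \<and> T w \<le> ennreal q \<and> ennreal q < R w" if less: "T w < R w" for w
  proof -
    obtain x where x: "0 \<le> x" "T w = ennreal x" using less by (cases "T w" rule: ennreal_cases) auto
    obtain q where "q \<in> \<rat>" "x < q" "ennreal q < R w"
    proof (cases "R w" rule: ennreal_cases)
      case (real r)
      then have "x < r" using less x by (simp add: ennreal_less_iff)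
      then obtain q where "q \<in> \<rat>" "x < q" "q < r" using Rats_dense_in_real by blast
      then show ?thesis using that real x by (simp add: ennreal_less_iff)
    next
      case top
      obtain q where "q \<in> \<rat>" "x < q" "q < x + 1" using Rats_dense_in_real[of x "x + 1"] by auto
      then show ?thesis using that top by simp
    qed
    then show ?thesis using x by (intro bexI[of _ q]) (auto intro!: ennreal_leI)
  qed
  have P: "{w \<in> space P. T w < R w} = (\<Union>q\<in>\<rat> \<inter> {0..}. ?Q q)"
  proof (intro set_eqI iffI)
    fix w assume "w \<in> {w \<in> space P. T w < R w}"
    then show "w \<in> (\<Union>q\<in>\<rat> \<inter> {0..}. ?Q q)" using ex[of w] by auto
  qed auto
  have "{w \<in> space P. T w < R w} \<in> sets P"
    unfolding P
  proof (rule sets.countable_UN'')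
    show "countable (\<rat> \<inter> {0..})" using countable_rat by auto
    show "?Q q \<in> sets P" if "q \<in> \<rat> \<inter> {0..}" for q
      by (rule sets_G[of q]) (use that in \<open>auto intro!: Q\<close>)
  qed
  moreover have "{w \<in> {w \<in> space P. T w < R w}. T w \<le> ennreal t} \<in> sets (G t)" if t: "0 \<le> t" for t
  proof -
    have eq: "{w \<in> {w \<in> space P. T w < R w}. T w \<le> ennreal t} = ?Q t \<union> (\<Union>q\<in>\<rat> \<inter> {0..t}. ?Q q)"
    proof (intro set_eqI iffI)
      fix w assume mem: "w \<in> {w \<in> {w \<in> space P. T w < R w}. T w \<le> ennreal t}"
      show "w \<in> ?Q t \<union> (\<Union>q\<in>\<rat> \<inter> {0..t}. ?Q q)"
      proof (cases "ennreal t < R w")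
        case False
        obtain q where q: "q \<in> \<rat>" "0 \<le> q" "T w \<le> ennreal q" "ennreal q < R w" using ex[of w] mem by auto
        have "ennreal q < ennreal t" using q(4) False by (simp add: not_less)
        then have "q \<le> t" using q(2) by (simp add: ennreal_less_iff)
        then show ?thesis using q mem by auto
      qed (use mem in auto)
    next
      fix w assume "w \<in> ?Q t \<union> (\<Union>q\<in>\<rat> \<inter> {0..t}. ?Q q)"
      then obtain q where "q \<le> t" "w \<in> ?Q q" by auto
      moreover from this have "T w \<le> ennreal t" using ennreal_leI[of q t] by (auto intro: order_trans)
      ultimately show "w \<in> {w \<in> {w \<in> space P. T w < R w}. T w \<le> ennreal t}" by auto
    qed
    have "(\<Union>q\<in>\<rat> \<inter> {0..t}. ?Q q) \<in> sets (G t)"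
    proof (rule sets.countable_UN'')
      show "countable (\<rat> \<inter> {0..t})" using countable_rat by auto
      show "?Q q \<in> sets (G t)" if "q \<in> \<rat> \<inter> {0..t}" for q
        by (rule sets_G_mono[of q]) (use that in \<open>auto intro!: Q\<close>)
    qed
    with Q[OF t] show ?thesis unfolding eq by (rule sets.Un)
  qed
  ultimately show ?thesis by (simp add: stop_sigma(2)[OF T])
qed

text \<open>Where \<open>T w \<le> t\<close>, the variable is the value of the process at the
  bounded time \<open>min (T w) (ennreal t)\<close>, whose measurability is known.\<close>

lemma value_at_measurable:
  assumes T: "stop_time P G T" and N: "adapted G N" "AE w in P. cadlag (\<lambda>t. N t w)"
  shows "value_at N T \<in> borel_measurable (stop_sigma P G T)"
proof (rule measurableI)
  fix C :: "real set" assume C: "C \<in> sets borel"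
  let ?D = "value_at N T -` C \<inter> space P"
  have D: "{w \<in> ?D. T w \<le> ennreal t} \<in> sets (G t)" if t: "0 \<le> t" for t
  proof -
    have 1: "stop_time P G (\<lambda>w. min (T w) (ennreal t))"
      by (intro stop_time_min T stop_time_const t)
    have fin: "min x (ennreal t) < top" for x by (simp add: min_less_iff_disj)
    have m: "(\<lambda>w. N (enn2real (min (T w) (ennreal t))) w) \<in> borel_measurable (G t)"
    proof (rule stopped_value_measurable[OF t _ cadlag_AE_right[OF N(2)] space_past_stop[OF 1 fin]])
      show "0 \<le> enn2real (min (T w) (ennreal t)) \<and> enn2real (min (T w) (ennreal t)) \<le> t" for w
        using fin t by (simp add: enn2real_le_iff_ennreal)
    qed (use N in \<open>auto simp: adapted_def\<close>)
    have eq: "{w \<in> ?D. T w \<le> ennreal t} = ((\<lambda>w. N (enn2real (min (T w) (ennreal t))) w) -` C \<inter> space (G t))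
        \<inter> {w \<in> space P. T w \<le> ennreal t}"
    proof (intro set_eqI)
      fix w
      have "value_at N T w = N (enn2real (min (T w) (ennreal t))) w" if "T w \<le> ennreal t"
        using that le_less_trans[OF that, of top] by (simp add: value_at_def min_absorb1)
      then show "w \<in> {w \<in> ?D. T w \<le> ennreal t} \<longleftrightarrow> w \<in> ((\<lambda>w. N (enn2real (min (T w) (ennreal t))) w) -` C \<inter> space (G t))
        \<inter> {w \<in> space P. T w \<le> ennreal t}" using space_G[OF t] by auto
    qed
    show ?thesis unfolding eq
      by (rule sets.Int[OF measurable_sets[OF m C]]) (use T t in \<open>simp add: stop_time_def\<close>)
  qed
  have U: "(\<Union>n::nat. {w \<in> space P. T w \<le> ennreal (real n)}) \<in> sets P"
  proof (rule sets.countable_UN'')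
    show "{w \<in> space P. T w \<le> ennreal (real n)} \<in> sets P" for n :: nat
      by (rule sets_G[of "real n"]) (use T in \<open>simp_all add: stop_time_def\<close>)
  qed simp
  have fin: "\<exists>n::nat. T w \<le> ennreal (real n)" if lt: "T w < \<infinity>" for w
  proof -
    obtain x where "T w = ennreal x" using lt by (cases "T w" rule: ennreal_cases) auto
    then show ?thesis using real_arch_simple[of x] by (auto intro: ennreal_leI)
  qed
  \<comment> \<open>Where \<open>T\<close> is infinite the value is zero by convention, so that part
    of the space lies in \<open>?D\<close> entirely or not at all.\<close>
  have eqD: "?D = (\<Union>n::nat. {w \<in> ?D. T w \<le> ennreal (real n)}) \<union>
      (if 0 \<in> C then space P - (\<Union>n::nat. {w \<in> space P. T w \<le> ennreal (real n)}) else {})"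
  proof (intro set_eqI)
    fix w
    show "w \<in> ?D \<longleftrightarrow> w \<in> (\<Union>n::nat. {w \<in> ?D. T w \<le> ennreal (real n)}) \<union>
      (if 0 \<in> C then space P - (\<Union>n::nat. {w \<in> space P. T w \<le> ennreal (real n)}) else {})"
    proof (cases "T w < \<infinity>")
      case True
      then show ?thesis using fin[OF True] by auto
    next
      case False
      then have "\<not> T w \<le> ennreal (real n)" for n using le_less_trans[of "T w" "ennreal (real n)" top] by auto
      moreover have "value_at N T w = 0" using False by (simp add: value_at_def)
      ultimately show ?thesis by auto
    qed
  qed
  have UD: "(\<Union>n::nat. {w \<in> ?D. T w \<le> ennreal (real n)}) \<in> sets P"
  proof (rule sets.countable_UN'')
    show "{w \<in> ?D. T w \<le> ennreal (real n)} \<in> sets P" for n :: nat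
      by (rule sets_G[OF _ D]) auto
  qed simp
  have "?D \<in> sets P"
    by (subst eqD, rule sets.Un[OF UD]) (use sets.Diff[OF sets.top U] in simp)
  then show "value_at N T -` C \<inter> space (stop_sigma P G T) \<in> sets (stop_sigma P G T)"
    unfolding stop_sigma(1,2)[OF T] using D by blast
qed simp

end

section \<open>The projection is reduced by the same stopping times\<close>

context reduced_local_martingale
begin

text \<open>The projection property at the bounded time \<open>?R\<close> involves a generalised
  conditional expectation. Multiplied by the indicator of \<open>A\<close> it becomes an ordinary
  one, because there \<open>X\<close> is integrable by \<open>reduced_martingale\<close>.\<close>

lemma stopped_projection:
  assumes N: "is_optional_projection P G X N" and t: "0 \<le> t"
    and A: "A \<in> G.past (stopped n t)" "\<And>w. w \<in> A \<Longrightarrow> 0 < S n w"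
  shows "integrable P (\<lambda>w. indicator A w * N (stopped n t w) w)"
    and "(\<integral>w. indicator A w * N (stopped n t w) w \<partial>P) = (\<integral>w. indicator A w * X (stopped n t w) w \<partial>P)"
proof -
  let ?R = "\<lambda>w. min (ennreal t) (S n w)"
  let ?\<Sigma> = "stop_sigma P G ?R"
  have R: "stop_time P G ?R" by (rule stopped_stop[OF t])
  interpret sigma_finite_subalgebra P ?\<Sigma> by (rule G.cond_exp_stop_sigma[OF R])
  have v: "value_at Y ?R = (\<lambda>w. Y (stopped n t w) w)" for Y
    by (auto simp: value_at_def stopped_def min_less_iff_disj)
  have Xi: "integrable P (\<lambda>w. indicator A w * X (stopped n t w) w)"
    by (rule reduced_martingale(1)[OF t _ _ G_past_H[OF A(1)]])
      (use G_past_H[OF stopped_past[OF t]] stopped(1-3)[OF t] A(2) in blast)+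
  have Xm: "value_at X ?R \<in> borel_measurable P"
    and NX: "AE w in P. value_at N ?R w = real_cond_exp P ?\<Sigma> (value_at X ?R) w"
    using N R by (auto simp: is_optional_projection_def)
  have A\<Sigma>: "A \<in> sets ?\<Sigma>" using A(1) by (simp add: sets_stop_sigma_stopped[OF t])
  then have [measurable]: "(indicator A :: 'a \<Rightarrow> real) \<in> borel_measurable ?\<Sigma>" by measurable
  let ?f = "\<lambda>w. indicator A w * value_at X ?R w"
  have fi: "integrable P ?f" using Xi by (simp add: v)
  \<comment> \<open>Pulling out the indicator asks for integrability of the product only.\<close>
  have "AE w in P. real_cond_exp P ?\<Sigma> ?f w = indicator A w * real_cond_exp P ?\<Sigma> (value_at X ?R) w"
    by (rule real_cond_exp_mult[OF _ Xm fi]) measurable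
  with NX have eq: "AE w in P. real_cond_exp P ?\<Sigma> ?f w = indicator A w * value_at N ?R w"
    by eventually_elim simp
  have "adapted G N" using N optional_process_adapted[OF G.filt] by (simp add: is_optional_projection_def)
  have m: "(\<lambda>w. indicator A w * value_at N ?R w) \<in> borel_measurable P"
    by (rule measurable_AE_cong[OF G.complete_measure_axioms _ _ _ eq]) (auto simp: subalgebra_def null_sets_def)
  have "integrable P (\<lambda>w. indicator A w * value_at N ?R w)"
    using real_cond_exp_int(1)[OF fi] integrable_cong_AE[OF _ m eq] by auto
  then show "integrable P (\<lambda>w. indicator A w * N (stopped n t w) w)" by (simp add: v)
  have "(\<integral>w. indicator A w * value_at N ?R w \<partial>P) = (\<integral>w. real_cond_exp P ?\<Sigma> ?f w \<partial>P)"
    using integral_cong_AE[OF _ m eq] by auto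
  also have "\<dots> = (\<integral>w. ?f w \<partial>P)" by (rule real_cond_exp_int(2)[OF fi])
  finally show "(\<integral>w. indicator A w * N (stopped n t w) w \<partial>P) = (\<integral>w. indicator A w * X (stopped n t w) w \<partial>P)"
    by (simp add: v)
qed

theorem projection_local_martingale:
  assumes N: "is_optional_projection P G X N" and cad: "AE w in P. cadlag (\<lambda>t. N t w)"
  shows "local_martingale P G N"
proof -
  have adapt: "adapted G N" using N optional_process_adapted[OF G.filt] by (simp add: is_optional_projection_def)
  have "martingale P G (stopped_process N (S n))" for n
  proof -
    let ?E = "{w \<in> space P. 0 < S n w}"
    let ?Z = "\<lambda>t w. indicator ?E w * N (stopped n t w) w"
    have E0: "?E \<in> sets (G 0)" using G.stop_time_pos[OF S_stop order_refl, of n] by simp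
    have Epast: "?E \<in> G.past (stopped n t)" if t: "0 \<le> t" for t
    proof -
      have "{w \<in> ?E. stopped n t w \<le> r} = ?E \<inter> {w \<in> space P. stopped n t w \<le> r}" for r by auto
      moreover have "?E \<in> sets (G r)" if "0 \<le> r" for r by (rule G.sets_G_mono[OF order_refl that E0])
      ultimately show ?thesis
        using stopped_past[OF t, of n] G.sets_G[OF order_refl E0] by (simp add: G.past_def sets.Int)
    qed
    \<comment> \<open>The two forms agree on the space only, so measurability and integrability are
      transferred by congruence below.\<close>
    have ZS: "stopped_process N (S n) t w = ?Z t w" if "w \<in> space P" for t w
      using that by (simp add: stopped_process_def stopped_def)
    have Zm: "?Z t \<in> borel_measurable (G t)" if t: "0 \<le> t" for t
    proof -
      have "(\<lambda>w. N (stopped n t w) w) \<in> borel_measurable (G t)"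
        by (rule G.stopped_value_measurable[OF t _ G.cadlag_AE_right[OF cad] stopped_past[OF t]])
          (use adapt stopped[OF t] in \<open>auto simp: adapted_def\<close>)
      moreover have "?E \<in> sets (G t)" by (rule G.sets_G_mono[OF order_refl t E0])
      ultimately show ?thesis by measurable
    qed
    have Zi: "integrable P (?Z t)" if t: "0 \<le> t" for t
      by (rule stopped_projection(1)[OF N t Epast[OF t]]) simp
    have mart: "AE w in P. real_cond_exp P (G s) (?Z t) w = ?Z s w" if st: "0 \<le> s" "s \<le> t" for s t
    proof -
      have t: "0 \<le> t" using st by simp
      interpret sigma_finite_subalgebra P "G s" by (rule G.cond_exp_subalgebra[OF st(1)])
      show ?thesis
      proof (rule real_cond_exp_charact)
        fix A assume A: "A \<in> sets (G s)"
        have AP: "A \<in> sets P" by (rule G.sets_G[OF st(1) A])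
        have Asp: "A \<subseteq> space P" using AP by (rule sets.sets_into_space)
        let ?C = "{w \<in> space P. ennreal s < S n w}"
        have C: "?C \<in> sets (G s)" by (rule G.stop_time_pos[OF S_stop st(1)])
        have CP: "?C \<in> sets P" by (rule G.sets_G[OF st(1) C])
        have AC: "A \<inter> ?C \<in> sets (G s)" using A C by (rule sets.Int)
        \<comment> \<open>The event is known at \<open>s\<close>, and on it the time
          \<open>stopped n u\<close> is at least \<open>s\<close>; before \<open>s\<close> there is
          nothing to check.\<close>
        have pasts: "A \<inter> ?C \<in> G.past (stopped n u)" if u: "s \<le> u" for u
          unfolding G.past_def
        proof (intro CollectI conjI allI impI)
          have u0: "0 \<le> u" using u st by simp
          show "A \<inter> ?C \<in> sets P" using AP CP by auto
          fix r :: real assume r: "0 \<le> r"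
          show "{w \<in> A \<inter> ?C. stopped n u w \<le> r} \<in> sets (G r)"
          proof (cases "s \<le> r")
            case True
            have "{w \<in> A \<inter> ?C. stopped n u w \<le> r} = (A \<inter> ?C) \<inter> {w \<in> space P. stopped n u w \<le> r}" by auto
            moreover have "A \<inter> ?C \<in> sets (G r)" by (rule G.sets_G_mono[OF st(1) True AC])
            ultimately show ?thesis using stopped_past[OF u0, of n] r by (simp add: G.past_def sets.Int)
          next
            case False
            have "s \<le> stopped n u w" if "w \<in> ?C" for w
            proof -
              have "ennreal s \<le> ennreal (stopped n u w)"
                unfolding stopped(5)[OF u0] using that u by (auto intro: ennreal_leI less_imp_le)
              then show ?thesis using stopped(1)[OF u0] by simp
            qed
            then have e: "{w \<in> A \<inter> ?C. stopped n u w \<le> r} = {}" using False by force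
            show ?thesis unfolding e by simp
          qed
        qed
        have pos: "w \<in> A \<inter> ?C \<Longrightarrow> 0 < S n w" for w by (auto intro: le_less_trans[rotated])
        have eqs: "stopped n s w = s" if "w \<in> A \<inter> ?C" for w
          using that stopped(4)[OF st(1), of n w] by (auto intro: less_imp_le)
        have "(\<integral>w. indicator (A \<inter> ?C) w * N (stopped n t w) w \<partial>P)
            = (\<integral>w. indicator (A \<inter> ?C) w * X (stopped n t w) w \<partial>P)"
          by (rule stopped_projection(2)[OF N t pasts[OF st(2)] pos])
        also have "\<dots> = (\<integral>w. indicator (A \<inter> ?C) w * X (stopped n s w) w \<partial>P)"
        proof (rule reduced_martingale(2)[OF t _ _ G_past_H[OF pasts[OF order_refl]], symmetric])
          show "space P \<in> H.past (stopped n s)" by (rule G_past_H[OF stopped_past[OF st(1)]])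
          show "0 \<le> stopped n s w \<and> stopped n s w \<le> t" for w
            using stopped(1,2)[OF st(1), of n w] st(2) by linarith
          show "ennreal (stopped n s w) \<le> S n w \<and> 0 < S n w" if "w \<in> A \<inter> ?C" for w
            using stopped(3)[OF st(1)] pos[OF that] by blast
        qed
        also have "\<dots> = (\<integral>w. indicator (A \<inter> ?C) w * N (stopped n s w) w \<partial>P)"
          by (rule stopped_projection(2)[OF N st(1) pasts[OF order_refl] pos, symmetric])
        finally have 1: "(\<integral>w. indicator (A \<inter> ?C) w * N (stopped n t w) w \<partial>P)
            = (\<integral>w. indicator (A \<inter> ?C) w * N (stopped n s w) w \<partial>P)" .
        have split: "(\<integral>w. indicator A w * ?Z u w \<partial>P) = (\<integral>w. indicator (A \<inter> ?C) w * N (stopped n u w) w \<partial>P)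
            + (\<integral>w. indicator (A - ?C) w * ?Z u w \<partial>P)" if u: "0 \<le> u" for u
        proof -
          have "(\<integral>w. indicator A w * ?Z u w \<partial>P)
            = (\<integral>w. indicator (A \<inter> ?C) w * ?Z u w + indicator (A - ?C) w * ?Z u w \<partial>P)"
            by (intro Bochner_Integration.integral_cong refl) (auto split: split_indicator)
          also have "\<dots> = (\<integral>w. indicator (A \<inter> ?C) w * ?Z u w \<partial>P) + (\<integral>w. indicator (A - ?C) w * ?Z u w \<partial>P)"
            using AP CP by (intro Bochner_Integration.integral_add G.integrable_ind Zi[OF u]) auto
          also have "(\<integral>w. indicator (A \<inter> ?C) w * ?Z u w \<partial>P) = (\<integral>w. indicator (A \<inter> ?C) w * N (stopped n u w) w \<partial>P)"
            by (intro Bochner_Integration.integral_cong refl) (use pos in \<open>auto split: split_indicator\<close>)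
          finally show ?thesis .
        qed
        have "(\<integral>w. indicator (A - ?C) w * ?Z t w \<partial>P) = (\<integral>w. indicator (A - ?C) w * ?Z s w \<partial>P)"
        proof (intro Bochner_Integration.integral_cong refl)
          fix w assume "w \<in> space P"
          have "stopped n t w = stopped n s w" if "S n w \<le> ennreal s"
            using that st order_trans[OF that ennreal_leI[OF st(2)]] by (simp add: stopped_def min_absorb2)
          then show "indicator (A - ?C) w * ?Z t w = indicator (A - ?C) w * ?Z s w"
            using Asp by (auto simp: not_less split: split_indicator)
        qed
        then show "(\<integral>w\<in>A. ?Z t w \<partial>P) = (\<integral>w\<in>A. ?Z s w \<partial>P)"
          using split[OF st(1)] split[OF t] 1 by (simp add: set_lebesgue_integral_def)
      qed (use Zi Zm st t in auto)
    qed
    have [simp]: "integrable P (stopped_process N (S n) t) \<longleftrightarrow> integrable P (?Z t)" for t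
      by (intro Bochner_Integration.integrable_cong refl ZS)
    show ?thesis
      unfolding martingale_def
    proof (intro conjI allI impI)
      show "adapted G (stopped_process N (S n))"
        unfolding adapted_def
      proof (intro allI impI)
        fix t :: real assume t: "0 \<le> t"
        show "stopped_process N (S n) t \<in> borel_measurable (G t)"
          by (rule measurable_cong[THEN iffD2, OF ZS Zm[OF t]]) (simp add: G.space_G[OF t])
      qed
      show "AE w in P. cadlag (\<lambda>t. stopped_process N (S n) t w)"
        using cad
      proof eventually_elim
        case (elim w)
        then show ?case
          using cadlag_stopped[OF elim, of "S n w"]
          by (cases "0 < S n w") (simp_all add: stopped_process_def cadlag_const)
      qed
      show "integrable P (stopped_process N (S n) t)" if "0 \<le> t" for t using Zi[OF that] by simp
      fix s t :: real assume st: "0 \<le> s" "s \<le> t"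
      interpret sigma_finite_subalgebra P "G s" by (rule G.cond_exp_subalgebra[OF st(1)])
      have t: "0 \<le> t" using st by simp
      have "AE w in P. real_cond_exp P (G s) (stopped_process N (S n) t) w = real_cond_exp P (G s) (?Z t) w"
      proof (rule real_cond_exp_cong)
        show "AE w in P. stopped_process N (S n) t w = ?Z t w" using ZS by (rule AE_I2)
        show "?Z t \<in> borel_measurable P" by (rule borel_measurable_integrable[OF Zi[OF t]])
        then show "stopped_process N (S n) t \<in> borel_measurable P"
          by (rule measurable_cong[THEN iffD2, OF ZS, rotated])
      qed
      with mart[OF st] AE_space
      show "AE w in P. real_cond_exp P (G s) (stopped_process N (S n) t) w = stopped_process N (S n) s w"
        by eventually_elim (simp add: ZS)
    qed
  qed
  then show ?thesis
    unfolding local_martingale_def using adapt cad S_stop S_lim by (intro conjI exI[of _ S]) auto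
qed

end

section \<open>Existence of the optional projection\<close>

lemma ennreal_less_witness:
  assumes "ennreal t < x" "0 \<le> t"
  obtains c where "t < c" "ennreal c \<le> x"
proof (cases x rule: ennreal_cases)
  case (real r)
  then show ?thesis using assms that[of r] by (simp add: ennreal_less_iff)
next
  case top
  then show ?thesis using that[of "t + 1"] by simp
qed

context reduced_local_martingale
begin

text \<open>The horizon and the reducing time share the index \<open>n\<close>, so that a single
  sequence of closed martingales exhausts the half-line.\<close>

abbreviation closing :: "nat \<Rightarrow> 'a \<Rightarrow> real" where
  "closing n \<equiv> (\<lambda>w. indicator {w \<in> space P. 0 < S n w} w * X (stopped n (real n) w) w)"

text \<open>Optional stopping of \<open>Y\<close> in \<open>G\<close> and
  \<open>reduced_martingale\<close> for \<open>X\<close> in \<open>H\<close> lead to the same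
  integral of the closing variable. So \<open>Y\<close> acts as projection of \<open>X\<close> at
  times up to \<open>S n\<close> and \<open>n\<close>.\<close>

lemma closed_version_projection:
  fixes n :: nat
  assumes closed: "\<And>m. G.closed_by m (closing n) Y"
    and cad: "\<And>w. w \<in> space P \<Longrightarrow> cadlag (\<lambda>t. Y t w)"
    and th: "space P \<in> G.past \<theta>" "\<And>w. w \<in> space P \<Longrightarrow> 0 \<le> \<theta> w \<and> \<theta> w \<le> real n"
    and A: "A \<in> G.past \<theta>" "\<And>w. w \<in> A \<Longrightarrow> ennreal (\<theta> w) \<le> S n w \<and> 0 < S n w"
  shows "integrable P (\<lambda>w. indicator A w * Y (\<theta> w) w)"
    and "(\<integral>w. indicator A w * Y (\<theta> w) w \<partial>P) = (\<integral>w. indicator A w * X (\<theta> w) w \<partial>P)"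
proof -
  let ?\<xi> = "closing n"
  have AP: "A \<in> sets P" using A(1) by (simp add: G.past_def)
  have Asp: "A \<subseteq> space P" using AP by (rule sets.sets_into_space)
  have rc: "AE w in P. \<forall>s\<ge>0. ((\<lambda>s. Y s w) \<longlongrightarrow> Y s w) (at_right s)"
    by (rule G.cadlag_AE_right, rule AE_I2, rule cad)
  have n0: "0 \<le> real n" by simp
  note ost = G.optional_stopping[OF n0 closed rc th]
  show "integrable P (\<lambda>w. indicator A w * Y (\<theta> w) w)"
    by (rule G.integrable_ind[OF AP ost(1)])
  have "(\<integral>w. indicator A w * Y (\<theta> w) w \<partial>P) = (\<integral>w. indicator A w * ?\<xi> w \<partial>P)"
    by (rule ost(2)[OF _ A(1)])
  also have "\<dots> = (\<integral>w. indicator A w * X (stopped n (real n) w) w \<partial>P)"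
    by (intro Bochner_Integration.integral_cong refl) (use A(2) in \<open>auto split: split_indicator\<close>)
  also have "\<dots> = (\<integral>w. indicator A w * X (\<theta> w) w \<partial>P)"
    by (rule reduced_martingale(2)[OF n0 G_past_H[OF th(1)] th(2) G_past_H[OF A(1)] A(2), symmetric])
  finally show "(\<integral>w. indicator A w * Y (\<theta> w) w \<partial>P) = (\<integral>w. indicator A w * X (\<theta> w) w \<partial>P)" .
qed

lemma ex_closed_versions:
  "\<exists>Y. \<forall>n::nat. adapted G (Y n) \<and> (\<forall>w\<in>space P. cadlag (\<lambda>t. Y n t w)) \<and>
    (\<forall>m. G.closed_by m (closing n) (Y n))"
proof (intro choice allI)
  fix n :: nat
  have n0: "0 \<le> real n" by simp
  show "\<exists>Y. adapted G Y \<and> (\<forall>w\<in>space P. cadlag (\<lambda>t. Y t w)) \<and>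
    (\<forall>m. G.closed_by m (closing n) Y)"
  proof (rule G.cadlag_version[OF reduced_martingale(1)[OF n0]])
    let ?E = "{w \<in> space P. 0 < S n w}"
    show s: "space P \<in> H.past (stopped n (real n))" by (rule G_past_H[OF stopped_past[OF n0]])
    show "0 \<le> stopped n (real n) w \<and> stopped n (real n) w \<le> real n" for w
      using stopped(1,2)[OF n0] by blast
    show "ennreal (stopped n (real n) w) \<le> S n w \<and> 0 < S n w" if "w \<in> ?E" for w
      using stopped(3)[OF n0] that by blast
    have E0: "?E \<in> sets (G 0)" using G.stop_time_pos[OF S_stop order_refl, of n] by simp
    have "{w \<in> ?E. stopped n (real n) w \<le> r} = ?E \<inter> {w \<in> space P. stopped n (real n) w \<le> r}" for r by auto
    moreover have "?E \<in> sets (G r)" if "0 \<le> r" for r by (rule G.sets_G_mono[OF order_refl that E0])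
    ultimately have "?E \<in> G.past (stopped n (real n))"
      using stopped_past[OF n0, of n] G.sets_G[OF order_refl E0] by (simp add: G.past_def sets.Int)
    then show "?E \<in> H.past (stopped n (real n))" by (rule G_past_H)
  qed
qed

text \<open>On the event that \<open>t\<close> precedes both reducing times, either version is the
  conditional expectation of \<open>X t\<close> restricted to that event.\<close>

lemma closed_versions_agree:
  fixes m n :: nat
  assumes Y: "adapted G Y" "\<And>w. w \<in> space P \<Longrightarrow> cadlag (\<lambda>t. Y t w)"
      "\<And>l. G.closed_by l (closing n) Y"
    and Z: "adapted G Z" "\<And>w. w \<in> space P \<Longrightarrow> cadlag (\<lambda>t. Z t w)"
      "\<And>l. G.closed_by l (closing m) Z"
    and t: "0 \<le> t" "t < real n" "t < real m"
  shows "AE w in P. ennreal t < S n w \<longrightarrow> ennreal t < S m w \<longrightarrow> Y t w = Z t w"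
proof -
  interpret sigma_finite_subalgebra P "G t" by (rule G.cond_exp_subalgebra[OF t(1)])
  let ?B = "{w \<in> space P. ennreal t < S n w} \<inter> {w \<in> space P. ennreal t < S m w}"
  have B: "?B \<in> sets (G t)" by (intro sets.Int G.stop_time_pos[OF S_stop t(1)])
  have BP: "?B \<in> sets P" by (rule G.sets_G[OF t(1) B])
  have Bpos: "ennreal t \<le> S n w \<and> 0 < S n w" "ennreal t \<le> S m w \<and> 0 < S m w" if "w \<in> ?B" for w
    using that by (auto intro: less_imp_le le_less_trans[rotated])
  have sp: "space P \<in> G.past (\<lambda>_. t)"
    using G.past_const[OF t(1), of "space P"] sets.top[of "G t"] by (simp add: G.space_G[OF t(1)])
  let ?f = "\<lambda>w. indicator ?B w * X t w"
  have fi: "integrable P ?f"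
    by (rule reduced_martingale(1)[OF t(1) G_past_H[OF sp] _ G_past_H[OF G.past_const[OF t(1) B]], of n])
      (use t Bpos in auto)
  have one: "AE w in P. real_cond_exp P (G t) ?f w = indicator ?B w * U t w"
    if U: "adapted G U" "\<And>A. A \<in> sets (G t) \<Longrightarrow> A \<subseteq> ?B \<Longrightarrow> integrable P (\<lambda>w. indicator A w * U t w) \<and>
      (\<integral>w. indicator A w * U t w \<partial>P) = (\<integral>w. indicator A w * X t w \<partial>P)" for U
  proof (rule real_cond_exp_charact)
    fix A assume A: "A \<in> sets (G t)"
    have "(\<integral>w. indicator (A \<inter> ?B) w * X t w \<partial>P) = (\<integral>w. indicator (A \<inter> ?B) w * U t w \<partial>P)"
      by (rule U(2)[OF sets.Int[OF A B] Int_lower2, THEN conjunct2, symmetric])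
    then show "(\<integral>w\<in>A. ?f w \<partial>P) = (\<integral>w\<in>A. indicator ?B w * U t w \<partial>P)"
      by (simp add: set_lebesgue_integral_def indicator_inter_arith mult.assoc)
  next
    show "integrable P (\<lambda>w. indicator ?B w * U t w)" using U(2)[OF B order_refl] by blast
    have [measurable]: "U t \<in> borel_measurable (G t)" using U(1) t(1) by (simp add: adapted_def)
    show "(\<lambda>w. indicator ?B w * U t w) \<in> borel_measurable (G t)"
      by (intro borel_measurable_times borel_measurable_indicator B) measurable
  qed (rule fi)
  have "AE w in P. real_cond_exp P (G t) ?f w = indicator ?B w * Y t w"
  proof (rule one[OF Y(1)])
    fix A assume A: "A \<in> sets (G t)" "A \<subseteq> ?B"
    have "w \<in> A \<Longrightarrow> ennreal t \<le> S n w \<and> 0 < S n w" for w using Bpos(1) A(2) by blast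
    from closed_version_projection[OF Y(3,2) sp _ G.past_const[OF t(1) A(1)] this] t
    show "integrable P (\<lambda>w. indicator A w * Y t w) \<and>
      (\<integral>w. indicator A w * Y t w \<partial>P) = (\<integral>w. indicator A w * X t w \<partial>P)" by auto
  qed
  moreover have "AE w in P. real_cond_exp P (G t) ?f w = indicator ?B w * Z t w"
  proof (rule one[OF Z(1)])
    fix A assume A: "A \<in> sets (G t)" "A \<subseteq> ?B"
    have "w \<in> A \<Longrightarrow> ennreal t \<le> S m w \<and> 0 < S m w" for w using Bpos(2) A(2) by blast
    from closed_version_projection[OF Z(3,2) sp _ G.past_const[OF t(1) A(1)] this] t
    show "integrable P (\<lambda>w. indicator A w * Z t w) \<and>
      (\<integral>w. indicator A w * Z t w \<partial>P) = (\<integral>w. indicator A w * X t w \<partial>P)" by auto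
  qed
  ultimately show ?thesis using AE_space
    by eventually_elim (auto split: split_indicator_asm)
qed

text \<open>The closed versions agree almost surely at all rational times at once, and right
  continuity extends this to all times. Each path can therefore be pasted from pieces on windows
  \<open>[0, min n (S n))\<close>, and the projection property is verified on the events that
  \<open>T\<close> falls into such a window.\<close>

theorem ex_optional_projection:
  "\<exists>N. is_optional_projection P G X N \<and> (AE w in P. cadlag (\<lambda>t. N t w))"
proof -
  obtain Y where Yall: "\<forall>n::nat. adapted G (Y n) \<and> (\<forall>w\<in>space P. cadlag (\<lambda>t. Y n t w)) \<and>
    (\<forall>m. G.closed_by m (closing n) (Y n))"
    using ex_closed_versions by blast
  have Ya: "adapted G (Y n)" and Yc: "\<And>w. w \<in> space P \<Longrightarrow> cadlag (\<lambda>t. Y n t w)"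
    and Ycl: "\<And>m. G.closed_by m (closing n) (Y n)"
    for n using Yall by blast+
  have "AE w in P. (\<forall>q\<in>\<rat>. \<forall>n m. 0 \<le> q \<longrightarrow> q < real n \<longrightarrow> q < real m \<longrightarrow>
      ennreal q < S n w \<longrightarrow> ennreal q < S m w \<longrightarrow> Y n q w = Y m q w) \<and> (\<lambda>n. S n w) \<longlonglongrightarrow> \<infinity>"
  proof (rule AE_conjI)
    show "AE w in P. \<forall>q\<in>\<rat>. \<forall>n m. 0 \<le> q \<longrightarrow> q < real n \<longrightarrow> q < real m \<longrightarrow>
      ennreal q < S n w \<longrightarrow> ennreal q < S m w \<longrightarrow> Y n q w = Y m q w"
    proof (intro AE_ball_countable[THEN iffD2] countable_rat ballI AE_all_countable[THEN iffD2] allI)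
      fix q :: real and n m :: nat
      show "AE w in P. 0 \<le> q \<longrightarrow> q < real n \<longrightarrow> q < real m \<longrightarrow>
        ennreal q < S n w \<longrightarrow> ennreal q < S m w \<longrightarrow> Y n q w = Y m q w"
      proof (cases "0 \<le> q \<and> q < real n \<and> q < real m")
        case True
        then have "AE w in P. ennreal q < S n w \<longrightarrow> ennreal q < S m w \<longrightarrow> Y n q w = Y m q w"
          by (intro closed_versions_agree[OF Ya Yc Ycl Ya Yc Ycl]) auto
        then show ?thesis by eventually_elim blast
      qed (auto intro!: AE_I2)
    qed
    show "AE w in P. (\<lambda>n. S n w) \<longlonglongrightarrow> \<infinity>" using S_lim by eventually_elim blast
  qed
  then obtain M where M: "M \<in> null_sets P" and good: "\<And>w. w \<in> space P - M \<Longrightarrow>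
     (\<forall>q\<in>\<rat>. \<forall>n m. 0 \<le> q \<longrightarrow> q < real n \<longrightarrow> q < real m \<longrightarrow>
      ennreal q < S n w \<longrightarrow> ennreal q < S m w \<longrightarrow> Y n q w = Y m q w) \<and> (\<lambda>n. S n w) \<longlonglongrightarrow> \<infinity>"
    by (rule AE_E3) blast
  have large: "\<exists>n0. \<forall>n\<ge>n0. t < real n \<and> ennreal t < S n w" if mem: "w \<in> space P" "w \<notin> M" for w and t :: real
  proof -
    have "eventually (\<lambda>n. ennreal t < S n w) sequentially"
      using good[of w] mem by (intro order_tendstoD(1)[where y = \<infinity>]) auto
    moreover have "eventually (\<lambda>n. t < real n) sequentially"
      using filterlim_real_sequentially by (simp add: filterlim_at_top_dense)
    ultimately show ?thesis using eventually_conj unfolding eventually_sequentially[symmetric] by fastforce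
  qed
  have agree: "Y n t w = Y m t w"
    if mem: "w \<in> space P" "w \<notin> M" and t: "0 \<le> t" "t < real n" "t < real m" "ennreal t < S n w" "ennreal t < S m w"
    for w t n m
  proof -
    obtain c1 where c1: "t < c1" "ennreal c1 \<le> S n w" using ennreal_less_witness[OF t(4,1)] by blast
    obtain c2 where c2: "t < c2" "ennreal c2 \<le> S m w" using ennreal_less_witness[OF t(5,1)] by blast
    \<comment> \<open>Rationals between \<open>t\<close> and \<open>c\<close> still lie inside both
      windows, so there the two versions are known to agree.\<close>
    define c where "c = min (min c1 c2) (min (real n) (real m))"
    have c: "t < c" using c1 c2 t by (simp add: c_def)
    let ?F = "at t within (\<rat> \<inter> {t<..})"
    have sub: "((\<lambda>q. Y l q w) \<longlongrightarrow> Y l t w) ?F" for l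
      by (rule tendsto_within_subset[of _ _ _ "{t<..}"]) (use Yc[OF mem(1), of l] t in \<open>auto simp: cadlag_def\<close>)
    have "eventually (\<lambda>q. q \<in> {..<c} \<and> q \<in> \<rat> \<inter> {t<..}) ?F"
      unfolding eventually_at_topological using c by (intro exI[of _ "{..<c}"]) auto
    then have "eventually (\<lambda>q. Y n q w = Y m q w) ?F"
    proof eventually_elim
      case (elim q)
      then have q: "q \<in> \<rat>" "0 \<le> q" "q < c1" "q < c2" "q < real n" "q < real m" using t(1) by (auto simp: c_def)
      have "ennreal q < S n w" "ennreal q < S m w"
        using less_le_trans[OF _ c1(2), of "ennreal q"] less_le_trans[OF _ c2(2), of "ennreal q"] q
        by (simp_all add: ennreal_lessI)
      then show ?case using good[of w] mem q by blast
    qed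
    then have "((\<lambda>q. Y n q w) \<longlongrightarrow> Y m t w) ?F" using sub[of m] by (simp add: tendsto_cong)
    then show ?thesis by (rule tendsto_unique[OF at_within_Rats_right sub])
  qed
  \<comment> \<open>Outside \<open>M\<close> the sequence is eventually constant in
    \<open>n\<close>. Zero on \<open>M\<close> again keeps every path cadlag, which makes
    \<open>N\<close> itself a source of generators of the optional \<sigma>-field.\<close>
  define N where "N t w = (if w \<in> M then 0 else lim (\<lambda>n. Y n t w))" for t w
  have NY: "N t w = Y n t w"
    if mem: "w \<in> space P" "w \<notin> M" and t: "0 \<le> t" "t < real n" "ennreal t < S n w" for w t n
  proof -
    obtain n0 where n0: "\<And>m. n0 \<le> m \<Longrightarrow> t < real m \<and> ennreal t < S m w" using large[OF mem] by blast
    have "eventually (\<lambda>m. Y m t w = Y n t w) sequentially"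
      unfolding eventually_sequentially using agree[OF mem t(1) _ t(2) _ t(3)] n0 by blast
    then have "(\<lambda>m. Y m t w) \<longlonglongrightarrow> Y n t w" by (rule tendsto_eventually)
    then show ?thesis using mem by (simp add: N_def limI)
  qed
  have Ncad: "cadlag (\<lambda>t. N t w)" if mem: "w \<in> space P" for w
  proof (cases "w \<in> M")
    case True
    then show ?thesis by (simp add: N_def cadlag_const)
  next
    case False
    show ?thesis
    proof (rule cadlag_cong)
      fix t :: real assume t: "0 \<le> t"
      obtain n where n: "t + 1 < real n" "ennreal (t + 1) < S n w" using large[OF mem False, of "t + 1"] by blast
      have "N s w = Y n s w" if s: "0 \<le> s" "s < t + 1" for s
      proof (rule NY[OF mem False s(1)])
        show "s < real n" using s n by simp
        have "ennreal s \<le> ennreal (t + 1)" using s by (intro ennreal_leI) simp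
        then show "ennreal s < S n w" using n(2) by (rule le_less_trans)
      qed
      then show "\<exists>e>0. \<exists>g. cadlag g \<and> (\<forall>s. 0 \<le> s \<longrightarrow> s < t + e \<longrightarrow> N s w = g s)"
        using Yc[OF mem, of n] by (intro exI[of _ 1] conjI exI[of _ "\<lambda>s. Y n s w"]) auto
    qed
  qed
  have Nad: "adapted G N"
    unfolding adapted_def
  proof (intro allI impI)
    fix t :: real assume t: "0 \<le> t"
    have [measurable]: "M \<in> sets (G t)" using G.null_sets_G[OF t] M by blast
    have [measurable]: "Y n t \<in> borel_measurable (G t)" for n using Ya t by (simp add: adapted_def)
    show "N t \<in> borel_measurable (G t)" unfolding N_def by measurable
  qed
  have Nopt: "optional_process G N"
    unfolding optional_process_def
  proof (rule measurableI)
    fix B :: "real set" assume B: "B \<in> sets borel"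
    let ?gen = "{{(t, w) \<in> {0..} \<times> space (G 0). X t w \<in> B} | X B.
        adapted G X \<and> (\<forall>w\<in>space (G 0). cadlag (\<lambda>t. X t w)) \<and> B \<in> sets borel}"
    have gen: "?gen \<subseteq> Pow ({0..} \<times> space (G 0))" by auto
    have "(\<lambda>(t, w). N t w) -` B \<inter> space (optional_sigma G) = {(t, w) \<in> {0..} \<times> space (G 0). N t w \<in> B}"
      unfolding optional_sigma_def space_measure_of[OF gen] by auto
    moreover have "\<dots> \<in> ?gen" using Nad Ncad B G.space_G[of 0] by auto
    ultimately show "(\<lambda>(t, w). N t w) -` B \<inter> space (optional_sigma G) \<in> sets (optional_sigma G)"
      unfolding optional_sigma_def sets_measure_of[OF gen] by (metis (no_types, lifting) sigma_sets.Basic)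
  qed simp
  have NcadAE: "AE w in P. cadlag (\<lambda>t. N t w)" using Ncad by (rule AE_I2)
  have "value_at X T \<in> borel_measurable P \<and>
      (AE w in P. nn_cond_exp P (stop_sigma P G T) (\<lambda>w. ennreal \<bar>value_at X T w\<bar>) w < \<infinity>) \<and>
      (AE w in P. value_at N T w = real_cond_exp P (stop_sigma P G T) (value_at X T) w)"
    if T: "stop_time P G T" for T
  proof -
    let ?\<Sigma> = "stop_sigma P G T"
    let ?proj = "\<lambda>w. nn_cond_exp P ?\<Sigma> (\<lambda>w. ennreal \<bar>value_at X T w\<bar>) w < \<infinity> \<and>
        value_at N T w = real_cond_exp P ?\<Sigma> (value_at X T) w"
    interpret sigma_finite_subalgebra P ?\<Sigma> by (rule G.cond_exp_stop_sigma[OF T])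
    have TH: "stop_time P H T" using T G_le_H by (auto simp: stop_time_def)
    have Xm[measurable]: "value_at X T \<in> borel_measurable P"
      by (rule measurable_from_subalg[OF H.stop_sigma(3)[OF TH] H.value_at_measurable[OF TH X_adapted X_cadlag]])
    have Nm[measurable]: "value_at N T \<in> borel_measurable ?\<Sigma>"
      by (rule G.value_at_measurable[OF T Nad NcadAE])
    \<comment> \<open>Generalised conditional expectations are local: on an event of
      \<open>?\<Sigma>\<close> where \<open>X\<close> at time \<open>T\<close> is integrable,
      finiteness and the projection identity can be tested after multiplication by the
      indicator.\<close>
    have local: "AE w in P. w \<in> B \<longrightarrow> ?proj w"
      if B: "B \<in> sets ?\<Sigma>" and Xi: "integrable P (\<lambda>w. indicator B w * value_at X T w)"
        and Ni: "integrable P (\<lambda>w. indicator B w * value_at N T w)"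
        and eq: "\<And>A. A \<in> sets ?\<Sigma> \<Longrightarrow> (\<integral>w. indicator (A \<inter> B) w * value_at X T w \<partial>P) = (\<integral>w. indicator (A \<inter> B) w * value_at N T w \<partial>P)"
      for B
    proof -
      have [measurable]: "(indicator B :: 'a \<Rightarrow> real) \<in> borel_measurable ?\<Sigma>" using B by (rule borel_measurable_indicator)
      have Bn[measurable]: "(indicator B :: 'a \<Rightarrow> ennreal) \<in> borel_measurable ?\<Sigma>" using B by (rule borel_measurable_indicator)
      have Bn'[measurable]: "(indicator B :: 'a \<Rightarrow> ennreal) \<in> borel_measurable P"
        by (rule measurable_from_subalg[OF subalg Bn])
      have 1: "AE w in P. real_cond_exp P ?\<Sigma> (\<lambda>w. indicator B w * value_at X T w) w = indicator B w * real_cond_exp P ?\<Sigma> (value_at X T) w"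
        by (rule real_cond_exp_mult[OF _ Xm Xi]) measurable
      have 2: "AE w in P. real_cond_exp P ?\<Sigma> (\<lambda>w. indicator B w * value_at X T w) w = indicator B w * value_at N T w"
      proof (rule real_cond_exp_charact[OF _ Xi Ni])
        show "(\<integral>w\<in>A. indicator B w * value_at X T w \<partial>P) = (\<integral>w\<in>A. indicator B w * value_at N T w \<partial>P)" if "A \<in> sets ?\<Sigma>" for A
          using eq[OF that] by (simp add: set_lebesgue_integral_def indicator_inter_arith mult.assoc)
      qed measurable
      let ?g = "\<lambda>w. indicator B w * ennreal \<bar>value_at X T w\<bar>"
      have 3: "AE w in P. indicator B w * nn_cond_exp P ?\<Sigma> (\<lambda>w. ennreal \<bar>value_at X T w\<bar>) w = nn_cond_exp P ?\<Sigma> ?g w"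
        by (rule nn_cond_exp_prod) measurable
      have "AE w in P. nn_cond_exp P ?\<Sigma> ?g w \<noteq> \<infinity>"
      proof (rule nn_integral_noteq_infinite)
        have "(\<integral>\<^sup>+w. nn_cond_exp P ?\<Sigma> ?g w \<partial>P) = (\<integral>\<^sup>+w. ?g w \<partial>P)"
          using nn_cond_exp_intg[of "\<lambda>_. 1" ?g] by simp
        also have "\<dots> = (\<integral>\<^sup>+w. ennreal (norm (indicator B w * value_at X T w)) \<partial>P)"
          by (intro nn_integral_cong) (auto split: split_indicator)
        also have "\<dots> < \<infinity>" using Xi by (simp add: integrable_iff_bounded)
        finally show "(\<integral>\<^sup>+w. nn_cond_exp P ?\<Sigma> ?g w \<partial>P) \<noteq> \<infinity>" by simp
      qed measurable
      with 1 2 3 show ?thesis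
        by eventually_elim (auto simp: less_top)
    qed
    \<comment> \<open>Strict inequality places \<open>T\<close> inside the window on which
      \<open>N\<close> equals \<open>Y n\<close>. The complementary event \<open>?C\<close>, that
      \<open>T\<close> is infinite, is harmless since \<open>value_at\<close> is zero there.\<close>
    let ?B = "\<lambda>n::nat. {w \<in> space P. T w < min (ennreal (real n)) (S n w)}"
    let ?C = "space P - {w \<in> space P. T w < top}"
    have Bn: "AE w in P. w \<in> ?B n \<longrightarrow> ?proj w" for n
    proof (rule local)
      have n0: "0 \<le> real n" by simp
      define \<theta> where "\<theta> w = enn2real (min (T w) (ennreal (real n)))" for w
      have 1: "stop_time P G (\<lambda>w. min (T w) (ennreal (real n)))"
        by (intro G.stop_time_min T G.stop_time_const n0)
      have fin: "min x (ennreal (real n)) < top" for x by (simp add: min_less_iff_disj)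
      have th: "space P \<in> G.past \<theta>" "0 \<le> \<theta> w \<and> \<theta> w \<le> real n" for w
        unfolding \<theta>_def using G.space_past_stop[OF 1 fin] fin by (auto simp: enn2real_le_iff_ennreal)
      show B: "?B n \<in> sets ?\<Sigma>" by (rule G.stop_time_less[OF T G.stop_time_min[OF G.stop_time_const[OF n0] S_stop]])
      have on: "ennreal (\<theta> w) = T w" "T w < top" "T w < S n w" "\<theta> w < real n" if mem: "w \<in> ?B n" for w
      proof -
        have less: "T w < ennreal (real n)" "T w < S n w" using mem by auto
        then show "T w < top" "T w < S n w" by (auto intro: less_trans)
        then show e: "ennreal (\<theta> w) = T w" using less by (simp add: \<theta>_def min_absorb1 less_imp_le)
        show "\<theta> w < real n" using less(1) th(2)[of w] unfolding e[symmetric] by (simp add: ennreal_less_iff)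
      qed
      have val: "value_at U T w = U (\<theta> w) w" if mem: "w \<in> ?B n" for w and U :: "real \<Rightarrow> 'a \<Rightarrow> real"
        using on(1,2)[OF mem] th(2)[of w] by (simp add: value_at_def on(1)[OF mem, symmetric])
      have past: "A \<inter> ?B n \<in> G.past \<theta>" if A: "A \<in> sets ?\<Sigma>" for A
      proof -
        have AB: "A \<inter> ?B n \<in> sets ?\<Sigma>" using A B by (rule sets.Int)
        have "{w \<in> A \<inter> ?B n. \<theta> w \<le> r} = {w \<in> A \<inter> ?B n. T w \<le> ennreal r}" if r: "0 \<le> r" for r
        proof (intro set_eqI)
          fix w
          have "\<theta> w \<le> r \<longleftrightarrow> T w \<le> ennreal r" if mem: "w \<in> ?B n"
            by (simp only: on(1)[OF mem, symmetric] ennreal_le_iff[OF r])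
          then show "w \<in> {w \<in> A \<inter> ?B n. \<theta> w \<le> r} \<longleftrightarrow> w \<in> {w \<in> A \<inter> ?B n. T w \<le> ennreal r}"
            by blast
        qed
        then show ?thesis using AB by (simp add: G.stop_sigma(2)[OF T] G.past_def)
      qed
      have pos: "ennreal (\<theta> w) \<le> S n w \<and> 0 < S n w" if "w \<in> A \<inter> ?B n" for A w
        using on(1,3)[of w] that by (auto intro: less_imp_le le_less_trans[rotated])
      have proj: "integrable P (\<lambda>w. indicator (A \<inter> ?B n) w * Y n (\<theta> w) w)"
          "(\<integral>w. indicator (A \<inter> ?B n) w * Y n (\<theta> w) w \<partial>P) = (\<integral>w. indicator (A \<inter> ?B n) w * X (\<theta> w) w \<partial>P)"
        if A: "A \<in> sets ?\<Sigma>" for A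
        by (rule closed_version_projection[OF Ycl Yc th past[OF A] pos[of _ A]]; assumption)+
      have indX: "indicator (A \<inter> ?B n) w * value_at U T w = indicator (A \<inter> ?B n) w * U (\<theta> w) w" for A w and U :: "real \<Rightarrow> 'a \<Rightarrow> real"
        using val[of w U] by (cases "w \<in> ?B n") (auto split: split_indicator)
      have indN: "AE w in P. indicator (A \<inter> ?B n) w * Y n (\<theta> w) w = indicator (A \<inter> ?B n) w * value_at N T w" for A
        using AE_not_in[OF M] AE_space
      proof eventually_elim
        case (elim w)
        show ?case
        proof (cases "w \<in> ?B n")
          case True
          have "N (\<theta> w) w = Y n (\<theta> w) w"
            by (rule NY[OF elim(2,1)]) (use th(2)[of w] on[OF True] in auto)
          then show ?thesis using val[OF True, of N] by simp
        qed simp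
      qed
      have top: "space P \<in> sets ?\<Sigma>" using sets.top[of ?\<Sigma>] by (simp add: G.stop_sigma(1)[OF T])
      have spB: "space P \<inter> ?B n = ?B n" by auto
      have Nind: "(\<lambda>w. indicator (A \<inter> ?B n) w * value_at N T w) \<in> borel_measurable P" if "A \<in> sets ?\<Sigma>" for A
      proof (rule measurable_from_subalg[OF subalg])
        show "(\<lambda>w. indicator (A \<inter> ?B n) w * value_at N T w) \<in> borel_measurable ?\<Sigma>"
          by (intro borel_measurable_times borel_measurable_indicator sets.Int that B Nm)
      qed
      show "integrable P (\<lambda>w. indicator (?B n) w * value_at X T w)"
      proof -
        have "integrable P (\<lambda>w. indicator (space P \<inter> ?B n) w * X (\<theta> w) w)"
          by (rule reduced_martingale(1)[OF n0 G_past_H[OF th(1)] th(2) G_past_H[OF past[OF top]] pos[of _ "space P"]])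
        then have "integrable P (\<lambda>w. indicator (space P \<inter> ?B n) w * value_at X T w)"
          by (simp only: indX)
        then show ?thesis unfolding spB .
      qed
      show "integrable P (\<lambda>w. indicator (?B n) w * value_at N T w)"
        using integrable_cong_AE[OF borel_measurable_integrable[OF proj(1)[OF top]] Nind[OF top] indN[of "space P"]]
          proj(1)[OF top] unfolding spB by blast
      fix A assume A: "A \<in> sets ?\<Sigma>"
      have "(\<integral>w. indicator (A \<inter> ?B n) w * value_at X T w \<partial>P) = (\<integral>w. indicator (A \<inter> ?B n) w * Y n (\<theta> w) w \<partial>P)"
        unfolding indX by (rule proj(2)[OF A, symmetric])
      also have "\<dots> = (\<integral>w. indicator (A \<inter> ?B n) w * value_at N T w \<partial>P)"
        by (rule integral_cong_AE[OF _ Nind[OF A] indN]) (rule borel_measurable_integrable[OF proj(1)[OF A]])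
      finally show "(\<integral>w. indicator (A \<inter> ?B n) w * value_at X T w \<partial>P) = (\<integral>w. indicator (A \<inter> ?B n) w * value_at N T w \<partial>P)" .
    qed
    have C0: "indicator ?C w * value_at U T w = 0" for w and U :: "real \<Rightarrow> 'a \<Rightarrow> real"
      by (auto simp: value_at_def split: split_indicator)
    have C0': "indicator (A \<inter> ?C) w * value_at U T w = 0" for w A and U :: "real \<Rightarrow> 'a \<Rightarrow> real"
      by (auto simp: value_at_def split: split_indicator)
    have Cn: "AE w in P. w \<in> ?C \<longrightarrow> ?proj w"
    proof (rule local)
      have "stop_time P G (\<lambda>_. top)" by (simp add: stop_time_def top_unique)
      from G.stop_time_less[OF T this] have "{w \<in> space P. T w < top} \<in> sets ?\<Sigma>" .
      then show "?C \<in> sets ?\<Sigma>" using sets.top[of ?\<Sigma>] by (auto simp: G.stop_sigma(1)[OF T] intro!: sets.Diff)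
    qed (simp_all only: C0 C0' integrable_zero)
    have "AE w in P. w \<in> ?C \<or> (\<exists>n. w \<in> ?B n)"
      using AE_not_in[OF M] AE_space
    proof eventually_elim
      case (elim w)
      show ?case
      proof (cases "T w < top")
        case True
        then obtain x where x: "T w = ennreal x" "0 \<le> x" by (cases "T w" rule: ennreal_cases) auto
        obtain n where "x < real n" "ennreal x < S n w" using large[OF elim(2,1)] by blast
        then show ?thesis using x elim(2) by (auto simp: ennreal_less_iff)
      qed (use elim in auto)
    qed
    moreover have "AE w in P. \<forall>n. w \<in> ?B n \<longrightarrow> ?proj w"
      unfolding AE_all_countable using Bn by blast
    ultimately have "AE w in P. ?proj w"
      using Cn by eventually_elim blast
    then show ?thesis using Xm by (simp only: AE_conj_iff)
  qed
  then have "is_optional_projection P G X N" using Nopt by (simp add: is_optional_projection_def)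
  then show ?thesis using NcadAE by blast
qed

end

section \<open>The reducing sequence\<close>

lemma ennreal_tendsto_infinity:
  fixes f :: "nat \<Rightarrow> ennreal"
  assumes "\<And>l. 0 \<le> l \<Longrightarrow> eventually (\<lambda>n. ennreal l \<le> f n) sequentially"
  shows "f \<longlonglongrightarrow> \<infinity>"
proof (rule order_tendstoI)
  fix a :: ennreal assume a: "a < \<infinity>"
  obtain x where x: "a = ennreal x" "0 \<le> x" using a by (cases a rule: ennreal_cases) auto
  have "eventually (\<lambda>n. ennreal (x + 1) \<le> f n) sequentially" using x by (intro assms) simp
  then show "eventually (\<lambda>n. a < f n) sequentially"
  proof eventually_elim
    case (elim n)
    have "a < ennreal (x + 1)" using x by (simp add: ennreal_lessI)
    then show ?case using elim by (rule less_le_trans)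
  qed
qed (simp add: top.not_eq_extremum)

text \<open>On right-continuous paths rational times give the same infimum as all times, strict
  exceedance being an open condition; the restriction makes the relevant events countable unions.
  The infimum of the empty set is infinite, as it should be for a path staying within the
  level.\<close>

definition exceed_time :: "(real \<Rightarrow> 'a \<Rightarrow> real) \<Rightarrow> real \<Rightarrow> 'a \<Rightarrow> ennreal" where
  "exceed_time M c w = (INF q\<in>{q \<in> \<rat>. 0 \<le> q \<and> c < \<bar>M q w\<bar>}. ennreal q)"

context usual_filtered_space
begin

text \<open>That the time is strictly before \<open>u\<close> is decided by rationals before
  \<open>u\<close>. The non-strict inequality at \<open>t\<close> looks slightly beyond
  \<open>t\<close>, and right continuity of the filtration closes this gap.\<close>

lemma exceed_time_stop:
  assumes "adapted G M" shows "stop_time P G (exceed_time M c)"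
  unfolding stop_time_def
proof (intro allI impI)
  fix t :: real assume t: "0 \<le> t"
  have less: "{w \<in> space P. exceed_time M c w < ennreal u} \<in> sets (G u)" if u: "0 \<le> u" for u
  proof -
    have eq: "{w \<in> space P. exceed_time M c w < ennreal u} = (\<Union>q\<in>\<rat> \<inter> {0..<u}. {w \<in> space (G q). c < \<bar>M q w\<bar>})"
      using space_G by (auto simp: exceed_time_def INF_less_iff ennreal_less_iff)
    show ?thesis unfolding eq
    proof (rule sets.countable_UN'')
      show "countable (\<rat> \<inter> {0..<u})" using countable_rat by auto
      fix q assume q: "q \<in> \<rat> \<inter> {0..<u}"
      have [measurable]: "M q \<in> borel_measurable (G q)" using assms q by (simp add: adapted_def)
      have "{w \<in> space (G q). c < \<bar>M q w\<bar>} \<in> sets (G q)" by measurable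
      then show "{w \<in> space (G q). c < \<bar>M q w\<bar>} \<in> sets (G u)"
        by (rule sets_G_mono[rotated 2]) (use q in auto)
    qed
  qed
  have "{w \<in> space P. exceed_time M c w \<le> ennreal t} \<in> sets (G u)" if u: "t < u" for u
  proof -
    let ?d = "\<lambda>j::nat. t + (u - t) / (real j + 1)"
    have d: "t < ?d j" "?d j \<le> u" for j
    proof -
      show "t < ?d j" using u by simp
      have "(u - t) / (real j + 1) \<le> (u - t) / 1" by (rule divide_left_mono) (use u in auto)
      then show "?d j \<le> u" by simp
    qed
    have dlim: "\<exists>j. ?d j < c" if c: "t < c" for c
    proof -
      obtain j :: nat where "(u - t) / (c - t) < real j" using reals_Archimedean2 by blast
      then have "u - t < real j * (c - t)" using c by (simp add: field_simps)
      also have "\<dots> \<le> (real j + 1) * (c - t)" using c by (intro mult_right_mono) auto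
      finally have "(u - t) / (real j + 1) < c - t" by (simp add: field_simps)
      then show ?thesis by (intro exI[of _ j]) simp
    qed
    have eq: "{w \<in> space P. exceed_time M c w \<le> ennreal t}
        = (\<Inter>j. {w \<in> space P. exceed_time M c w < ennreal (?d j)})"
    proof (intro set_eqI iffI)
      fix w assume mem: "w \<in> {w \<in> space P. exceed_time M c w \<le> ennreal t}"
      have "exceed_time M c w < ennreal (?d j)" for j
      proof (rule le_less_trans)
        show "exceed_time M c w \<le> ennreal t" using mem by simp
        have "0 < ?d j" using t d(1)[of j] by linarith
        then show "ennreal t < ennreal (?d j)" using d(1)[of j] by (rule ennreal_lessI)
      qed
      then show "w \<in> (\<Inter>j. {w \<in> space P. exceed_time M c w < ennreal (?d j)})" using mem by auto
    next
      fix w assume mem: "w \<in> (\<Inter>j. {w \<in> space P. exceed_time M c w < ennreal (?d j)})"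
      have "exceed_time M c w \<le> ennreal t"
      proof (rule ccontr)
        assume "\<not> ?thesis"
        then obtain b where b: "t < b" "ennreal b \<le> exceed_time M c w"
          using ennreal_less_witness[of t "exceed_time M c w"] t by (auto simp: not_le)
        obtain j where "?d j < b" using dlim[OF b(1)] by blast
        then have "ennreal (?d j) \<le> exceed_time M c w"
          by (intro order_trans[OF ennreal_leI b(2)]) simp
        moreover have "exceed_time M c w < ennreal (?d j)" using mem by blast
        ultimately show False by simp
      qed
      then show "w \<in> {w \<in> space P. exceed_time M c w \<le> ennreal t}" using mem by blast
    qed
    have "{w \<in> space P. exceed_time M c w < ennreal (?d j)} \<in> sets (G u)" for j
      by (rule sets_G_mono[OF _ d(2) less]) (use d(1)[of j] t in auto)
    then show ?thesis unfolding eq by (intro sets.countable_INT) auto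
  qed
  then have "{w \<in> space P. exceed_time M c w \<le> ennreal t} \<in> (\<Inter>u\<in>{t<..}. sets (G u))" by blast
  then show "{w \<in> space P. exceed_time M c w \<le> ennreal t} \<in> sets (G t)"
    using rc t unfolding right_continuous_filtration_def by blast
qed

text \<open>The bound \<open>V\<close> is not assumed measurable, so its integral is a lower integral; the running
  supremum of \<open>\<bar>A\<bar>\<close> is measurable and lies below \<open>V\<close>, which is all that is needed.\<close>

lemma ex_reducing_sequence:
  fixes A :: "real \<Rightarrow> 'a \<Rightarrow> real" and V :: "real \<Rightarrow> 'a \<Rightarrow> ennreal"
  assumes M: "local_martingale P G M"
    and Am: "\<And>t. 0 \<le> t \<Longrightarrow> A t \<in> borel_measurable P" and Ac: "AE w in P. cadlag (\<lambda>t. A t w)"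
    and AV: "\<And>t r w. 0 \<le> r \<Longrightarrow> r \<le> t \<Longrightarrow> ennreal \<bar>A r w\<bar> \<le> V t w"
    and V: "\<And>t. 0 \<le> t \<Longrightarrow> (\<integral>\<^sup>+w. V t w \<partial>P) < \<infinity>"
  shows "\<exists>S. (\<forall>n::nat. stop_time P G (S n)) \<and>
    (AE w in P. incseq (\<lambda>n. S n w) \<and> (\<lambda>n. S n w) \<longlonglongrightarrow> \<infinity>) \<and>
    (\<forall>n t. 0 \<le> t \<longrightarrow> (\<exists>D. integrable P D \<and> (AE w in P. 0 < S n w \<longrightarrow>
        (\<forall>r. 0 \<le> r \<longrightarrow> r \<le> t \<longrightarrow> ennreal r \<le> S n w \<longrightarrow> \<bar>M r w - A r w\<bar> \<le> D w))))"
proof -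
  obtain T where T: "\<And>n::nat. stop_time P G (T n)"
    and Tlim: "AE w in P. incseq (\<lambda>n. T n w) \<and> (\<lambda>n. T n w) \<longlonglongrightarrow> \<infinity>"
    and Tm: "\<And>n. martingale P G (stopped_process M (T n))"
    and Ma: "adapted G M" and Mc: "AE w in P. cadlag (\<lambda>t. M t w)"
    using M unfolding local_martingale_def by blast
  let ?R = "\<lambda>n::nat. exceed_time M (real n)"
  define S where "S n w = min (T n w) (?R n w)" for n w
  have Rstop: "stop_time P G (?R n)" for n by (rule exceed_time_stop[OF Ma])
  have Sstop: "stop_time P G (S n)" for n unfolding S_def by (rule stop_time_min[OF T Rstop])
  have Slim: "AE w in P. incseq (\<lambda>n. S n w) \<and> (\<lambda>n. S n w) \<longlonglongrightarrow> \<infinity>"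
    using Tlim Mc
  proof eventually_elim
    case (elim w)
    have Rinc: "incseq (\<lambda>n. ?R n w)"
    proof (rule monoI)
      fix m n :: nat assume "m \<le> n"
      then have "real m \<le> real n" by simp
      then show "?R m w \<le> ?R n w"
        unfolding exceed_time_def by (intro INF_superset_mono) auto
    qed
    have "incseq (\<lambda>n. S n w)"
      unfolding S_def using elim Rinc by (intro monoI min.mono) (auto dest: monoD)
    moreover have "(\<lambda>n. S n w) \<longlonglongrightarrow> \<infinity>"
    proof (rule ennreal_tendsto_infinity)
      fix l :: real assume l: "0 \<le> l"
      obtain B where B: "\<And>s. s \<in> {0..l} \<Longrightarrow> \<bar>M s w\<bar> \<le> B" using cadlag_bounded[OF elim(2) l] by blast
      obtain m :: nat where m: "B \<le> real m" using real_arch_simple by blast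
      \<comment> \<open>A cadlag path is bounded on \<open>[0, l]\<close>, so levels above that
        bound are not exceeded before \<open>l\<close>.\<close>
      have "ennreal l \<le> ?R n w" if n: "m \<le> n" for n
        unfolding exceed_time_def
      proof (rule INF_greatest)
        fix q assume q: "q \<in> {q \<in> \<rat>. 0 \<le> q \<and> real n < \<bar>M q w\<bar>}"
        have "B \<le> real n" using m n by simp
        then have "l < q" using B[of q] q by force
        then show "ennreal l \<le> ennreal q" by (intro ennreal_leI) simp
      qed
      then have "eventually (\<lambda>n. ennreal l \<le> ?R n w) sequentially" by (auto simp: eventually_sequentially)
      moreover have "eventually (\<lambda>n. ennreal l < T n w) sequentially"
        using elim by (intro order_tendstoD(1)[where y = \<infinity>]) auto
      ultimately show "eventually (\<lambda>n. ennreal l \<le> S n w) sequentially"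
        by eventually_elim (simp add: S_def)
    qed
    ultimately show ?case by blast
  qed
  have dom: "\<exists>D. integrable P D \<and> (AE w in P. 0 < S n w \<longrightarrow>
        (\<forall>r. 0 \<le> r \<longrightarrow> r \<le> t \<longrightarrow> ennreal r \<le> S n w \<longrightarrow> \<bar>M r w - A r w\<bar> \<le> D w))"
    if t: "0 \<le> t" for n t
  proof -
    define \<theta> where "\<theta> w = enn2real (min (ennreal t) (?R n w))" for w
    have fin: "min (ennreal t) x < top" for x by (simp add: min_less_iff_disj)
    have th: "space P \<in> past \<theta>" "0 \<le> \<theta> w \<and> \<theta> w \<le> t" for w
      unfolding \<theta>_def using space_past_stop[OF stop_time_min[OF stop_time_const[OF t] Rstop] fin] fin t
      by (auto simp: enn2real_le_iff_ennreal)
    have the: "ennreal (\<theta> w) = min (ennreal t) (?R n w)" for w using fin by (simp add: \<theta>_def)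
    let ?Z = "stopped_process M (T n)"
    have Zi: "integrable P (\<lambda>w. ?Z (\<theta> w) w)"
      by (rule optional_stopping(1)[OF t martingale_closed_by[OF Tm t] cadlag_AE_right th])
        (use Tm in \<open>simp add: martingale_def\<close>)
    \<comment> \<open>The end point is added by hand: it may be irrational, and it is not approached
      from the right within \<open>[0, t]\<close>.\<close>
    let ?Q = "insert t (\<rat> \<inter> {0..t})"
    define U where "U w = (SUP q\<in>?Q. ennreal \<bar>A q w\<bar>)" for w
    have Um: "U \<in> borel_measurable P"
      unfolding U_def
    proof (rule borel_measurable_SUP)
      show "countable ?Q" using countable_rat by auto
      show "(\<lambda>w. ennreal \<bar>A q w\<bar>) \<in> borel_measurable P" if "q \<in> ?Q" for q
      proof -
        have [measurable]: "A q \<in> borel_measurable P" using that t by (intro Am) auto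
        show ?thesis by measurable
      qed
    qed
    have "(\<integral>\<^sup>+w. U w \<partial>P) \<le> (\<integral>\<^sup>+w. V t w \<partial>P)"
      unfolding U_def by (intro nn_integral_mono SUP_least AV) (use t in auto)
    then have Ufin: "(\<integral>\<^sup>+w. U w \<partial>P) < \<infinity>" using V[OF t] by (rule le_less_trans)
    have Ui: "integrable P (\<lambda>w. enn2real (U w))"
    proof (rule integrableI_bounded)
      have "ennreal (norm (enn2real x)) \<le> x" for x :: ennreal
        by (cases x rule: ennreal_cases) auto
      then have "(\<integral>\<^sup>+w. ennreal (norm (enn2real (U w))) \<partial>P) \<le> (\<integral>\<^sup>+w. U w \<partial>P)" by (intro nn_integral_mono)
      then show "(\<integral>\<^sup>+w. ennreal (norm (enn2real (U w))) \<partial>P) < \<infinity>" using Ufin by (rule le_less_trans)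
    qed (use Um in measurable)
    \<comment> \<open>Strictly before \<open>\<theta>\<close> the path of \<open>M\<close> stays
      within \<open>real n\<close>. At \<open>\<theta>\<close> it may jump beyond any constant; that
      value belongs to the reduced martingale \<open>?Z\<close> and is integrable by optional
      stopping.\<close>
    define D where "D w = real n + \<bar>?Z (\<theta> w) w\<bar> + enn2real (U w)" for w
    have Di: "integrable P D"
      unfolding D_def by (intro Bochner_Integration.integrable_add integrable_const integrable_abs Zi Ui)
    \<comment> \<open>Finiteness matters because \<open>enn2real\<close> would turn an infinite
      supremum into zero.\<close>
    have "AE w in P. U w \<noteq> \<infinity>" by (rule nn_integral_noteq_infinite[OF Um]) (use Ufin in simp)
    then have "AE w in P. 0 < S n w \<longrightarrow>
        (\<forall>r. 0 \<le> r \<longrightarrow> r \<le> t \<longrightarrow> ennreal r \<le> S n w \<longrightarrow> \<bar>M r w - A r w\<bar> \<le> D w)"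
      using Ac Mc
    proof eventually_elim
      case (elim w)
      have Aq: "\<bar>A q w\<bar> \<le> enn2real (U w)" if "q \<in> ?Q" for q
      proof -
        have "ennreal \<bar>A q w\<bar> \<le> U w" unfolding U_def using that by (rule SUP_upper)
        then show ?thesis using elim(1) by (cases "U w" rule: ennreal_cases) auto
      qed
      have Ar: "\<bar>A r w\<bar> \<le> enn2real (U w)" if r: "0 \<le> r" "r \<le> t" for r
      proof (cases "r = t")
        case False
        show ?thesis
          by (rule abs_le_of_right_limit[of "\<lambda>r. A r w" r t]) (use elim(2) r False Aq in \<open>auto simp: cadlag_def\<close>)
      qed (use Aq in auto)
      have Mr: "\<bar>M r w\<bar> \<le> real n + \<bar>?Z (\<theta> w) w\<bar>"
        if S0: "0 < S n w" and r: "0 \<le> r" "r \<le> t" "ennreal r \<le> S n w" for r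
      proof (cases "r < \<theta> w")
        case True
        have "\<bar>M r w\<bar> \<le> real n"
        proof (rule abs_le_of_right_limit[of "\<lambda>r. M r w" r "\<theta> w"])
          fix q assume q: "q \<in> \<rat>" "r < q" "q < \<theta> w"
          show "\<bar>M q w\<bar> \<le> real n"
          proof (rule ccontr)
            assume "\<not> ?thesis"
            then have "?R n w \<le> ennreal q"
              unfolding exceed_time_def using q r by (intro INF_lower) auto
            moreover have "ennreal (\<theta> w) \<le> ?R n w" unfolding the by simp
            ultimately have "ennreal (\<theta> w) \<le> ennreal q" by (rule order_trans[rotated])
            then show False using q r by (simp add: ennreal_le_iff)
          qed
        qed (use True elim(3) r in \<open>auto simp: cadlag_def\<close>)
        then show ?thesis by simp
      next
        case False
        have "ennreal r \<le> ennreal (\<theta> w)"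
          unfolding the using r by (auto simp: S_def intro: ennreal_leI)
        then have "r \<le> \<theta> w" using th(2)[of w] by simp
        then have req: "\<theta> w = r" using False by simp
        have "?Z r w = M r w"
          using S0 r by (simp add: stopped_process_def S_def min_absorb1)
        then show ?thesis unfolding req by simp
      qed
      show ?case
      proof (intro impI allI)
        fix r assume "0 < S n w" "0 \<le> r" "r \<le> t" "ennreal r \<le> S n w"
        then show "\<bar>M r w - A r w\<bar> \<le> D w"
          using Ar[of r] Mr[of r] unfolding D_def by linarith
      qed
    qed
    with Di show ?thesis by blast
  qed
  show ?thesis using Sstop Slim dom by blast
qed

end

text \<open>An intersection of \<sigma>-fields is itself one; in the augmented and the expanded
  filtration \<open>sigma\<close> merely wraps it into a value of type
  \<open>measure\<close>.\<close>

lemma sets_sigma_INT: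
  assumes "\<And>i. i \<in> I \<Longrightarrow> a i \<subseteq> Pow \<Omega>" "I \<noteq> {}"
  shows "sets (sigma \<Omega> (\<Inter>i\<in>I. sigma_sets \<Omega> (a i))) = (\<Inter>i\<in>I. sigma_sets \<Omega> (a i))"
proof -
  have "sigma_sets \<Omega> (a i) \<subseteq> Pow \<Omega>" if "i \<in> I" for i
    using sigma_sets_into_sp[OF assms(1)[OF that]] by blast
  then have "(\<Inter>i\<in>I. sigma_sets \<Omega> (a i)) \<subseteq> Pow \<Omega>" using assms(2) by blast
  then have "sets (sigma \<Omega> (\<Inter>i\<in>I. sigma_sets \<Omega> (a i))) = sigma_sets \<Omega> (\<Inter>i\<in>I. sigma_sets \<Omega> (a i))"
    by (rule sets_measure_of)
  moreover have "sigma_sets \<Omega> (\<Inter>i\<in>I. sigma_sets \<Omega> (a i)) \<subseteq> sigma_sets \<Omega> (a i)" if "i \<in> I" for i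
  proof -
    have "sigma_sets \<Omega> (\<Inter>i\<in>I. sigma_sets \<Omega> (a i)) \<subseteq> sigma_sets \<Omega> (sigma_sets \<Omega> (a i))"
      by (rule sigma_sets_subseteq) (use that in blast)
    then show ?thesis by (simp add: sigma_sets_sigma_sets_eq[OF assms(1)[OF that]])
  qed
  ultimately show ?thesis by (auto intro: sigma_sets.Basic)
qed

text \<open>In the non-integrable case the Bochner integral is zero by convention, so the estimate
  holds for every integrand.\<close>

lemma set_integral_abs_le_nn_integral:
  fixes f :: "'b \<Rightarrow> real"
  shows "ennreal \<bar>LINT x:B|M. f x\<bar> \<le> (\<integral>\<^sup>+x\<in>B. ennreal \<bar>f x\<bar> \<partial>M)"
proof (cases "integrable M (\<lambda>x. indicator B x *\<^sub>R f x)")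
  case True
  have "ennreal \<bar>LINT x:B|M. f x\<bar> \<le> (\<integral>\<^sup>+x. ennreal (norm (indicator B x *\<^sub>R f x)) \<partial>M)"
    using integral_norm_bound_ennreal[OF True] by (simp add: set_lebesgue_integral_def)
  also have "\<dots> = (\<integral>\<^sup>+x\<in>B. ennreal \<bar>f x\<bar> \<partial>M)"
    by (intro nn_integral_cong) (auto split: split_indicator)
  finally show ?thesis .
next
  case False
  then show ?thesis by (simp add: set_lebesgue_integral_def not_integrable_integral_eq)
qed

text \<open>The three filtrations meet here: the sequence is built in \<open>F\<close> from
  \<open>M\<close> and the drift \<open>M - X\<close>, it consists of stopping times of the larger
  \<open>G\<close>, and it dominates \<open>X\<close>, a local martingale of the still larger
  \<open>H\<close>.\<close>

lemma optional_projection_of_local_martingale: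
  fixes P :: "'a measure" and V :: "real \<Rightarrow> 'a \<Rightarrow> ennreal"
  assumes "usual_filtered_space P F" "usual_filtered_space P G" "complete_filtered_space P H"
    and FG: "\<And>t. 0 \<le> t \<Longrightarrow> sets (F t) \<subseteq> sets (G t)" and GH: "\<And>t. 0 \<le> t \<Longrightarrow> sets (G t) \<subseteq> sets (H t)"
    and M: "local_martingale P F M" and X: "local_martingale P H X"
    and XV: "\<And>t r w. 0 \<le> r \<Longrightarrow> r \<le> t \<Longrightarrow> ennreal \<bar>M r w - X r w\<bar> \<le> V t w"
    and V: "\<And>t. 0 \<le> t \<Longrightarrow> (\<integral>\<^sup>+w. V t w \<partial>P) < \<infinity>"
  shows "(\<exists>N. is_optional_projection P G X N \<and> local_martingale P G N) \<and>
         (\<forall>N. is_optional_projection P G X N \<longrightarrow> (AE w in P. cadlag (\<lambda>t. N t w)) \<longrightarrow> local_martingale P G N)"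
proof -
  interpret F: usual_filtered_space P F by fact
  interpret G: usual_filtered_space P G by fact
  interpret H: complete_filtered_space P H by fact
  let ?A = "\<lambda>t w. M t w - X t w"
  have Am: "?A t \<in> borel_measurable P" if t: "0 \<le> t" for t
  proof -
    have "M t \<in> borel_measurable P"
      using M t F.measurable_G[OF t] by (auto simp: local_martingale_def adapted_def)
    moreover have "X t \<in> borel_measurable P"
      using X t H.measurable_G[OF t] by (auto simp: local_martingale_def adapted_def)
    ultimately show ?thesis by measurable
  qed
  have "AE w in P. cadlag (\<lambda>t. M t w)" "AE w in P. cadlag (\<lambda>t. X t w)"
    using M X by (auto simp: local_martingale_def)
  then have Ac: "AE w in P. cadlag (\<lambda>t. ?A t w)" by eventually_elim (rule cadlag_diff)
  obtain S where Sstop: "\<And>n::nat. stop_time P F (S n)"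
    and Slim: "AE w in P. incseq (\<lambda>n. S n w) \<and> (\<lambda>n. S n w) \<longlonglongrightarrow> \<infinity>"
    and Sdom: "\<And>n t. 0 \<le> t \<Longrightarrow> \<exists>D. integrable P D \<and> (AE w in P. 0 < S n w \<longrightarrow>
        (\<forall>r. 0 \<le> r \<longrightarrow> r \<le> t \<longrightarrow> ennreal r \<le> S n w \<longrightarrow> \<bar>X r w\<bar> \<le> D w))"
  proof -
    have MAX: "M r w - ?A r w = X r w" for r w by simp
    show ?thesis
      using F.ex_reducing_sequence[where A = ?A and V = V, OF M Am Ac XV V] that
      unfolding MAX by blast
  qed
  interpret reduced_local_martingale P G H X S
  proof unfold_locales
    show "stop_time P G (S n)" for n using Sstop[of n] FG by (auto simp: stop_time_def)
  qed (use GH X Slim Sdom in auto)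
  show ?thesis using ex_optional_projection projection_local_martingale by blast
qed

theorem theorem10:
  fixes P :: "'a measure"
    and W M C :: "real \<Rightarrow> 'a \<Rightarrow> real"
    and F G :: "real \<Rightarrow> 'a measure"
    and \<tau> :: "'a \<Rightarrow> real"
    and \<eta> :: "real measure"
    and p q k :: "real \<Rightarrow> real \<Rightarrow> 'a \<Rightarrow> real"
  assumes "prob_space P" and "complete_measure P"
    and "brownian_motion P W"
    and "F = augmented_filtration P W"
    and "\<tau> \<in> borel_measurable P" and "\<forall>\<omega>\<in>space P. 0 \<le> \<tau> \<omega>"
    and "jacod_criterion P F \<tau> \<eta>"
    and "filtration_on P G" and "right_continuous_filtration G"
    and "\<forall>t\<ge>0. sets (F t) \<subseteq> sets (G t) \<and> sets (G t) \<subseteq> sets (initial_expansion P F \<tau> t)"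
    and "stop_time P G (\<lambda>\<omega>. ennreal (\<tau> \<omega>))"
    and "\<forall>t\<ge>0. {A \<inter> {\<omega> \<in> space P. t < \<tau> \<omega>} | A. A \<in> sets (G t)}
              = {A \<inter> {\<omega> \<in> space P. t < \<tau> \<omega>} | A. A \<in> sets (F t)}"
    and "conditional_density P F \<tau> \<eta> p"
    and "\<forall>u\<ge>0. ito_integral P F W (\<lambda>t. q t u) (\<lambda>t \<omega>. p t u \<omega> - p 0 u \<omega>)"
    and "\<exists>K :: real \<Rightarrow> 'a \<Rightarrow> real. (\<forall>s\<ge>0. integrable P (K s)) \<and>
           (AE \<omega> in P. \<forall>u\<ge>0. \<forall>s\<ge>0. \<bar>q s u \<omega>\<bar> \<le> K s \<omega>)"
    and "local_martingale P F M"
    and "angle_bracket_self P F M C"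
    and "jacod_function P F \<tau> \<eta> p M C k"
    and "\<forall>t\<ge>0. (\<integral>\<^sup>+\<omega>. (\<integral>\<^sup>+s\<in>{0<..t}. ennreal \<bar>k s (\<tau> \<omega>) \<omega>\<bar> \<partial>path_measure C \<omega>) \<partial>P) < \<infinity>"
  shows "(\<exists>N. is_optional_projection P G (expansion_part M C k \<tau>) N \<and> local_martingale P G N) \<and>
         (\<forall>N. is_optional_projection P G (expansion_part M C k \<tau>) N \<longrightarrow>
              (AE \<omega> in P. cadlag (\<lambda>t. N t \<omega>)) \<longrightarrow> local_martingale P G N)"
proof -
  interpret prob_space P by fact
  interpret complete_measure P by fact
  let ?g = "\<lambda>u. {W s -` B \<inter> space P | s B. 0 \<le> s \<and> s \<le> u \<and> B \<in> sets borel} \<union> null_sets P"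
  let ?n = "\<lambda>u. sigma_sets (space P) (?g u)"
  have gPow: "?g u \<subseteq> Pow (space P)" for u by (auto dest: null_setsD2 sets.sets_into_space)
  have Fsets: "sets (F t) = (\<Inter>u\<in>{t<..}. ?n u)" for t
    unfolding assms(4) augmented_filtration_def by (rule sets_sigma_INT[OF gPow]) auto
  have Fspace: "space (F t) = space P" for t
    unfolding assms(4) augmented_filtration_def by (simp add: space_measure_of_conv)
  have FG: "sets (F t) \<subseteq> sets (G t)" and GH: "sets (G t) \<subseteq> sets (initial_expansion P F \<tau> t)" if "0 \<le> t" for t
    using assms(10) that by auto
  have GP: "sets (G t) \<subseteq> sets P" if "0 \<le> t" for t
    using assms(8) that by (auto simp: filtration_on_def subalgebra_def)
  have FP: "sets (F t) \<subseteq> sets P" if "0 \<le> t" for t using FG[OF that] GP[OF that] by (rule order_trans)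
  have Fmono: "sets (F s) \<subseteq> sets (F t)" if "s \<le> t" for s t
    unfolding Fsets using that by (intro INF_superset_mono) auto
  have nullF: "null_sets P \<subseteq> sets (F t)" for t
    unfolding Fsets by (auto intro: sigma_sets.Basic)
  have F: "usual_filtered_space P F"
  proof unfold_locales
    show "filtration_on P F" using FP Fmono Fspace by (simp add: filtration_on_def subalgebra_def)
    show "null_sets P \<subseteq> sets (F 0)" by (rule nullF)
    show "right_continuous_filtration F"
      unfolding right_continuous_filtration_def
    proof (intro allI impI antisym)
      fix t :: real
      show "sets (F t) \<subseteq> (\<Inter>u\<in>{t<..}. sets (F u))" using Fmono by (auto intro: less_imp_le)
      show "(\<Inter>u\<in>{t<..}. sets (F u)) \<subseteq> sets (F t)"
      proof
        fix A assume A: "A \<in> (\<Inter>u\<in>{t<..}. sets (F u))"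
        have "A \<in> ?n u" if u: "t < u" for u
        proof -
          \<comment> \<open>The midpoint is strictly between \<open>t\<close> and \<open>u\<close>,
            so the intersection defining \<open>F\<close> at the midpoint still runs over
            \<open>u\<close>.\<close>
          have "A \<in> sets (F ((t + u) / 2))" using A u by auto
          then show ?thesis using u unfolding Fsets by auto
        qed
        then show "A \<in> sets (F t)" unfolding Fsets by blast
      qed
    qed
  qed
  have G: "usual_filtered_space P G"
  proof unfold_locales
    show "null_sets P \<subseteq> sets (G 0)" using nullF[of 0] FG[of 0] by auto
  qed (rule assms(8,9))+
  let ?H = "initial_expansion P F \<tau>"
  let ?h = "\<lambda>u. sets (F u) \<union> {\<tau> -` B \<inter> space P | B. B \<in> sets borel}"
  have hP: "?h u \<subseteq> sets P" if "0 \<le> u" for u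
    using FP[OF that] measurable_sets[OF assms(5)] by auto
  have Hsets: "sets (?H t) = (\<Inter>u\<in>{t<..}. sigma_sets (space P) (?h u))" if t: "0 \<le> t" for t
    unfolding initial_expansion_def
  proof (rule sets_sigma_INT)
    fix u assume "u \<in> {t<..}"
    then have "?h u \<subseteq> sets P" using t by (intro hP) simp
    also have "\<dots> \<subseteq> Pow (space P)" by (rule sets.space_closed)
    finally show "?h u \<subseteq> Pow (space P)" .
  qed auto
  have H: "complete_filtered_space P ?H"
  proof unfold_locales
    have "subalgebra P (?H t)" if t: "0 \<le> t" for t
      unfolding subalgebra_def
    proof
      show "space (?H t) = space P" by (simp add: initial_expansion_def space_measure_of_conv)
      have "sets (?H t) \<subseteq> sigma_sets (space P) (?h (t + 1))" unfolding Hsets[OF t] by auto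
      also have "\<dots> \<subseteq> sets P" by (rule sets.sigma_sets_subset[OF hP]) (use t in simp)
      finally show "sets (?H t) \<subseteq> sets P" .
    qed
    moreover have "sets (?H s) \<subseteq> sets (?H t)" if "0 \<le> s" "s \<le> t" for s t
      using that Hsets[of s] Hsets[of t] by (auto intro!: INF_superset_mono)
    ultimately show "filtration_on P ?H" by (simp add: filtration_on_def)
    show "null_sets P \<subseteq> sets (?H 0)" using nullF[of 0] FG[of 0] GH[of 0] by auto
  qed
  show ?thesis
  proof (rule optional_projection_of_local_martingale[OF F G H FG GH])
    show "local_martingale P F M" by fact
    show "local_martingale P ?H (expansion_part M C k \<tau>)"
      using assms(18) by (simp add: jacod_function_def)
    \<comment> \<open>The absolute integral bounds the drift and increases with its upper limit, so
      its value at \<open>t\<close> serves all earlier times.\<close>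
    let ?V = "\<lambda>t w. \<integral>\<^sup>+s\<in>{0<..t}. ennreal \<bar>k s (\<tau> w) w\<bar> \<partial>path_measure C w"
    show "(\<integral>\<^sup>+w. ?V t w \<partial>P) < \<infinity>" if "0 \<le> t" for t using assms(19) that by blast
    show "ennreal \<bar>M r w - expansion_part M C k \<tau> r w\<bar> \<le> ?V t w" if "0 \<le> r" "r \<le> t" for t r w
    proof -
      have "ennreal \<bar>M r w - expansion_part M C k \<tau> r w\<bar> \<le> ?V r w"
        unfolding expansion_part_def using set_integral_abs_le_nn_integral by simp
      also have "\<dots> \<le> ?V t w"
        by (intro nn_integral_mono) (use that in \<open>auto split: split_indicator\<close>)
      finally show ?thesis .
    qed
  qed auto
qed

end
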